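(* Assume that pseudorandom function families exist. Then for every constant $\epsilon>0$, there is no algorithm that, given the $2^n$-bit truth table of a function $f\in B_n$, runs in time $2^{O(n)}$ and approximates $c_\wedge(f)$ with approximation factor $\rho(n)\le(2-\epsilon)^{n/2}$, i.e. always outputs a value in the interval $[c_\wedge(f),\rho(n)c_\wedge(f)]$.
   Context: $B_n$ denotes the set of Boolean functions $\mathbb{F}_2^n\to\mathbb{F}_2$. An XOR-AND circuit is a Boolean circuit with fan-in 2 over the basis $(\land,\oplus,1)$. The multiplicative complexity $c_\wedge(f)$ of $f\in B_n$ is the smallest number of AND gates in an XOR-AND circuit computing $f$. A family $\{f_n\}_{n\in\mathbb{N}}$ with $f_n:\{0,1\}^n\times\{0,1\}^n\to\{0,1\}$ is a pseudorandom function family if $f$ is computable in polynomial time and for every probabilistic polynomial-time oracle Turing machine $A$, $\left|\Pr_{k\in_R\{0,1\}^n}[A^{f_n(k,\cdot)}(1^n)=1]-\Pr_{g\in_R B_n}[A^{g}(1^n)=1]\right|\le n^{-\omega(1)}$, where $\in_R$ means chosen uniformly at random and $A^H$ means $A$ has oracle access to $H$. *)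

theory Defs
  imports "HOL-Probability.Probability"
begin

section \<open>Boolean functions, XOR-AND circuits, multiplicative complexity\<close>

text \<open>
  Field elements are booleans, vectors of length \<open>n\<close> are lists of length \<open>n\<close>. A function on
  such vectors is represented by its extension with value \<open>False\<close> on all other lists, so that
  \<open>boolfuns n\<close> is a finite set with exactly \<open>2 ^ 2 ^ n\<close> elements.
\<close>

definition bvecs :: "nat \<Rightarrow> bool list set" where
  "bvecs n = {x. length x = n}"

definition boolfuns :: "nat \<Rightarrow> (bool list \<Rightarrow> bool) set" where
  "boolfuns n = {f. \<forall>x. x \<notin> bvecs n \<longrightarrow> \<not> f x}"

text \<open>
  A circuit is a straight-line program. On \<open>n\<close> inputs, wires \<open>0, \<dots>, n - 1\<close> carry the inputs and
  wire \<open>n + i\<close> carries the value of gate \<open>i\<close>; any wire may be designated as the output.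
\<close>

datatype gate = AndG nat nat | XorG nat nat | OneG

fun gate_val :: "bool list \<Rightarrow> gate \<Rightarrow> bool" where
  "gate_val ws (AndG i j) = (ws ! i \<and> ws ! j)"
| "gate_val ws (XorG i j) = (ws ! i \<noteq> ws ! j)"
| "gate_val ws OneG = True"

fun gate_inputs :: "gate \<Rightarrow> nat set" where
  "gate_inputs (AndG i j) = {i, j}"
| "gate_inputs (XorG i j) = {i, j}"
| "gate_inputs OneG = {}"

fun is_and :: "gate \<Rightarrow> bool" where
  "is_and (AndG i j) = True"
| "is_and (XorG i j) = False"
| "is_and OneG = False"

definition wf_circuit :: "nat \<Rightarrow> gate list \<Rightarrow> nat \<Rightarrow> bool" where
  "wf_circuit n gs out \<longleftrightarrow>
     (\<forall>i < length gs. \<forall>j \<in> gate_inputs (gs ! i). j < n + i) \<and> out < n + length gs"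

definition wire_vals :: "gate list \<Rightarrow> bool list \<Rightarrow> bool list" where
  "wire_vals gs x = foldl (\<lambda>ws g. ws @ [gate_val ws g]) x gs"

definition circuit_computes :: "nat \<Rightarrow> gate list \<Rightarrow> nat \<Rightarrow> (bool list \<Rightarrow> bool) \<Rightarrow> bool" where
  "circuit_computes n gs out f \<longleftrightarrow>
     wf_circuit n gs out \<and> (\<forall>x \<in> bvecs n. wire_vals gs x ! out = f x)"

definition mult_complexity :: "nat \<Rightarrow> (bool list \<Rightarrow> bool) \<Rightarrow> nat" where
  "mult_complexity n f =
     (LEAST m. \<exists>gs out. circuit_computes n gs out f \<and> length (filter is_and gs) = m)"

text \<open>All vectors of length \<open>n\<close> in lexicographic order.\<close>

fun bvec_list :: "nat \<Rightarrow> bool list list" where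
  "bvec_list 0 = [[]]"
| "bvec_list (Suc n) = map (Cons False) (bvec_list n) @ map (Cons True) (bvec_list n)"

definition truth_table :: "nat \<Rightarrow> (bool list \<Rightarrow> bool) \<Rightarrow> bool list" where
  "truth_table n f = map f (bvec_list n)"

section \<open>Turing machines\<close>

text \<open>
  Multi-tape machines with one-way infinite tapes. States and tape symbols are initial segments
  of the natural numbers, of arbitrary finite size. Symbol 0 is the blank, symbol 1 marks the left
  end of each tape (cell 0), symbols 2 and 3 are the bits 0 and 1. Tape 0 is the input tape,
  tape 1 the output tape and, for oracle machines, tape 2 the query tape.
\<close>

datatype dir = MoveL | Stay | MoveR

type_synonym transition = "nat \<Rightarrow> nat list \<Rightarrow> nat \<times> (nat \<times> dir) list"

type_synonym tape = "(nat \<Rightarrow> nat) \<times> nat"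

type_synonym config = "nat \<times> tape list"

record tm =
  tm_tapes :: nat
  tm_symbols :: nat
  tm_states :: nat
  tm_start :: nat
  tm_halt :: nat
  tm_trans :: transition

definition wf_trans :: "'a tm_scheme \<Rightarrow> transition \<Rightarrow> bool" where
  "wf_trans M \<delta> \<longleftrightarrow>
     (\<forall>q < tm_states M. \<forall>ss. length ss = tm_tapes M \<and> set ss \<subseteq> {..<tm_symbols M} \<longrightarrow>
        fst (\<delta> q ss) < tm_states M \<and> length (snd (\<delta> q ss)) = tm_tapes M \<and>
        fst ` set (snd (\<delta> q ss)) \<subseteq> {..<tm_symbols M})"

definition wf_tm :: "'a tm_scheme \<Rightarrow> bool" where
  "wf_tm M \<longleftrightarrow> 2 \<le> tm_tapes M \<and> 4 \<le> tm_symbols M \<and>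
     tm_start M < tm_states M \<and> tm_halt M < tm_states M \<and> wf_trans M (tm_trans M)"

fun move :: "dir \<Rightarrow> nat \<Rightarrow> nat" where
  "move MoveL h = h - 1"
| "move Stay h = h"
| "move MoveR h = h + 1"

fun read_tape :: "tape \<Rightarrow> nat" where
  "read_tape (t, h) = t h"

fun act_tape :: "nat \<times> dir \<Rightarrow> tape \<Rightarrow> tape" where
  "act_tape (s, d) (t, h) = (t(h := s), move d h)"

definition apply_trans :: "transition \<Rightarrow> config \<Rightarrow> config" where
  "apply_trans \<delta> c =
     (let (q, as) = \<delta> (fst c) (map read_tape (snd c)) in (q, map2 act_tape as (snd c)))"

definition init_tape :: "bool list \<Rightarrow> tape" where
  "init_tape x =
     ((\<lambda>i. if i = 0 then 1 else if i \<le> length x then (if x ! (i - 1) then 3 else 2) else 0), 0)"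

definition init_config :: "'a tm_scheme \<Rightarrow> bool list \<Rightarrow> config" where
  "init_config M x = (tm_start M, init_tape x # replicate (tm_tapes M - 1) (init_tape []))"

text \<open>The bit string on a tape extends from cell 1 up to the first cell not holding a bit.\<close>

definition tape_word :: "tape \<Rightarrow> bool list" where
  "tape_word tp = map (\<lambda>i. fst tp i = 3) [1..<(LEAST j. 1 \<le> j \<and> fst tp j \<notin> {2, 3})]"

definition halted :: "'a tm_scheme \<Rightarrow> config \<Rightarrow> bool" where
  "halted M c \<longleftrightarrow> fst c = tm_halt M"

definition out_word :: "config \<Rightarrow> bool list" where
  "out_word c = tape_word (snd c ! 1)"

definition tm_step :: "tm \<Rightarrow> config \<Rightarrow> config" where
  "tm_step M c = (if halted M c then c else apply_trans (tm_trans M) c)"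

definition outputs_within :: "tm \<Rightarrow> bool list \<Rightarrow> nat \<Rightarrow> bool list \<Rightarrow> bool" where
  "outputs_within M x t y \<longleftrightarrow>
     (let c = (tm_step M ^^ t) (init_config M x) in halted M c \<and> out_word c = y)"

section \<open>Probabilistic oracle Turing machines\<close>

text \<open>
  A probabilistic machine has two transition functions; in every step a fair coin selects the one
  that is applied. In the query state, the oracle is applied to the word on the query tape, and the
  machine passes in one step to the yes or the no state without changing its tapes.
\<close>

record potm = tm +
  tm_trans' :: transition
  tm_query :: nat
  tm_yes :: nat
  tm_no :: nat

definition wf_potm :: "potm \<Rightarrow> bool" where
  "wf_potm A \<longleftrightarrow> wf_tm A \<and> 3 \<le> tm_tapes A \<and> wf_trans A (tm_trans' A) \<and>
     tm_query A < tm_states A \<and> tm_yes A < tm_states A \<and> tm_no A < tm_states A"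

definition potm_step :: "potm \<Rightarrow> (bool list \<Rightarrow> bool) \<Rightarrow> bool \<Rightarrow> config \<Rightarrow> config" where
  "potm_step A g b c =
     (if halted A c then c
      else if fst c = tm_query A
        then (if g (tape_word (snd c ! 2)) then tm_yes A else tm_no A, snd c)
      else apply_trans (if b then tm_trans' A else tm_trans A) c)"

text \<open>The configuration reached with oracle \<open>g\<close> and coin tosses \<open>r\<close> (one per step) on input \<open>1\<^sup>n\<close>.\<close>

definition potm_run :: "potm \<Rightarrow> (bool list \<Rightarrow> bool) \<Rightarrow> nat \<Rightarrow> bool list \<Rightarrow> config" where
  "potm_run A g n r = fold (potm_step A g) r (init_config A (replicate n True))"

definition potm_time :: "potm \<Rightarrow> (nat \<Rightarrow> nat) \<Rightarrow> bool" where
  "potm_time A p \<longleftrightarrow> (\<forall>n g. \<forall>r \<in> bvecs (p n). halted A (potm_run A g n r))"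

definition potm_accepts :: "potm \<Rightarrow> (bool list \<Rightarrow> bool) \<Rightarrow> nat \<Rightarrow> bool list \<Rightarrow> bool" where
  "potm_accepts A g n r \<longleftrightarrow> out_word (potm_run A g n r) = [True]"

section \<open>Pseudorandom function families\<close>

definition poly_bounded :: "(nat \<Rightarrow> nat) \<Rightarrow> bool" where
  "poly_bounded p \<longleftrightarrow> (\<exists>c. \<forall>n. p n \<le> n ^ c + c)"

definition poly_time_family :: "(nat \<Rightarrow> bool list \<Rightarrow> bool list \<Rightarrow> bool) \<Rightarrow> bool" where
  "poly_time_family f \<longleftrightarrow>
     (\<exists>M p. wf_tm M \<and> poly_bounded p \<and>
        (\<forall>n. \<forall>k \<in> bvecs n. \<forall>x \<in> bvecs n. outputs_within M (k @ x) (p n) [f n k x]))"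

definition keyed_fun ::
  "(nat \<Rightarrow> bool list \<Rightarrow> bool list \<Rightarrow> bool) \<Rightarrow> nat \<Rightarrow> bool list \<Rightarrow> bool list \<Rightarrow> bool" where
  "keyed_fun f n k = (\<lambda>x. x \<in> bvecs n \<and> f n k x)"

text \<open>
  The coin tosses are uniform on \<open>bvecs (p n)\<close>, where \<open>p\<close> bounds the running time. As halting
  configurations are never left, the probabilities do not depend on the choice of the bound.
\<close>

definition prob_keyed ::
  "(nat \<Rightarrow> bool list \<Rightarrow> bool list \<Rightarrow> bool) \<Rightarrow> potm \<Rightarrow> (nat \<Rightarrow> nat) \<Rightarrow> nat \<Rightarrow> real" where
  "prob_keyed f A p n =
     measure_pmf.prob (pair_pmf (pmf_of_set (bvecs n)) (pmf_of_set (bvecs (p n))))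
       {(k, r). potm_accepts A (keyed_fun f n k) n r}"

definition prob_random :: "potm \<Rightarrow> (nat \<Rightarrow> nat) \<Rightarrow> nat \<Rightarrow> real" where
  "prob_random A p n =
     measure_pmf.prob (pair_pmf (pmf_of_set (boolfuns n)) (pmf_of_set (bvecs (p n))))
       {(g, r). potm_accepts A g n r}"

text \<open>The bound \<open>\<nu>(n) \<le> n\<^bsup>-\<omega>(1)\<^esup>\<close>.\<close>

definition negligible :: "(nat \<Rightarrow> real) \<Rightarrow> bool" where
  "negligible \<nu> \<longleftrightarrow>
     (\<exists>h :: nat \<Rightarrow> real. filterlim h at_top at_top \<and>
        (\<forall>\<^sub>F n in at_top. \<nu> n \<le> real n powr (- h n)))"

definition prf_family :: "(nat \<Rightarrow> bool list \<Rightarrow> bool list \<Rightarrow> bool) \<Rightarrow> bool" where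
  "prf_family f \<longleftrightarrow> poly_time_family f \<and>
     (\<forall>A p. wf_potm A \<and> poly_bounded p \<and> potm_time A p \<longrightarrow>
        negligible (\<lambda>n. \<bar>prob_keyed f A p n - prob_random A p n\<bar>))"

section \<open>Approximating multiplicative complexity from the truth table\<close>

definition exp_bounded :: "(nat \<Rightarrow> nat) \<Rightarrow> bool" where
  "exp_bounded T \<longleftrightarrow> (\<exists>C n0. \<forall>n \<ge> n0. T n \<le> 2 ^ (C * n))"

text \<open>
  The time bound is a function of the number \<open>n\<close> of variables, not of the input length \<open>2 ^ n\<close>.
  The output is read as a natural number in binary, least significant bit first.
\<close>

definition approximates_mc :: "tm \<Rightarrow> (nat \<Rightarrow> nat) \<Rightarrow> (nat \<Rightarrow> real) \<Rightarrow> bool" where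
  "approximates_mc M T \<rho> \<longleftrightarrow>
     (\<forall>n. \<forall>f \<in> boolfuns n. \<exists>y. outputs_within M (truth_table n f) (T n) y \<and>
        real (horner_sum of_bool 2 y) \<in>
          {real (mult_complexity n f) .. \<rho> n * real (mult_complexity n f)})"

end

theory Submission imports Defs begin

text \<open>
  Write \<open>l\<close> for the bit length of \<open>n\<close>, and put \<open>m = (2 a + 3) l\<close> and \<open>t = (a + 1) l\<close> for a constant
  \<open>a\<close>. Given an approximation algorithm, a distinguisher restricts its oracle to \<open>m\<close> variables, queries
  the whole truth table (of polynomial size \<open>2 ^ m\<close>), runs the algorithm on it and accepts iff the
  output is at least \<open>2 ^ t\<close>. A keyed function is computed by polynomially many steps of a Turing
  machine, hence by a circuit with polynomially many AND gates, and for large \<open>a\<close> the factor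
  \<open>(2 - \<epsilon>) powr (m / 2)\<close> does not lift this to \<open>2 ^ t\<close>. On the other hand at most
  \<open>2 ^ ((2 s + 1) (m + 1 + s))\<close> functions have multiplicative complexity at most \<open>s\<close>, since every AND
  gate is determined by two affine combinations of the inputs and the preceding AND gates; as
  \<open>2 ^ (2 t)\<close> is smaller than \<open>2 ^ m\<close> by the factor \<open>2 ^ l\<close>, a random function almost always has
  complexity above \<open>2 ^ t\<close>.
\<close>

section \<open>Configurations of Turing machines\<close>

text \<open>The exponent n/2 is where the counting stops: it shows only that random functions of
  \<open>m\<close> variables have complexity about 2^(m/2), so a factor (2 - \<epsilon>)^(m/2)
  leaves a gap exponential in \<open>m\<close>. With \<open>m\<close> a large multiple of log n this
  gap becomes an arbitrarily high power of n and swallows the circuit size of the keyed functions.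

  Both \<open>m\<close> and \<open>t\<close> are integer multiples of \<open>l\<close>, so that they
  can be marked off as lengths on a tape, and the threshold is a power of two, so that the
  comparison is a search for a bit 1 at a high position.

  The obstacle is that the distinguisher has to be a concrete machine that halts in polynomial time
  for every n and every oracle, also for small n, where \<open>m\<close> may exceed n. It is
  therefore written in a small language whose translation into machines is verified once. It ignores
  its coins. For large n it accepts no keyed function and at least half of all functions, hence a
  constant advantage.\<close>

definition wf_config :: "'a tm_scheme \<Rightarrow> config \<Rightarrow> bool" where
  "wf_config M c \<longleftrightarrow> fst c < tm_states M \<and> length (snd c) = tm_tapes M \<and>
     (\<forall>tp \<in> set (snd c). \<forall>i. fst tp i < tm_symbols M)"

lemma wf_config_reads:
  assumes "wf_config M c"
  shows "length (map read_tape (snd c)) = tm_tapes M"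
    and "set (map read_tape (snd c)) \<subseteq> {..<tm_symbols M}"
  using assms by (auto simp: wf_config_def)

lemma wf_config_init:
  assumes "wf_tm M"
  shows "wf_config M (init_config M x)"
  using assms by (auto simp: wf_config_def init_config_def wf_tm_def init_tape_def)

lemma wf_config_step:
  assumes "wf_tm M" "wf_config M c"
  shows "wf_config M (tm_step M c)"
proof (cases "halted M c")
  case False
  let ?ss = "map read_tape (snd c)"
  obtain q as where d: "tm_trans M (fst c) ?ss = (q, as)" by (cases "tm_trans M (fst c) ?ss")
  have len: "length ?ss = tm_tapes M" and ss: "set ?ss \<subseteq> {..<tm_symbols M}"
    and q: "fst c < tm_states M"
    using assms(2) wf_config_reads[OF assms(2)] by (auto simp: wf_config_def)
  have "wf_trans M (tm_trans M)" using assms(1) by (simp add: wf_tm_def)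
  with len ss q d have w: "q < tm_states M" "length as = tm_tapes M" "fst ` set as \<subseteq> {..<tm_symbols M}"
    unfolding wf_trans_def by (metis fst_conv snd_conv)+
  have st: "tm_step M c = (q, map2 act_tape as (snd c))"
    using False d by (simp add: tm_step_def apply_trans_def)
  have "fst tp i < tm_symbols M" if "tp \<in> set (map2 act_tape as (snd c))" for tp i
  proof -
    from that obtain a tp0 where "(a, tp0) \<in> set (zip as (snd c))" "tp = act_tape a tp0"
      by auto
    moreover then have "a \<in> set as" "tp0 \<in> set (snd c)"
      by (auto dest: set_zip_leftD set_zip_rightD)
    ultimately show ?thesis using w(3) assms(2)
      by (cases a; cases tp0) (auto simp: wf_config_def)
  qed
  then show ?thesis using st w assms(2) by (auto simp: wf_config_def)
qed (use assms in \<open>simp add: tm_step_def\<close>)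

lemma wf_config_steps:
  assumes "wf_tm M" "wf_config M c"
  shows "wf_config M ((tm_step M ^^ t) c)"
  by (induction t) (use assms wf_config_step in auto)

text \<open>Control flow is compiled into steps that rewrite every scanned symbol and move no head,
  so they change nothing but the state. The same device turns halting configurations into fixed
  points of \<open>full_trans\<close>.\<close>

lemma map2_act_keep:
  "map2 act_tape (map (\<lambda>s. (s, Stay)) (map read_tape ts)) ts = ts"
  by (induction ts) auto

text \<open>A head advances at most one cell per step and only the scanned cell is written. This
  bounds the window of cells that a circuit has to follow, and it locates a blank cell behind the
  output of a machine.\<close>

lemma tm_steps_head_le:
  assumes "wf_tm M" "wf_config M c" "\<forall>tp \<in> set (snd c). snd tp = 0" "i < tm_tapes M"
  shows "snd (snd ((tm_step M ^^ t) c) ! i) \<le> t \<and>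
    (\<forall>j > t. fst (snd ((tm_step M ^^ t) c) ! i) j = fst (snd c ! i) j)"
proof (induction t)
  case 0
  then show ?case using assms by (auto simp: wf_config_def)
next
  case (Suc t)
  let ?c = "(tm_step M ^^ t) c"
  have wf: "wf_config M ?c" "wf_config M (tm_step M ?c)"
    using assms wf_config_steps wf_config_step by blast+
  have "snd (tm_step M ?c) ! i = snd ?c ! i \<or> (\<exists>s d. snd (tm_step M ?c) ! i = act_tape (s, d) (snd ?c ! i))"
  proof (cases "halted M ?c")
    case False
    then show ?thesis using wf assms(4)
      by (simp add: tm_step_def apply_trans_def wf_config_def split: prod.splits) (metis surj_pair)
  qed (simp add: tm_step_def)
  moreover have "move d h \<le> Suc t" if "h \<le> t" for d h using that by (cases d) auto
  ultimately show ?case using Suc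
    by (cases "snd ?c ! i") auto
qed

section \<open>A programming language for oracle Turing machines\<close>

text \<open>
  Instructions act on the list of tapes. \<open>RunTM M\<close> runs \<open>M\<close> on the tapes from number 4 on; as \<open>M\<close>
  may destroy the left end marker of its output tape, the head of tape 3 mirrors the moves of the
  head on that tape.
\<close>

datatype prog =
    Act nat "nat option" dir
  | Ask prog prog
  | RunTM tm
  | Seq prog prog (infixr ";;" 60)
  | Cond "nat list \<Rightarrow> bool" prog prog
  | Loop "nat list \<Rightarrow> bool" prog

text \<open>\<open>B\<close> is an upper bound on the number of steps, so costs may be rounded up
  anywhere. In \<open>runs_RunTM\<close> the two additional steps enter and leave the copy of
  \<open>M\<close>, and \<open>t\<close> may exceed its halting time because halted configurations
  repeat. Tape 5 is tape 1 of \<open>M\<close>, hence the condition relating the heads of tapes 3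
  and 5.\<close>

inductive runs :: "(bool list \<Rightarrow> bool) \<Rightarrow> prog \<Rightarrow> tape list \<Rightarrow> nat \<Rightarrow> tape list \<Rightarrow> bool" for g where
  runs_Act: "i < length ts \<Longrightarrow>
    runs g (Act i w d) ts 1
      (ts[i := act_tape (case w of None \<Rightarrow> read_tape (ts ! i) | Some s \<Rightarrow> s, d) (ts ! i)])"
| runs_Ask: "runs g (if g (tape_word (ts ! 2)) then p else q) ts B ts' \<Longrightarrow>
    runs g (Ask p q) ts (Suc B) ts'"
| runs_RunTM: "(tm_step M ^^ t) (tm_start M, drop 4 ts) = (tm_halt M, us) \<Longrightarrow>
    wf_tm M \<Longrightarrow> wf_config M (tm_start M, drop 4 ts) \<Longrightarrow> snd (ts ! 3) = snd (ts ! 5) \<Longrightarrow>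
    runs g (RunTM M) ts (t + 2) (take 3 ts @ (fst (ts ! 3), snd (us ! 1)) # us)"
| runs_Seq: "runs g p ts B ts' \<Longrightarrow> runs g q ts' B' ts'' \<Longrightarrow> runs g (p ;; q) ts (B + B') ts''"
| runs_Cond: "runs g (if b (map read_tape ts) then p else q) ts B ts' \<Longrightarrow>
    runs g (Cond b p q) ts (Suc B) ts'"
| runs_Loop_end: "\<not> b (map read_tape ts) \<Longrightarrow> runs g (Loop b p) ts 1 ts"
| runs_Loop: "b (map read_tape ts) \<Longrightarrow> runs g p ts B ts' \<Longrightarrow> runs g (Loop b p) ts' B' ts'' \<Longrightarrow>
    runs g (Loop b p) ts (Suc (B + B')) ts''"
| runs_weaken: "runs g p ts B ts' \<Longrightarrow> B \<le> B' \<Longrightarrow> runs g p ts B' ts'"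

text \<open>Loops are treated by exhibiting the tapes \<open>S i\<close> at the start of every
  round. Each round pays one step for its test, and the failing test pays the final one.\<close>

lemma runs_Loop_iterate:
  assumes "\<And>i. i < N \<Longrightarrow> b (map read_tape (S i))"
    and "\<And>i. i < N \<Longrightarrow> runs g p (S i) B (S (Suc i))"
    and "\<not> b (map read_tape (S N))"
  shows "runs g (Loop b p) (S 0) (N * Suc B + 1) (S N)"
  using assms
proof (induction N arbitrary: S)
  case 0
  then show ?case using runs_Loop_end[of b "S 0" g p] by simp
next
  case (Suc N)
  have "runs g (Loop b p) (S (Suc 0)) (N * Suc B + 1) (S (Suc N))"
    using Suc.IH[of "\<lambda>i. S (Suc i)"] Suc.prems by simp
  then have "runs g (Loop b p) (S 0) (Suc (B + (N * Suc B + 1))) (S (Suc N))"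
    using Suc.prems runs_Loop by (metis zero_less_Suc)
  then show ?case by (simp add: add_ac)
qed

section \<open>Compilation of programs into transition functions\<close>

fun psize :: "prog \<Rightarrow> nat" where
  "psize (Act i w d) = 1"
| "psize (Ask p q) = 1 + psize p + psize q"
| "psize (RunTM M) = 1 + tm_states M"
| "psize (p ;; q) = psize p + psize q"
| "psize (Cond b p q) = 1 + psize p + psize q"
| "psize (Loop b p) = 1 + psize p"

abbreviation keep :: "nat list \<Rightarrow> (nat \<times> dir) list" where
  "keep ss \<equiv> map (\<lambda>s. (s, Stay)) ss"

text \<open>
  The code of \<open>p\<close> occupies the states from \<open>b\<close> to \<open>b + psize p - 1\<close>, is entered at \<open>b\<close> and left to
  state \<open>e\<close>.
\<close>

fun code_trans :: "prog \<Rightarrow> nat \<Rightarrow> nat \<Rightarrow> transition" where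
  "code_trans (Act i w d) b e l ss = (e, (keep ss)[i := (case w of None \<Rightarrow> ss ! i | Some s \<Rightarrow> s, d)])"
| "code_trans (Ask p q) b e l ss =
     (if l = b then (b, keep ss) else
      if l < b + 1 + psize p then code_trans p (b + 1) e l ss
      else code_trans q (b + 1 + psize p) e l ss)"
| "code_trans (RunTM M) b e l ss =
     (if l = b then (b + 1 + tm_start M, keep ss) else
      if l - b - 1 = tm_halt M then (e, keep ss) else
      (case tm_trans M (l - b - 1) (drop 4 ss) of
        (q, as) \<Rightarrow> (b + 1 + q, keep (take 3 ss) @ (ss ! 3, snd (as ! 1)) # as)))"
| "code_trans (p ;; q) b e l ss =
     (if l < b + psize p then code_trans p b (b + psize p) l ss
      else code_trans q (b + psize p) e l ss)"
| "code_trans (Cond c p q) b e l ss =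
     (if l = b then (if c ss then b + 1 else b + 1 + psize p, keep ss) else
      if l < b + 1 + psize p then code_trans p (b + 1) e l ss
      else code_trans q (b + 1 + psize p) e l ss)"
| "code_trans (Loop c p) b e l ss =
     (if l = b then (if c ss then b + 1 else e, keep ss) else code_trans p (b + 1) b l ss)"

fun asks :: "prog \<Rightarrow> nat \<Rightarrow> (nat \<times> nat \<times> nat) set" where
  "asks (Act i w d) b = {}"
| "asks (Ask p q) b =
     insert (b, b + 1, b + 1 + psize p) (asks p (b + 1) \<union> asks q (b + 1 + psize p))"
| "asks (RunTM M) b = {}"
| "asks (p ;; q) b = asks p b \<union> asks q (b + psize p)"
| "asks (Cond c p q) b = asks p (b + 1) \<union> asks q (b + 1 + psize p)"
| "asks (Loop c p) b = asks p (b + 1)"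

lemma asks_range: "x \<in> asks p b \<Longrightarrow> b \<le> fst x \<and> fst x < b + psize p"
  by (induction p arbitrary: b) fastforce+

lemma psize_pos: "0 < psize p"
  by (induction p) auto

text \<open>Both transition functions are required to follow the code, which makes the coins
  irrelevant. The clause on \<open>tm_query\<close> ensures that no ordinary instruction is
  overridden by an oracle step.\<close>

definition code_at :: "potm \<Rightarrow> prog \<Rightarrow> nat \<Rightarrow> nat \<Rightarrow> bool" where
  "code_at A p b e \<longleftrightarrow>
     (\<forall>l \<in> {b..<b + psize p}. l \<noteq> tm_halt A \<and>
        (l = tm_query A \<longleftrightarrow> l \<in> fst ` asks p b) \<and>
        tm_trans A l = code_trans p b e l \<and> tm_trans' A l = code_trans p b e l) \<and>
     asks p b \<subseteq> {(tm_query A, tm_yes A, tm_no A)}"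

lemma not_in_asks:
  "l < b \<Longrightarrow> l \<notin> fst ` asks p b"  "b + psize p \<le> l \<Longrightarrow> l \<notin> fst ` asks p b"
  using asks_range by fastforce+

lemma code_at_Seq:
  assumes "code_at A (p ;; q) b e"
  shows "code_at A p b (b + psize p)" "code_at A q (b + psize p) e"
  using assms not_in_asks by (auto simp: code_at_def image_Un add.assoc fun_eq_iff)

lemma code_at_Cond:
  assumes "code_at A (Cond c p q) b e"
  shows "code_at A p (b + 1) e" "code_at A q (b + 1 + psize p) e"
  using assms not_in_asks by (auto simp: code_at_def image_Un add.assoc fun_eq_iff)

text \<open>The query state is already taken by this instruction. The branches lie at later
  addresses, so they cannot contain a further oracle call.\<close>

lemma code_at_Ask:
  assumes "code_at A (Ask p q) b e"
  shows "code_at A p (b + 1) e" "code_at A q (b + 1 + psize p) e"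
proof -
  have q: "tm_query A = b" and sub: "asks p (b + 1) \<union> asks q (b + 1 + psize p) \<subseteq> {(b, tm_yes A, tm_no A)}"
    using assms by (auto simp: code_at_def)
  have "x \<notin> asks p (b + 1)" "x \<notin> asks q (b + 1 + psize p)" for x
    using asks_range[of x p "b + 1"] asks_range[of x q "b + 1 + psize p"] sub by force+
  then have e: "asks p (b + 1) = {}" "asks q (b + 1 + psize p) = {}" by auto
  have "\<forall>l \<in> {b..<b + psize (Ask p q)}. l \<noteq> tm_halt A \<and>
      tm_trans A l = code_trans (Ask p q) b e l \<and> tm_trans' A l = code_trans (Ask p q) b e l"
    using assms unfolding code_at_def by blast
  then show "code_at A p (b + 1) e" "code_at A q (b + 1 + psize p) e"
    unfolding code_at_def e q by (auto simp: fun_eq_iff)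
qed

lemma code_at_Loop:
  assumes "code_at A (Loop c p) b e"
  shows "code_at A p (b + 1) b"
  using assms not_in_asks by (auto simp: code_at_def image_Un add.assoc fun_eq_iff)

lemma code_at_step:
  assumes "code_at A p b e" "b \<le> l" "l < b + psize p" "l \<notin> fst ` asks p b"
    and "code_trans p b e l (map read_tape ts) = (l', as)"
  shows "potm_step A g True (l, ts) = (l', map2 act_tape as ts)"
  using assms by (auto simp: code_at_def potm_step_def halted_def apply_trans_def)

lemma act_tapes_update:
  "map2 act_tape ((keep (map read_tape ts))[i := (s, d)]) ts = ts[i := act_tape (s, d) (ts ! i)]"
proof (rule nth_equalityI)
  fix j assume "j < length (map2 act_tape ((keep (map read_tape ts))[i := (s, d)]) ts)"
  then show "map2 act_tape ((keep (map read_tape ts))[i := (s, d)]) ts ! j =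
      ts[i := act_tape (s, d) (ts ! i)] ! j"
    by (cases "i = j"; cases "ts ! j") simp_all
qed simp

text \<open>Every step of \<open>M\<close> is one step of its copy, and one more step leaves the
  copy. Heads 3 and 5 start at the same position and make the same moves, including a move to the
  left at cell 0, so they stay synchronized.\<close>

lemma code_at_RunTM:
  assumes A: "code_at A (RunTM M) b e"
    and M: "wf_tm M" "wf_config M (q, us)"
    and eq: "(tm_step M ^^ t) (q, us) = (tm_halt M, us')"
    and xs: "length xs = 3" and sync: "snd (us ! 1) = h"
  shows "\<exists>t' \<le> Suc t. (potm_step A g True ^^ t') (b + 1 + q, xs @ (c, h) # us) =
    (e, xs @ (c, snd (us' ! 1)) # us')"
  using M eq sync
proof (induction t arbitrary: q us h)
  case 0
  then have q: "q = tm_halt M" "us' = us" by auto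
  have "potm_step A g True (b + 1 + q, xs @ (c, h) # us) =
      (e, map2 act_tape (keep (map read_tape (xs @ (c, h) # us))) (xs @ (c, h) # us))"
    using 0 q by (intro code_at_step[OF A]) (auto simp: wf_config_def)
  then show ?case using 0 q by (intro exI[of _ 1]) (simp add: map2_act_keep del: map_map map_append)
next
  case (Suc t)
  show ?case
  proof (cases "q = tm_halt M")
    case True
    \<comment> \<open>\<open>M\<close> idles after halting while the copy leaves at once, so the
      induction hypothesis is applied to the unchanged configuration.\<close>
    then have "tm_step M (q, us) = (q, us)" by (simp add: tm_step_def halted_def)
    then have "(tm_step M ^^ t) (q, us) = (tm_halt M, us')"
      using Suc.prems by (simp add: funpow_swap1)
    with Suc.IH[OF Suc.prems(1,2) this Suc.prems(4)] show ?thesis by (meson le_SucI)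
  next
    case False
    obtain q1 as where d: "tm_trans M q (map read_tape us) = (q1, as)"
      by (cases "tm_trans M q (map read_tape us)")
    have st: "tm_step M (q, us) = (q1, map2 act_tape as us)"
      using False d by (simp add: tm_step_def halted_def apply_trans_def)
    have wf1: "wf_config M (q1, map2 act_tape as us)"
      using wf_config_step[OF Suc.prems(1,2)] st by simp
    have "length us = tm_tapes M" "length as \<ge> length us" "2 \<le> tm_tapes M"
      using Suc.prems(1,2) wf1 by (auto simp: wf_config_def wf_tm_def)
    then have l: "1 < length us" "1 < length as" by auto
    have h1: "snd (map2 act_tape as us ! 1) = move (snd (as ! 1)) h"
      using l Suc.prems(4) by (cases "as ! 1"; cases "us ! 1") simp
    have "(tm_step M ^^ t) (q1, map2 act_tape as us) = (tm_halt M, us')"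
      using Suc.prems(3) st by (simp add: funpow_swap1)
    from Suc.IH[OF Suc.prems(1) wf1 this h1] obtain t' where t': "t' \<le> Suc t"
      "(potm_step A g True ^^ t') (b + 1 + q1, xs @ (c, move (snd (as ! 1)) h) # map2 act_tape as us) =
        (e, xs @ (c, snd (us' ! 1)) # us')" by blast
    have "potm_step A g True (b + 1 + q, xs @ (c, h) # us) =
      (b + 1 + q1, map2 act_tape (keep (map read_tape xs) @ (c h, snd (as ! 1)) # as) (xs @ (c, h) # us))"
      using Suc.prems False xs d
      by (intro code_at_step[OF A]) (auto simp: wf_config_def nth_append)
    also have "\<dots> = (b + 1 + q1, xs @ (c, move (snd (as ! 1)) h) # map2 act_tape as us)"
      by (simp add: map2_act_keep del: map_map)
    finally show ?thesis using t' 
      by (intro exI[of _ "Suc t'"]) (simp add: funpow_swap1)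
  qed
qed

text \<open>Rule induction on the run, with the addresses \<open>b\<close> and \<open>e\<close>
  free: subprograms sit at shifted addresses, and a loop body exits to the test of its loop. Fixing
  the coin to \<open>True\<close> is harmless, as the two transition functions agree on the
  code.\<close>

theorem runs_correct:
  assumes "runs g p ts B ts'" "code_at A p b e"
  shows "\<exists>t \<le> B. (potm_step A g True ^^ t) (b, ts) = (e, ts')"
  using assms
proof (induction arbitrary: b e rule: runs.induct)
  case (runs_Act i ts w d)
  show ?case
    by (rule exI[of _ 1])
      (auto simp: code_at_step[OF runs_Act.prems, of b] act_tapes_update runs_Act.hyps 
        simp del: map_map split: option.split)
next
  case (runs_Ask ts p q B ts')
  have "tm_query A = b" "tm_yes A = b + 1" "tm_no A = b + 1 + psize p" "b \<noteq> tm_halt A"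
    using runs_Ask.prems by (auto simp: code_at_def)
  then have st: "potm_step A g True (b, ts) =
      (if g (tape_word (ts ! 2)) then b + 1 else b + 1 + psize p, ts)"
    by (simp add: potm_step_def halted_def)
  have "\<exists>t \<le> B. (potm_step A g True ^^ t)
      (if g (tape_word (ts ! 2)) then b + 1 else b + 1 + psize p, ts) = (e, ts')"
    using runs_Ask.IH code_at_Ask[OF runs_Ask.prems] by (auto split: if_splits)
  then obtain t where "t \<le> B" "(potm_step A g True ^^ t) (potm_step A g True (b, ts)) = (e, ts')"
    using st by auto
  then show ?case by (intro exI[of _ "Suc t"]) (simp add: funpow_swap1)
next
  case (runs_RunTM M t ts us)
  have "length (drop 4 ts) = tm_tapes M" "2 \<le> tm_tapes M"
    using runs_RunTM.hyps by (auto simp: wf_config_def wf_tm_def)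
  then have len: "5 < length ts" by simp
  then have ts: "ts = take 3 ts @ ts ! 3 # drop 4 ts"
    by (simp add: id_take_nth_drop numeral_eq_Suc)
  have "potm_step A g True (b, ts) =
      (b + 1 + tm_start M, map2 act_tape (keep (map read_tape ts)) ts)"
    by (intro code_at_step[OF runs_RunTM.prems]) auto
  then have st: "potm_step A g True (b, ts) = (b + 1 + tm_start M, ts)"
    by (simp add: map2_act_keep del: map_map)
  obtain t' where "t' \<le> Suc t" "(potm_step A g True ^^ t')
      (b + 1 + tm_start M, take 3 ts @ (fst (ts ! 3), snd (ts ! 3)) # drop 4 ts) =
      (e, take 3 ts @ (fst (ts ! 3), snd (us ! 1)) # us)"
    using code_at_RunTM[OF runs_RunTM.prems runs_RunTM.hyps(2,3,1), of "take 3 ts" "snd (ts ! 3)"]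
      len runs_RunTM.hyps(4) by auto
  then have "t' \<le> Suc t" "(potm_step A g True ^^ t') (potm_step A g True (b, ts)) =
      (e, take 3 ts @ (fst (ts ! 3), snd (us ! 1)) # us)"
    using ts st by auto
  then show ?case by (intro exI[of _ "Suc t'"]) (simp add: funpow_swap1)
next
  case (runs_Seq p ts B ts' q B' ts'')
  obtain t t' where "t \<le> B" "(potm_step A g True ^^ t) (b, ts) = (b + psize p, ts')"
    "t' \<le> B'" "(potm_step A g True ^^ t') (b + psize p, ts') = (e, ts'')"
    using runs_Seq.IH code_at_Seq[OF runs_Seq.prems] by meson
  then show ?case by (intro exI[of _ "t' + t"]) (simp add: funpow_add)
next
  case (runs_Cond c ts p q B ts')
  have st: "potm_step A g True (b, ts) =
      (if c (map read_tape ts) then b + 1 else b + 1 + psize p, map2 act_tape (keep (map read_tape ts)) ts)"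
    by (intro code_at_step[OF runs_Cond.prems])
      (auto simp: image_Un not_in_asks psize_pos)
  have "\<exists>t \<le> B. (potm_step A g True ^^ t)
      (if c (map read_tape ts) then b + 1 else b + 1 + psize p, ts) = (e, ts')"
    using runs_Cond.IH code_at_Cond[OF runs_Cond.prems] by (auto split: if_splits)
  then obtain t where "t \<le> B" "(potm_step A g True ^^ t) (potm_step A g True (b, ts)) = (e, ts')"
    using st by (auto simp: map2_act_keep simp del: map_map)
  then show ?case by (intro exI[of _ "Suc t"]) (simp add: funpow_swap1)
next
  case (runs_Loop_end c ts p)
  have "potm_step A g True (b, ts) = (e, map2 act_tape (keep (map read_tape ts)) ts)"
    using runs_Loop_end.hyps
    by (intro code_at_step[OF runs_Loop_end.prems]) (auto simp: not_in_asks)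
  then show ?case by (intro exI[of _ 1]) (simp add: map2_act_keep del: map_map)
next
  case (runs_Loop c ts p B ts' B' ts'')
  have "potm_step A g True (b, ts) = (b + 1, map2 act_tape (keep (map read_tape ts)) ts)"
    using runs_Loop.hyps
    by (intro code_at_step[OF runs_Loop.prems]) (auto simp: not_in_asks)
  then have st: "potm_step A g True (b, ts) = (b + 1, ts)" by (simp add: map2_act_keep del: map_map)
  obtain t t' where t: "t \<le> B" "(potm_step A g True ^^ t) (b + 1, ts) = (b, ts')"
    "t' \<le> B'" "(potm_step A g True ^^ t') (b, ts') = (e, ts'')"
    using runs_Loop.IH code_at_Loop[OF runs_Loop.prems] runs_Loop.prems by meson
  then have "(potm_step A g True ^^ (t' + t)) (potm_step A g True (b, ts)) = (e, ts'')"
    using st by (simp add: funpow_add)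
  then show ?case using t by (intro exI[of _ "Suc (t' + t)"]) (simp add: funpow_swap1)
next
  case (runs_weaken p ts B ts' B')
  then show ?case by (meson order_trans)
qed

section \<open>Compiled programs as well-formed probabilistic oracle machines\<close>

fun wf_prog :: "nat \<Rightarrow> nat \<Rightarrow> prog \<Rightarrow> bool" where
  "wf_prog k s (Act i w d) \<longleftrightarrow> i < k \<and> (\<forall>x. w = Some x \<longrightarrow> x < s)"
| "wf_prog k s (Ask p q) \<longleftrightarrow> wf_prog k s p \<and> wf_prog k s q"
| "wf_prog k s (RunTM M) \<longleftrightarrow> wf_tm M \<and> tm_tapes M + 4 = k \<and> tm_symbols M = s"
| "wf_prog k s (p ;; q) \<longleftrightarrow> wf_prog k s p \<and> wf_prog k s q"
| "wf_prog k s (Cond c p q) \<longleftrightarrow> wf_prog k s p \<and> wf_prog k s q"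
| "wf_prog k s (Loop c p) \<longleftrightarrow> wf_prog k s p"

lemma code_trans_wf:
  assumes "wf_prog k s p" "length ss = k" "set ss \<subseteq> {..<s}" "b \<le> l" "l < b + psize p"
    "b + psize p \<le> N" "e < N"
  shows "fst (code_trans p b e l ss) < N \<and> length (snd (code_trans p b e l ss)) = k \<and>
    fst ` set (snd (code_trans p b e l ss)) \<subseteq> {..<s}"
  using assms
proof (induction p arbitrary: b e)
  case (Act i w d)
  define y where "y = (case w of None \<Rightarrow> ss ! i | Some s \<Rightarrow> s, d)"
  have "ss ! i \<in> {..<s}" using Act.prems nth_mem by (metis subsetD wf_prog.simps(1))
  then have "fst y < s" using Act.prems by (auto simp: y_def split: option.split)
  moreover have "set ((keep ss)[i := y]) \<subseteq> insert y (set (keep ss))"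
    by (rule set_update_subset_insert)
  then have "fst ` set ((keep ss)[i := y]) \<subseteq> insert (fst y) (set ss)" by force
  ultimately have "fst ` set ((keep ss)[i := y]) \<subseteq> {..<s}" using Act.prems(3) by auto
  then show ?case using Act.prems unfolding y_def by simp
next
  case (Ask p q)
  show ?case
  proof (cases "l = b")
    case False
    then show ?thesis using Ask.IH(1)[of "b + 1" e] Ask.IH(2)[of "b + 1 + psize p" e] Ask.prems
      by simp
  qed (use Ask.prems in auto)
next
  case (RunTM M)
  show ?case
  proof (cases "l = b \<or> l - b - 1 = tm_halt M")
    case True
    then show ?thesis using RunTM by (auto simp: wf_tm_def)
  next
    case False
    obtain q as where d: "tm_trans M (l - b - 1) (drop 4 ss) = (q, as)"
      by (cases "tm_trans M (l - b - 1) (drop 4 ss)")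
    have 1: "l - b - 1 < tm_states M" "length (drop 4 ss) = tm_tapes M"
        "set (drop 4 ss) \<subseteq> {..<tm_symbols M}"
      using RunTM False set_drop_subset[of 4 ss] by auto
    have "wf_trans M (tm_trans M)" using RunTM by (simp add: wf_tm_def)
    with 1 d have "q < tm_states M" "length as = tm_tapes M" "fst ` set as \<subseteq> {..<tm_symbols M}"
      unfolding wf_trans_def by (metis fst_conv snd_conv)+
    moreover have "set (take 3 ss) \<subseteq> {..<s}" using RunTM set_take_subset[of 3 ss] by auto
    moreover have "ss ! 3 < s"
      using RunTM.prems nth_mem[of 3 ss] by (auto simp del: nth_mem)
    ultimately show ?thesis using RunTM False d by (auto simp: image_Un image_image)
  qed
next
  case (Seq p q)
  then show ?case using Seq.IH(1)[of b "b + psize p"] Seq.IH(2)[of "b + psize p" e] psize_pos[of q]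
    by simp
next
  case (Cond c p q)
  show ?case
  proof (cases "l = b")
    case False
    then show ?thesis using Cond.IH(1)[of "b + 1" e] Cond.IH(2)[of "b + 1 + psize p" e] Cond.prems
      by simp
  qed (use Cond.prems psize_pos[of q] in auto)
next
  case (Loop c p)
  show ?case
  proof (cases "l = b")
    case False
    then show ?thesis using Loop.IH(1)[of "b + 1" b] Loop.prems
      by simp
  qed (use Loop.prems psize_pos[of p] in auto)
qed

text \<open>The address \<open>psize p\<close> just behind the code serves as the halting
  state.\<close>

definition prog_trans :: "prog \<Rightarrow> transition" where
  "prog_trans p l ss = (if l < psize p then code_trans p 0 (psize p) l ss else (l, keep ss))"

definition prog_potm :: "nat \<Rightarrow> nat \<Rightarrow> prog \<Rightarrow> nat \<times> nat \<times> nat \<Rightarrow> potm" where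
  "prog_potm k s p x = \<lparr>tm_tapes = k, tm_symbols = s, tm_states = psize p + 1, tm_start = 0,
     tm_halt = psize p, tm_trans = prog_trans p, tm_trans' = prog_trans p,
     tm_query = fst x, tm_yes = fst (snd x), tm_no = snd (snd x)\<rparr>"

lemma asks_less:
  "(l, y, z) \<in> asks p b \<Longrightarrow> l < b + psize p \<and> y < b + psize p \<and> z < b + psize p"
proof (induction p arbitrary: b)
  case (Ask p q)
  then show ?case using psize_pos[of p] psize_pos[of q] by fastforce
qed fastforce+

context
  fixes k s :: nat and p :: prog and x :: "nat \<times> nat \<times> nat"
  assumes wf: "wf_prog k s p" and k: "3 \<le> k" and s: "4 \<le> s" and asks: "asks p 0 = {x}"
begin

lemma code_at_prog_potm: "code_at (prog_potm k s p x) p 0 (psize p)"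
  using asks by (cases x) (auto simp: code_at_def prog_potm_def prog_trans_def fun_eq_iff)

lemma wf_potm_prog_potm: "wf_potm (prog_potm k s p x)"
proof -
  have "wf_trans (prog_potm k s p x) (prog_trans p)"
    unfolding wf_trans_def
  proof (intro allI impI)
    fix q ss
    assume "q < tm_states (prog_potm k s p x)" and ss: "length ss = tm_tapes (prog_potm k s p x) \<and>
      set ss \<subseteq> {..<tm_symbols (prog_potm k s p x)}"
    then show "fst (prog_trans p q ss) < tm_states (prog_potm k s p x) \<and>
      length (snd (prog_trans p q ss)) = tm_tapes (prog_potm k s p x) \<and>
      fst ` set (snd (prog_trans p q ss)) \<subseteq> {..<tm_symbols (prog_potm k s p x)}"
      using code_trans_wf[OF wf, of ss 0 q "psize p + 1" "psize p"]
      by (auto simp: prog_potm_def prog_trans_def)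
  qed
  moreover have "fst x < psize p" "fst (snd x) < psize p" "snd (snd x) < psize p"
    using asks_less[of "fst x" "fst (snd x)" "snd (snd x)" p 0] asks by auto
  ultimately show ?thesis using k s
    by (simp add: wf_potm_def wf_tm_def) (simp add: prog_potm_def)
qed

end

section \<open>Building circuits\<close>

definition wf_gates :: "nat \<Rightarrow> gate list \<Rightarrow> bool" where
  "wf_gates n gs \<longleftrightarrow> (\<forall>i < length gs. \<forall>j \<in> gate_inputs (gs ! i). j < n + i)"

abbreviation and_count :: "gate list \<Rightarrow> nat" where
  "and_count gs \<equiv> length (filter is_and gs)"

definition on_wire :: "nat \<Rightarrow> gate list \<Rightarrow> (bool list \<Rightarrow> bool) \<Rightarrow> bool" where
  "on_wire n gs f \<longleftrightarrow> (\<exists>w < n + length gs. \<forall>x \<in> bvecs n. wire_vals gs x ! w = f x)"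

lemma wire_vals_snoc: "wire_vals (gs @ [g]) x = wire_vals gs x @ [gate_val (wire_vals gs x) g]"
  by (simp add: wire_vals_def)

lemma length_wire_vals [simp]: "length (wire_vals gs x) = length x + length gs"
  by (induction gs rule: rev_induct) (simp_all add: wire_vals_snoc, simp add: wire_vals_def)

lemma on_wire_snoc:
  assumes "on_wire n gs f"
  shows "on_wire n (gs @ [g]) f"
proof -
  obtain w where w: "w < n + length gs" "\<forall>x \<in> bvecs n. wire_vals gs x ! w = f x"
    using assms by (auto simp: on_wire_def)
  then show ?thesis unfolding on_wire_def
    by (intro exI[of _ w]) (auto simp: wire_vals_snoc nth_append bvecs_def)
qed

lemma on_wire_append: "on_wire n gs f \<Longrightarrow> on_wire n (gs @ hs) f"
proof (induction hs rule: rev_induct)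
  case (snoc g hs)
  then show ?case using on_wire_snoc[of n "gs @ hs" f g] by simp
qed simp

lemma on_wire_new:
  assumes "\<And>x. x \<in> bvecs n \<Longrightarrow> gate_val (wire_vals gs x) g = f x"
  shows "on_wire n (gs @ [g]) f"
  unfolding on_wire_def
  by (rule exI[of _ "n + length gs"]) (auto simp: wire_vals_snoc nth_append bvecs_def assms)

lemma wf_gates_snoc:
  "wf_gates n (gs @ [g]) \<longleftrightarrow> wf_gates n gs \<and> (\<forall>j \<in> gate_inputs g. j < n + length gs)"
  by (auto simp: wf_gates_def nth_append less_Suc_eq)

text \<open>A relative cost: whatever circuit already carries the functions in \<open>F\<close>, at
  most \<open>C\<close> further AND gates produce \<open>f\<close>. Quantifying over all circuits
  makes costs compose by appending gates, since existing wires survive, and intermediate results are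
  shared rather than recomputed.\<close>

definition and_cost :: "nat \<Rightarrow> (bool list \<Rightarrow> bool) set \<Rightarrow> nat \<Rightarrow> (bool list \<Rightarrow> bool) \<Rightarrow> bool" where
  "and_cost n F C f \<longleftrightarrow> (\<forall>gs. wf_gates n gs \<and> (\<forall>h \<in> F. on_wire n gs h) \<longrightarrow>
     (\<exists>hs. wf_gates n (gs @ hs) \<and> on_wire n (gs @ hs) f \<and> and_count hs \<le> C))"

lemma and_costE:
  assumes "and_cost n F C f" "wf_gates n gs" "\<And>h. h \<in> F \<Longrightarrow> on_wire n gs h"
  obtains hs where "wf_gates n (gs @ hs)" "on_wire n (gs @ hs) f" "and_count hs \<le> C"
  using assms unfolding and_cost_def by blast

lemma and_cost_mono: "and_cost n F C f \<Longrightarrow> C \<le> C' \<Longrightarrow> and_cost n F C' f"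
  unfolding and_cost_def by (meson order_trans)

lemma and_cost_mem: "f \<in> F \<Longrightarrow> and_cost n F C f"
  unfolding and_cost_def by (metis append_Nil2 filter.simps(1) list.size(3) zero_le)

lemma and_cost_cong:
  assumes "and_cost n F C f" "\<And>x. length x = n \<Longrightarrow> f x = h x"
  shows "and_cost n F C h"
proof -
  have "on_wire n gs f = on_wire n gs h" for gs using assms(2) by (auto simp: on_wire_def bvecs_def)
  then show ?thesis using assms(1) by (simp add: and_cost_def)
qed

lemma and_cost_trans:
  assumes "and_cost n F C f" "and_cost n (insert f F) D h"
  shows "and_cost n F (C + D) h"
  unfolding and_cost_def
proof (intro allI impI)
  fix gs assume gs: "wf_gates n gs \<and> (\<forall>h \<in> F. on_wire n gs h)"
  then obtain hs where hs: "wf_gates n (gs @ hs)" "on_wire n (gs @ hs) f" "and_count hs \<le> C"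
    using and_costE[OF assms(1)] by metis
  have "on_wire n (gs @ hs) h" if "h \<in> insert f F" for h
    using that hs(2) gs on_wire_append by blast
  then obtain ks where "wf_gates n ((gs @ hs) @ ks)" "on_wire n ((gs @ hs) @ ks) h" "and_count ks \<le> D"
    using and_costE[OF assms(2) hs(1)] by metis
  then show "\<exists>hs. wf_gates n (gs @ hs) \<and> on_wire n (gs @ hs) h \<and> and_count hs \<le> C + D"
    using hs by (intro exI[of _ "hs @ ks"]) auto
qed

lemma and_cost_superset: "and_cost n F C f \<Longrightarrow> F \<subseteq> G \<Longrightarrow> and_cost n G C f"
  unfolding and_cost_def by blast

lemma and_cost_const_True: "and_cost n F C (\<lambda>x. True)"
  unfolding and_cost_def
  by (intro allI impI exI[of _ "[OneG]"]) (auto simp: wf_gates_snoc intro: on_wire_new)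

lemma and_cost_input:
  assumes "i < n"
  shows "and_cost n F C (\<lambda>x. x ! i)"
proof -
  have "on_wire n gs (\<lambda>x. x ! i)" for gs
    using on_wire_append[of n "[]" "\<lambda>x. x ! i" gs] assms by (auto simp: on_wire_def wire_vals_def)
  then show ?thesis unfolding and_cost_def by (metis append_Nil2 filter.simps(1) list.size(3) zero_le)
qed

lemma and_cost_xor:
  assumes "and_cost n F C f" "and_cost n F D h"
  shows "and_cost n F (C + D) (\<lambda>x. f x \<noteq> h x)"
proof -
  have "and_cost n (insert h (insert f F)) 0 (\<lambda>x. f x \<noteq> h x)"
    unfolding and_cost_def
  proof (intro allI impI)
    fix gs assume "wf_gates n gs \<and> (\<forall>h \<in> insert h (insert f F). on_wire n gs h)"
    then obtain i j where "wf_gates n gs" "i < n + length gs" "j < n + length gs"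
      "\<forall>x \<in> bvecs n. wire_vals gs x ! i = f x" "\<forall>x \<in> bvecs n. wire_vals gs x ! j = h x"
      by (auto simp: on_wire_def)
    then show "\<exists>hs. wf_gates n (gs @ hs) \<and> on_wire n (gs @ hs) (\<lambda>x. f x \<noteq> h x) \<and> and_count hs \<le> 0"
      by (intro exI[of _ "[XorG i j]"]) (auto simp: wf_gates_snoc intro!: on_wire_new)
  qed
  from and_cost_trans[OF and_cost_superset[OF assms(2)] this]
  have "and_cost n (insert f F) D (\<lambda>x. f x \<noteq> h x)" by auto
  from and_cost_trans[OF assms(1) this] show ?thesis .
qed

lemma and_cost_and:
  assumes "and_cost n F C f" "and_cost n F D h"
  shows "and_cost n F (C + D + 1) (\<lambda>x. f x \<and> h x)"
proof -
  have "and_cost n (insert h (insert f F)) 1 (\<lambda>x. f x \<and> h x)"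
    unfolding and_cost_def
  proof (intro allI impI)
    fix gs assume "wf_gates n gs \<and> (\<forall>h \<in> insert h (insert f F). on_wire n gs h)"
    then obtain i j where "wf_gates n gs" "i < n + length gs" "j < n + length gs"
      "\<forall>x \<in> bvecs n. wire_vals gs x ! i = f x" "\<forall>x \<in> bvecs n. wire_vals gs x ! j = h x"
      by (auto simp: on_wire_def)
    then show "\<exists>hs. wf_gates n (gs @ hs) \<and> on_wire n (gs @ hs) (\<lambda>x. f x \<and> h x) \<and> and_count hs \<le> 1"
      by (intro exI[of _ "[AndG i j]"]) (auto simp: wf_gates_snoc intro!: on_wire_new)
  qed
  from and_cost_trans[OF and_cost_superset[OF assms(2)] this]
  have "and_cost n (insert f F) (D + 1) (\<lambda>x. f x \<and> h x)" by auto
  from and_cost_trans[OF assms(1) this] show ?thesis by (simp add: add.assoc)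
qed

lemma and_cost_not:
  assumes "and_cost n F C f"
  shows "and_cost n F C (\<lambda>x. \<not> f x)"
  using and_cost_xor[OF assms and_cost_const_True[of n F 0]] by simp

lemma and_cost_const: "and_cost n F C (\<lambda>x. b)"
  using and_cost_const_True[of n F C] and_cost_not[OF and_cost_const_True[of n F C]] by (cases b) simp_all

lemma and_cost_or:
  assumes "and_cost n F C f" "and_cost n F D h"
  shows "and_cost n F (C + D + 1) (\<lambda>x. f x \<or> h x)"
  using and_cost_not[OF and_cost_and[OF and_cost_not[OF assms(1)] and_cost_not[OF assms(2)]]] by simp

text \<open>The disjunction is built up from the constant \<open>False\<close>, so every member of
  \<open>I\<close> pays its own cost and one OR.\<close>

lemma and_cost_Bex:
  assumes "finite I" "\<And>i. i \<in> I \<Longrightarrow> and_cost n F C (f i)"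
  shows "and_cost n F (card I * (C + 1)) (\<lambda>x. \<exists>i \<in> I. f i x)"
  using assms
proof (induction I rule: finite_induct)
  case empty
  then show ?case using and_cost_const[of n F 0 False] by simp
next
  case (insert i I)
  have "and_cost n F (C + card I * (C + 1) + 1) (\<lambda>x. f i x \<or> (\<exists>i \<in> I. f i x))"
    using insert by (intro and_cost_or) auto
  then show ?case using insert by (simp add: add_ac)
qed

lemma and_cost_Ball:
  assumes "finite I" "\<And>i. i \<in> I \<Longrightarrow> and_cost n F C (f i)"
  shows "and_cost n F (card I * (C + 1)) (\<lambda>x. \<forall>i \<in> I. f i x)"
  using and_cost_not[OF and_cost_Bex[OF assms(1), of n F C "\<lambda>i x. \<not> f i x"]] and_cost_not[OF assms(2)]
  by simp

lemma mult_complexity_le: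
  assumes "and_cost n {} C f"
  shows "mult_complexity n f \<le> C"
proof -
  obtain gs where "wf_gates n gs" "on_wire n gs f" "and_count gs \<le> C"
    using and_costE[OF assms, of "[]"] by (auto simp: wf_gates_def)
  then obtain w where "circuit_computes n gs w f"
    by (auto simp: on_wire_def circuit_computes_def wf_circuit_def wf_gates_def)
  then have "mult_complexity n f \<le> and_count gs"
    unfolding mult_complexity_def by (intro Least_le) blast
  then show ?thesis using \<open>and_count gs \<le> C\<close> by simp
qed

lemma finite_bvecs [simp]: "finite (bvecs n)"
  using finite_lists_length_eq[of "UNIV :: bool set" n] by (simp add: bvecs_def)

lemma card_bvecs: "card (bvecs n) = 2 ^ n"
  using card_lists_length_eq[of "UNIV :: bool set" n] by (simp add: bvecs_def)

text \<open>The \<open>LEAST\<close> in \<open>mult_complexity\<close> has meaning only if some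
  circuit exists. The disjunctive normal form supplies one: literals are free, and a minterm costs
  \<open>n\<close>.\<close>

lemma and_cost_exists: "\<exists>C. and_cost n {} C f"
proof -
  have *: "and_cost n {} 0 (\<lambda>x. x ! i = y ! i)" if "i < n" for i and y :: "bool list"
    using and_cost_input[OF that, of "{}" 0] and_cost_not[OF and_cost_input[OF that, of "{}" 0]]
    by (cases "y ! i") simp_all
  have "and_cost n {} n (\<lambda>x. \<forall>i \<in> {..<n}. x ! i = y ! i)" for y
    using and_cost_Ball[of "{..<n}" n "{}" 0 "\<lambda>i x. x ! i = y ! i"] * by simp
  then have "and_cost n {} (card {y \<in> bvecs n. f y} * (n + 1))
      (\<lambda>x. \<exists>y \<in> {y \<in> bvecs n. f y}. \<forall>i \<in> {..<n}. x ! i = y ! i)"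
    by (intro and_cost_Bex) auto
  then have "and_cost n {} (card {y \<in> bvecs n. f y} * (n + 1)) f"
  proof (rule and_cost_cong)
    fix x :: "bool list" assume "length x = n"
    then have "(\<forall>i \<in> {..<n}. x ! i = y ! i) \<longleftrightarrow> x = y" if "y \<in> bvecs n" for y
      using that by (auto simp: bvecs_def intro: nth_equalityI)
    then show "(\<exists>y \<in> {y \<in> bvecs n. f y}. \<forall>i \<in> {..<n}. x ! i = y ! i) = f x"
      using \<open>length x = n\<close> by (auto simp: bvecs_def)
  qed
  then show ?thesis ..
qed

lemma mult_complexity_attained:
  "\<exists>gs out. circuit_computes n gs out f \<and> and_count gs = mult_complexity n f"
proof -
  obtain C where C: "and_cost n {} C f" using and_cost_exists by blast
  obtain gs where "wf_gates n gs" "on_wire n gs f" "and_count gs \<le> C"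
    using and_costE[OF C, of "[]"] by (auto simp: wf_gates_def)
  then obtain w where "circuit_computes n gs w f"
    by (auto simp: on_wire_def circuit_computes_def wf_circuit_def wf_gates_def)
  then have "\<exists>m gs out. circuit_computes n gs out f \<and> and_count gs = m" by blast
  then show ?thesis unfolding mult_complexity_def by (rule LeastI_ex)
qed

section \<open>Turing machine computations as circuits\<close>

text \<open>A unary (one-hot) encoding of configurations: one Boolean test for each possible state,
  head position and cell content within the window of cells up to \<open>P\<close>. In
  \<open>obs_funs\<close> the configuration is a function of the circuit input, so every test
  becomes a Boolean function.\<close>

definition obs :: "tm \<Rightarrow> nat \<Rightarrow> (config \<Rightarrow> bool) set" where
  "obs M P = (\<lambda>q c. fst c = q) ` {..<tm_states M}
     \<union> (\<lambda>(i, j) c. snd (snd c ! i) = j) ` ({..<tm_tapes M} \<times> {..P})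
     \<union> (\<lambda>(i, j, a) c. fst (snd c ! i) j = a) ` ({..<tm_tapes M} \<times> {..P} \<times> {..<tm_symbols M})"

definition obs_funs :: "tm \<Rightarrow> nat \<Rightarrow> (bool list \<Rightarrow> config) \<Rightarrow> (bool list \<Rightarrow> bool) set" where
  "obs_funs M P c = (\<lambda>\<phi> x. \<phi> (c x)) ` obs M P"

lemma finite_obs: "finite (obs M P)"
  by (simp add: obs_def)

lemma card_obs: "card (obs M P) \<le> tm_states M + tm_tapes M * (P + 1) + tm_tapes M * (P + 1) * tm_symbols M"
proof -
  have "card (obs M P) \<le> card ((\<lambda>q (c::config). fst c = q) ` {..<tm_states M})
      + card ((\<lambda>(i, j) (c::config). snd (snd c ! i) = j) ` ({..<tm_tapes M} \<times> {..P}))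
      + card ((\<lambda>(i, j, a) (c::config). fst (snd c ! i) j = a) ` ({..<tm_tapes M} \<times> {..P} \<times> {..<tm_symbols M}))"
    unfolding obs_def by (meson add_mono card_Un_le le_refl order_trans)
  also have "\<dots> \<le> card {..<tm_states M} + card ({..<tm_tapes M} \<times> {..P})
      + card ({..<tm_tapes M} \<times> {..P} \<times> {..<tm_symbols M})"
    by (intro add_mono card_image_le) auto
  finally show ?thesis by (simp add: card_cartesian_product algebra_simps)
qed

lemma obs_funs_intros:
  "q < tm_states M \<Longrightarrow> (\<lambda>x. fst (c x) = q) \<in> obs_funs M P c"
  "i < tm_tapes M \<Longrightarrow> j \<le> P \<Longrightarrow> (\<lambda>x. snd (snd (c x) ! i) = j) \<in> obs_funs M P c"
  "i < tm_tapes M \<Longrightarrow> j \<le> P \<Longrightarrow> a < tm_symbols M \<Longrightarrow> (\<lambda>x. fst (snd (c x) ! i) j = a) \<in> obs_funs M P c"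
proof -
  have obs: "\<phi> \<in> obs M P \<Longrightarrow> (\<lambda>x. \<phi> (c x)) \<in> obs_funs M P c" for \<phi>
    unfolding obs_funs_def by blast
  show "(\<lambda>x. fst (c x) = q) \<in> obs_funs M P c" if "q < tm_states M"
    by (rule obs) (use that in \<open>auto simp: obs_def\<close>)
  show "(\<lambda>x. snd (snd (c x) ! i) = j) \<in> obs_funs M P c" if "i < tm_tapes M" "j \<le> P"
    by (rule obs, unfold obs_def, rule UnI1, rule UnI2, rule image_eqI[of _ _ "(i, j)"]) (use that in auto)
  show "(\<lambda>x. fst (snd (c x) ! i) j = a) \<in> obs_funs M P c" if "i < tm_tapes M" "j \<le> P" "a < tm_symbols M"
    by (rule obs, unfold obs_def, rule UnI2, rule image_eqI[of _ _ "(i, j, a)"]) (use that in auto)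
qed

lemma obs_funs_cases:
  assumes "f \<in> obs_funs M P c"
  obtains (state) q where "q < tm_states M" "f = (\<lambda>x. fst (c x) = q)"
  | (head) i j where "i < tm_tapes M" "j \<le> P" "f = (\<lambda>x. snd (snd (c x) ! i) = j)"
  | (cell) i j a where "i < tm_tapes M" "j \<le> P" "a < tm_symbols M" "f = (\<lambda>x. fst (snd (c x) ! i) j = a)"
  using assms unfolding obs_funs_def obs_def by auto

text \<open>All functions in \<open>G\<close> have to appear in one and the same extended circuit.
  The costs of successive layers of a computation then add up, where separate circuits for each
  function would multiply them.\<close>

definition and_cost_all ::
  "nat \<Rightarrow> (bool list \<Rightarrow> bool) set \<Rightarrow> nat \<Rightarrow> (bool list \<Rightarrow> bool) set \<Rightarrow> bool" where
  "and_cost_all n F C G \<longleftrightarrow> (\<forall>gs. wf_gates n gs \<and> (\<forall>h \<in> F. on_wire n gs h) \<longrightarrow>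
     (\<exists>hs. wf_gates n (gs @ hs) \<and> (\<forall>f \<in> G. on_wire n (gs @ hs) f) \<and> and_count hs \<le> C))"

lemma and_cost_allI:
  assumes "finite G" "\<And>f. f \<in> G \<Longrightarrow> and_cost n F C f"
  shows "and_cost_all n F (card G * C) G"
  using assms
proof (induction G rule: finite_induct)
  case empty
  then show ?case unfolding and_cost_all_def by (auto intro: exI[of _ "[]"])
next
  case (insert f G)
  show ?case unfolding and_cost_all_def
  proof (intro allI impI)
    fix gs assume gs: "wf_gates n gs \<and> (\<forall>h \<in> F. on_wire n gs h)"
    then obtain hs where hs: "wf_gates n (gs @ hs)" "\<forall>f \<in> G. on_wire n (gs @ hs) f" "and_count hs \<le> card G * C"
      using insert.IH insert.prems unfolding and_cost_all_def by blast
    have "on_wire n (gs @ hs) h" if "h \<in> F" for h using that gs on_wire_append by blast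
    then obtain ks where "wf_gates n ((gs @ hs) @ ks)" "on_wire n ((gs @ hs) @ ks) f" "and_count ks \<le> C"
      using and_costE[OF insert.prems[of f] hs(1)] by auto
    then show "\<exists>hs. wf_gates n (gs @ hs) \<and> (\<forall>f \<in> insert f G. on_wire n (gs @ hs) f) \<and>
        and_count hs \<le> card (insert f G) * C"
      using hs insert.hyps on_wire_append[of n "gs @ hs" _ ks]
      by (intro exI[of _ "hs @ ks"]) auto
  qed
qed

lemma and_cost_all_trans:
  assumes "and_cost_all n F C G" "and_cost_all n G D H"
  shows "and_cost_all n F (C + D) H"
  unfolding and_cost_all_def
proof (intro allI impI)
  fix gs assume gs: "wf_gates n gs \<and> (\<forall>h \<in> F. on_wire n gs h)"
  then obtain hs where hs: "wf_gates n (gs @ hs)" "\<forall>f \<in> G. on_wire n (gs @ hs) f" "and_count hs \<le> C"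
    using assms(1) unfolding and_cost_all_def by blast
  then obtain ks where "wf_gates n ((gs @ hs) @ ks)" "\<forall>f \<in> H. on_wire n ((gs @ hs) @ ks) f" "and_count ks \<le> D"
    using assms(2) unfolding and_cost_all_def by blast
  then show "\<exists>hs. wf_gates n (gs @ hs) \<and> (\<forall>f \<in> H. on_wire n (gs @ hs) f) \<and> and_count hs \<le> C + D"
    using hs by (intro exI[of _ "hs @ ks"]) auto
qed

lemma and_cost_all_member: "and_cost_all n F C G \<Longrightarrow> f \<in> G \<Longrightarrow> and_cost n F C f"
  unfolding and_cost_all_def and_cost_def by blast

text \<open>With halting expressed as an idle transition, a step depends on the state and the
  scanned symbols in a uniform way, without a case distinction.\<close>

definition full_trans :: "tm \<Rightarrow> transition" where
  "full_trans M q ss = (if q = tm_halt M then (q, keep ss) else tm_trans M q ss)"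

lemma tm_step_full_trans: "tm_step M c = apply_trans (full_trans M) c"
  by (cases c) (auto simp: tm_step_def halted_def full_trans_def apply_trans_def map2_act_keep
      simp del: map_map)

definition view_count :: "tm \<Rightarrow> nat" where
  "view_count M = tm_states M * tm_symbols M ^ tm_tapes M"

text \<open>A view is a state together with the scanned symbols. Recognizing one costs
  \<open>2 * P + 3\<close> per tape, namely a scan of the window and a conjunction; the remaining 2
  are the conjunction with the state and the disjunction over views. The number of views depends on
  \<open>M\<close> alone.\<close>

definition view_cost :: "tm \<Rightarrow> nat \<Rightarrow> nat" where
  "view_cost M P = view_count M * (tm_tapes M * (2 * P + 3) + 2)"

context
  fixes M :: tm and n P :: nat and c :: "bool list \<Rightarrow> config"
  assumes wf: "wf_tm M"
    and wfc: "\<And>x. length x = n \<Longrightarrow> wf_config M (c x)"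
    and heads: "\<And>x i. length x = n \<Longrightarrow> i < tm_tapes M \<Longrightarrow> snd (snd (c x) ! i) \<le> P"
begin

text \<open>The head is at exactly one position of the window, so the scanned symbol is found by a
  disjunction over that position.\<close>

lemma and_cost_read:
  assumes "i < tm_tapes M" "a < tm_symbols M"
  shows "and_cost n (obs_funs M P c) (2 * (P + 1)) (\<lambda>x. read_tape (snd (c x) ! i) = a)"
proof -
  have "and_cost n (obs_funs M P c) (0 + 0 + 1) (\<lambda>x. snd (snd (c x) ! i) = j \<and> fst (snd (c x) ! i) j = a)"
    if "j \<in> {..P}" for j
    using assms that by (intro and_cost_and and_cost_mem obs_funs_intros) auto
  then have "and_cost n (obs_funs M P c) (card {..P} * (1 + 1))
      (\<lambda>x. \<exists>j \<in> {..P}. snd (snd (c x) ! i) = j \<and> fst (snd (c x) ! i) j = a)"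
    by (intro and_cost_Bex) auto
  then have "and_cost n (obs_funs M P c) (card {..P} * (1 + 1)) (\<lambda>x. read_tape (snd (c x) ! i) = a)"
  proof (rule and_cost_cong)
    fix x :: "bool list" assume "length x = n"
    then show "(\<exists>j \<in> {..P}. snd (snd (c x) ! i) = j \<and> fst (snd (c x) ! i) j = a) =
        (read_tape (snd (c x) ! i) = a)"
      using heads[of x i] assms by (cases "snd (c x) ! i") auto
  qed
  then show ?thesis by (rule and_cost_mono) simp
qed

text \<open>Any predicate of a view is the disjunction over those of the finitely many views that
  satisfy it.\<close>

lemma and_cost_view:
  "and_cost n (obs_funs M P c) (view_cost M P) (\<lambda>x. \<phi> (fst (c x)) (map read_tape (snd (c x))))"
proof -
  define L where "L = {ss. set ss \<subseteq> {..<tm_symbols M} \<and> length ss = tm_tapes M}"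
  define V where "V = {(q, ss). (q, ss) \<in> {..<tm_states M} \<times> L \<and> \<phi> q ss}"
  have L: "finite L" "card L = tm_symbols M ^ tm_tapes M"
    unfolding L_def using finite_lists_length_eq[of "{..<tm_symbols M}" "tm_tapes M"]
      card_lists_length_eq[of "{..<tm_symbols M}" "tm_tapes M"] by auto
  have sub: "V \<subseteq> {..<tm_states M} \<times> L" by (auto simp: V_def)
  then have V: "finite V" "card V \<le> view_count M"
    using finite_subset[OF sub] card_mono[OF _ sub] L
    by (auto simp: view_count_def card_cartesian_product)
  let ?D = "0 + card {..<tm_tapes M} * (2 * (P + 1) + 1) + 1"
  have *: "and_cost n (obs_funs M P c) ?D
      (\<lambda>x. fst (c x) = fst v \<and> (\<forall>i \<in> {..<tm_tapes M}. read_tape (snd (c x) ! i) = snd v ! i))"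
    if "v \<in> V" for v
  proof -
    have "snd v ! i < tm_symbols M" if "i < tm_tapes M" for i
      using that \<open>v \<in> V\<close> nth_mem[of i "snd v"] by (auto simp: V_def L_def simp del: nth_mem)
    then show ?thesis using that
      by (intro and_cost_and and_cost_mem and_cost_Ball obs_funs_intros and_cost_read) (auto simp: V_def)
  qed
  have "and_cost n (obs_funs M P c) (card V * (?D + 1)) (\<lambda>x. \<exists>v \<in> V. fst (c x) = fst v \<and>
      (\<forall>i \<in> {..<tm_tapes M}. read_tape (snd (c x) ! i) = snd v ! i))"
    using V(1) * by (rule and_cost_Bex)
  then have "and_cost n (obs_funs M P c) (card V * (?D + 1))
      (\<lambda>x. \<phi> (fst (c x)) (map read_tape (snd (c x))))"
  proof (rule and_cost_cong)
    fix x :: "bool list" assume "length x = n"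
    note w = wfc[OF this]
    have r: "(\<forall>i \<in> {..<tm_tapes M}. read_tape (snd (c x) ! i) = ss ! i) \<longleftrightarrow> map read_tape (snd (c x)) = ss"
      if "length ss = tm_tapes M" for ss
      using w that by (auto simp: wf_config_def list_eq_iff_nth_eq)
    have "(fst (c x), map read_tape (snd (c x))) \<in> {..<tm_states M} \<times> L"
      using w wf_config_reads[OF w] by (auto simp: L_def wf_config_def)
    then have "(fst (c x), map read_tape (snd (c x))) \<in> V \<longleftrightarrow> \<phi> (fst (c x)) (map read_tape (snd (c x)))"
      by (simp add: V_def)
    moreover have "(\<exists>v \<in> V. fst (c x) = fst v \<and> (\<forall>i \<in> {..<tm_tapes M}. read_tape (snd (c x) ! i) = snd v ! i)) \<longleftrightarrow>
        (\<exists>v \<in> V. v = (fst (c x), map read_tape (snd (c x))))"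
    proof (rule bex_cong[OF refl])
      fix v assume "v \<in> V"
      then have "length (snd v) = tm_tapes M" by (auto simp: V_def L_def)
      from r[OF this] have eq: "(\<forall>i \<in> {..<tm_tapes M}. read_tape (snd (c x) ! i) = snd v ! i) \<longleftrightarrow>
          map read_tape (snd (c x)) = snd v" .
      show "(fst (c x) = fst v \<and> (\<forall>i \<in> {..<tm_tapes M}. read_tape (snd (c x) ! i) = snd v ! i)) =
          (v = (fst (c x), map read_tape (snd (c x))))"
        unfolding eq prod_eq_iff fst_conv snd_conv by metis
    qed
    ultimately show "(\<exists>v \<in> V. fst (c x) = fst v \<and> (\<forall>i \<in> {..<tm_tapes M}. read_tape (snd (c x) ! i) = snd v ! i)) =
        \<phi> (fst (c x)) (map read_tape (snd (c x)))"
      by simp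
  qed
  moreover have "?D + 1 = tm_tapes M * (2 * P + 3) + 2" by (simp add: algebra_simps)
  then have "card V * (?D + 1) \<le> view_cost M P"
    unfolding view_cost_def using V(2) by (metis mult_le_mono1)
  ultimately show ?thesis by (rule and_cost_mono)
qed

text \<open>Locality of a step: the new state depends on the view; a new head position on the old
  one and the view; a new cell content on the view if the head was there, and otherwise it is the
  old content. The stated cost is a common bound for the three cases.\<close>

lemma and_cost_step:
  assumes "f \<in> obs_funs M P (\<lambda>x. tm_step M (c x))"
  shows "and_cost n (obs_funs M P c) ((P + 1) * (view_cost M P + 3)) f"
proof -
  define as where "as q ss = snd (full_trans M q ss)" for q ss
  let ?v = "\<lambda>x \<phi>. \<phi> (fst (c x)) (map read_tape (snd (c x)))"
  have nth: "snd (tm_step M (c x)) ! i = act_tape (?v x as ! i) (snd (c x) ! i)"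
    if "length x = n" "i < tm_tapes M" for x i
  proof -
    have "length (snd (c x)) = tm_tapes M" "length (snd (tm_step M (c x))) = tm_tapes M"
      using wfc[OF that(1)] wf_config_step[OF wf wfc[OF that(1)]] by (auto simp: wf_config_def)
    then show ?thesis using that
      by (auto simp: tm_step_full_trans apply_trans_def as_def split: prod.splits)
  qed
  from assms show ?thesis
  proof (cases rule: obs_funs_cases)
    case (state q)
    have "and_cost n (obs_funs M P c) (view_cost M P)
        (\<lambda>x. ?v x (\<lambda>q' ss. fst (full_trans M q' ss) = q))" by (rule and_cost_view)
    then have "and_cost n (obs_funs M P c) (view_cost M P) f"
      unfolding state
      by (rule and_cost_cong) (simp add: tm_step_full_trans apply_trans_def split: prod.splits)
    then show ?thesis by (rule and_cost_mono) simp
  next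
    case (head i j)
    have "and_cost n (obs_funs M P c) (0 + view_cost M P + 1) (\<lambda>x. snd (snd (c x) ! i) = h \<and>
        ?v x (\<lambda>q ss. move (snd (as q ss ! i)) h = j))" if "h \<in> {..P}" for h
      using that head by (intro and_cost_and and_cost_view and_cost_mem obs_funs_intros) auto
    then have "and_cost n (obs_funs M P c) (card {..P} * (0 + view_cost M P + 1 + 1))
      (\<lambda>x. \<exists>h \<in> {..P}. snd (snd (c x) ! i) = h \<and> ?v x (\<lambda>q ss. move (snd (as q ss ! i)) h = j))"
      by (intro and_cost_Bex) auto
    then have "and_cost n (obs_funs M P c) (card {..P} * (0 + view_cost M P + 1 + 1)) f"
      unfolding head
    proof (rule and_cost_cong)
      fix x :: "bool list" assume x: "length x = n"
      show "(\<exists>h \<in> {..P}. snd (snd (c x) ! i) = h \<and> ?v x (\<lambda>q ss. move (snd (as q ss ! i)) h = j)) =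
          (snd (snd (tm_step M (c x)) ! i) = j)"
        using heads[OF x head(1)] nth[OF x head(1)]
        by (cases "?v x as ! i"; cases "snd (c x) ! i") auto
    qed
    then show ?thesis by (rule and_cost_mono) (simp add: algebra_simps)
  next
    case (cell i j a)
    have "and_cost n (obs_funs M P c) ((0 + view_cost M P + 1) + (0 + 0 + 1) + 1)
      (\<lambda>x. (snd (snd (c x) ! i) = j \<and> ?v x (\<lambda>q ss. fst (as q ss ! i) = a)) \<or>
           (\<not> snd (snd (c x) ! i) = j \<and> fst (snd (c x) ! i) j = a))"
      using cell
      by (intro and_cost_or and_cost_and and_cost_not and_cost_view and_cost_mem obs_funs_intros) auto
    then have "and_cost n (obs_funs M P c) ((0 + view_cost M P + 1) + (0 + 0 + 1) + 1) f"
      unfolding cell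
    proof (rule and_cost_cong)
      fix x :: "bool list" assume x: "length x = n"
      show "((snd (snd (c x) ! i) = j \<and> ?v x (\<lambda>q ss. fst (as q ss ! i) = a)) \<or>
           (\<not> snd (snd (c x) ! i) = j \<and> fst (snd (c x) ! i) j = a)) =
          (fst (snd (tm_step M (c x)) ! i) j = a)"
        using nth[OF x cell(1)]
        by (cases "?v x as ! i"; cases "snd (c x) ! i") auto
    qed
    then show ?thesis by (rule and_cost_mono) simp
  qed
qed

end

text \<open>The number of tests times the cost of updating one of them; for fixed \<open>M\<close>
  this is a polynomial in \<open>P\<close>.\<close>

definition step_cost :: "tm \<Rightarrow> nat \<Rightarrow> nat" where
  "step_cost M P = (tm_states M + tm_tapes M * (P + 1) + tm_tapes M * (P + 1) * tm_symbols M) *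
     ((P + 1) * (view_cost M P + 3))"

lemma and_cost_all_mono: "and_cost_all n F C G \<Longrightarrow> C \<le> C' \<Longrightarrow> and_cost_all n F C' G"
  unfolding and_cost_all_def by (meson order_trans)

text \<open>One window serves the whole computation, since no head passes cell \<open>t\<close>
  within \<open>t\<close> steps.\<close>

lemma and_cost_all_steps:
  assumes wf: "wf_tm M" and t: "t \<le> P"
  shows "and_cost_all n (obs_funs M P (\<lambda>x. init_config M (e x))) (t * step_cost M P)
    (obs_funs M P (\<lambda>x. (tm_step M ^^ t) (init_config M (e x))))"
  using t
proof (induction t)
  case 0
  then show ?case unfolding and_cost_all_def by (auto intro: exI[of _ "[]"])
next
  case (Suc t)
  let ?c = "\<lambda>x. (tm_step M ^^ t) (init_config M (e x))"
  let ?G = "obs_funs M P (\<lambda>x. tm_step M (?c x))"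
  have "\<forall>tp \<in> set (snd (init_config M x)). snd tp = 0" for x
    by (auto simp: init_config_def init_tape_def)
  then have heads: "snd (snd (?c x) ! i) \<le> t" if "i < tm_tapes M" for x i
    using tm_steps_head_le[OF wf wf_config_init[OF wf] _ that, of "e x" t] by blast
  have "and_cost_all n (obs_funs M P ?c) (card ?G * ((P + 1) * (view_cost M P + 3))) ?G"
  proof (rule and_cost_allI)
    show "finite ?G" by (simp add: obs_funs_def finite_obs)
    show "and_cost n (obs_funs M P ?c) ((P + 1) * (view_cost M P + 3)) f" if "f \<in> ?G" for f
      using wf wf_config_steps[OF wf wf_config_init[OF wf]] heads Suc.prems
      by (intro and_cost_step[OF _ _ _ that]) (auto intro: order_trans[of _ t])
  qed
  moreover have "card ?G \<le> card (obs M P)"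
    unfolding obs_funs_def by (rule card_image_le[OF finite_obs])
  then have "card ?G * ((P + 1) * (view_cost M P + 3)) \<le> step_cost M P"
    unfolding step_cost_def using card_obs[of M P] by (intro mult_right_mono) auto
  ultimately have "and_cost_all n (obs_funs M P ?c) (step_cost M P) ?G"
    by (rule and_cost_all_mono)
  from and_cost_all_trans[OF Suc.IH this] Suc.prems show ?case by (simp add: add.commute)
qed

text \<open>A one-bit output can be read off a single test, the content of cell 1.\<close>

lemma tape_word_singleton:
  assumes "tape_word tp = [b]"
  shows "b \<longleftrightarrow> fst tp 1 = 3"
proof -
  let ?l = "LEAST j. 1 \<le> j \<and> fst tp j \<notin> {2, 3}"
  have "[1..<?l] \<noteq> []" using assms unfolding tape_word_def by fastforce
  then have "[1..<?l] = 1 # [2..<?l]" by (simp add: upt_conv_Cons numeral_eq_Suc)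
  with assms show ?thesis unfolding tape_word_def by auto
qed

text \<open>The map \<open>e\<close> prepares the machine input from the circuit input. Its bits
  cost no AND gate, so constants such as a key or padding can be wired in, and the initial
  configuration is free.\<close>

theorem mult_complexity_tm_le:
  assumes wf: "wf_tm M"
    and e: "\<And>x. length x = n \<Longrightarrow> length (e x) = l"
    and bits: "\<And>i. i < l \<Longrightarrow> and_cost n {} 0 (\<lambda>x. e x ! i)"
    and out: "\<And>x. length x = n \<Longrightarrow> outputs_within M (e x) t [f x]"
  shows "mult_complexity n f \<le> (t + 1) * step_cost M (t + 1)"
proof -
  \<comment> \<open>The window has to contain cell 1, where the output is read, even if
    \<open>t\<close> is 0.\<close>
  let ?P = "t + 1" and ?c = "\<lambda>t x. (tm_step M ^^ t) (init_config M (e x))"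
  have "and_cost n {} 0 h" if h: "h \<in> obs_funs M ?P (?c 0)" for h
    using h
  proof (cases rule: obs_funs_cases)
    case (state q)
    then show ?thesis by (auto simp: init_config_def intro: and_cost_const)
  next
    case (head i j)
    have "and_cost n {} 0 (\<lambda>x. j = 0)" by (rule and_cost_const)
    then show ?thesis unfolding head
      by (rule and_cost_cong) (use head(1) in \<open>auto simp: init_config_def init_tape_def nth_Cons split: nat.split\<close>)
  next
    case (cell i j a)
    have dep: "and_cost n {} 0 (\<lambda>x. (if e x ! k then 3 else 2) = a)" if "k < l" for k
    proof -
      have "(\<lambda>x. (if e x ! k then 3 else 2) = a) =
          (if a = 3 then (\<lambda>x. e x ! k) else if a = 2 then (\<lambda>x. \<not> e x ! k) else (\<lambda>x. False))"
        by auto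
      then show ?thesis
        using bits[OF that] and_cost_not[OF bits[OF that]] and_cost_const[of n "{}" 0 False] by simp
    qed
    show ?thesis
    proof (cases "i = 0 \<and> 0 < j \<and> j \<le> l")
      case True
      then have "and_cost n {} 0 (\<lambda>x. (if e x ! (j - 1) then 3 else 2) = a)" by (intro dep) auto
      then show ?thesis unfolding cell
        by (rule and_cost_cong) (use True e in \<open>auto simp: init_config_def init_tape_def\<close>)
    next
      case False
      have "and_cost n {} 0 (\<lambda>x. (if j = 0 then 1 else 0) = a)" by (rule and_cost_const)
      then show ?thesis unfolding cell
      proof (rule and_cost_cong)
        fix x :: "bool list" assume "length x = n"
        then show "((if j = 0 then 1 else 0) = a) = (fst (snd (?c 0 x) ! i) j = a)"
          using False e[of x] cell(1)
          by (cases i) (auto simp: init_config_def init_tape_def)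
      qed
    qed
  qed
  then have "and_cost_all n {} (card (obs_funs M ?P (?c 0)) * 0) (obs_funs M ?P (?c 0))"
    by (intro and_cost_allI) (auto simp: obs_funs_def finite_obs)
  from and_cost_all_trans[OF this, of "t * step_cost M ?P" "obs_funs M ?P (?c t)"]
  have all: "and_cost_all n {} (t * step_cost M ?P) (obs_funs M ?P (?c t))"
    using and_cost_all_steps[OF wf, of t ?P n e] by simp
  have "1 < tm_tapes M" "3 < tm_symbols M" using wf by (auto simp: wf_tm_def)
  then have "(\<lambda>x. fst (snd (?c t x) ! 1) 1 = 3) \<in> obs_funs M ?P (?c t)"
    by (intro obs_funs_intros) auto
  from and_cost_all_member[OF all this]
  have "and_cost n {} (t * step_cost M ?P) f"
  proof (rule and_cost_cong)
    fix x :: "bool list" assume "length x = n"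
    from out[OF this] show "(fst (snd (?c t x) ! 1) 1 = 3) = f x"
      using tape_word_singleton[of "snd (?c t x) ! 1" "f x"]
      by (simp add: outputs_within_def Let_def out_word_def)
  qed
  then show ?thesis
    by (intro mult_complexity_le) (erule and_cost_mono, simp)
qed

section \<open>Counting functions of small multiplicative complexity\<close>

fun lincomb :: "bool list \<Rightarrow> (bool list \<Rightarrow> bool) list \<Rightarrow> bool list \<Rightarrow> bool" where
  "lincomb (a # w) (b # bs) x = ((a \<and> b x) \<noteq> lincomb w bs x)"
| "lincomb _ _ x = False"

definition lspan :: "(bool list \<Rightarrow> bool) list \<Rightarrow> (bool list \<Rightarrow> bool) set" where
  "lspan bs = (\<lambda>w. lincomb w bs) ` bvecs (length bs)"

lemma lincomb_xor:
  "length w = length bs \<Longrightarrow> length w' = length bs \<Longrightarrow>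
    lincomb (map2 (\<noteq>) w w') bs x = (lincomb w bs x \<noteq> lincomb w' bs x)"
proof (induction bs arbitrary: w w')
  case (Cons b bs)
  then show ?case by (cases w; cases w') auto
qed simp

lemma lincomb_append:
  "length w = length bs \<Longrightarrow> lincomb (w @ w') (bs @ bs') x = (lincomb w bs x \<noteq> lincomb w' bs' x)"
proof (induction bs arbitrary: w)
  case (Cons b bs)
  then show ?case by (cases w) auto
qed simp

lemma lincomb_zero: "lincomb (replicate k False) bs x = False"
proof (induction k arbitrary: bs)
  case (Suc k)
  then show ?case by (cases bs) auto
qed simp

lemma lspan_xor:
  assumes "f \<in> lspan bs" "h \<in> lspan bs"
  shows "(\<lambda>x. f x \<noteq> h x) \<in> lspan bs"
proof -
  obtain w w' where w: "length w = length bs" "length w' = length bs" "f = lincomb w bs" "h = lincomb w' bs"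
    using assms by (auto simp: lspan_def bvecs_def)
  then have "(\<lambda>x. f x \<noteq> h x) = lincomb (map2 (\<noteq>) w w') bs" 
    by (intro ext) (simp only: lincomb_xor)
  then show ?thesis using w by (auto simp: lspan_def bvecs_def)
qed

lemma lspan_append:
  assumes "f \<in> lspan bs"
  shows "f \<in> lspan (bs @ bs')"
proof -
  obtain w where w: "length w = length bs" "f = lincomb w bs"
    using assms by (auto simp: lspan_def bvecs_def)
  then have "f = lincomb (w @ replicate (length bs') False) (bs @ bs')"
    by (simp add: lincomb_append lincomb_zero fun_eq_iff)
  then show ?thesis using w by (auto simp: lspan_def bvecs_def)
qed

lemma lspan_snoc_new: "b \<in> lspan (bs @ [b])"
proof -
  have "b = lincomb (replicate (length bs) False @ [True]) (bs @ [b])"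
    by (simp add: lincomb_append lincomb_zero fun_eq_iff)
  then show ?thesis by (auto simp: lspan_def bvecs_def)
qed

lemma lspan_nth:
  assumes "i < length bs"
  shows "bs ! i \<in> lspan bs"
proof -
  have "bs = (take i bs @ [bs ! i]) @ drop (Suc i) bs" using assms by (simp add: id_take_nth_drop)
  then show ?thesis using lspan_append[OF lspan_snoc_new] by metis
qed

text \<open>A basis lists the \<open>m\<close> inputs, the constant one, and then \<open>s\<close>
  AND gates, each the product of two linear combinations of earlier entries. The constant turns
  linear combinations into affine ones. All entries vanish on words of other lengths, so that they
  belong to \<open>boolfuns m\<close>.\<close>

fun and_bases :: "nat \<Rightarrow> nat \<Rightarrow> (bool list \<Rightarrow> bool) list set" where
  "and_bases m 0 = {map (\<lambda>i x. length x = m \<and> x ! i) [0..<m] @ [\<lambda>x. length x = m]}"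
| "and_bases m (Suc s) = (\<lambda>(bs, w, w'). bs @ [\<lambda>x. lincomb w bs x \<and> lincomb w' bs x]) `
     (and_bases m s \<times> bvecs (m + 1 + s) \<times> bvecs (m + 1 + s))"

lemma length_and_bases: "bs \<in> and_bases m s \<Longrightarrow> length bs = m + 1 + s"
  by (induction s arbitrary: bs) auto

lemma finite_and_bases: "finite (and_bases m s)"
  by (induction s) auto

text \<open>Each of the \<open>s\<close> gates is given by two coefficient words, whose lengths are
  all bounded by the final \<open>m + 1 + s\<close>.\<close>

lemma card_and_bases: "card (and_bases m s) \<le> 2 ^ (2 * s * (m + 1 + s))"
proof (induction s)
  case (Suc s)
  have "card (and_bases m (Suc s)) \<le> card (and_bases m s \<times> bvecs (m + 1 + s) \<times> bvecs (m + 1 + s))"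
    unfolding and_bases.simps by (rule card_image_le) (simp add: finite_and_bases)
  also have "\<dots> = card (and_bases m s) * 2 ^ (2 * (m + 1 + s))"
    by (simp add: card_cartesian_product card_bvecs flip: power_add mult_2)
  also have "\<dots> \<le> 2 ^ (2 * s * (m + 1 + s)) * 2 ^ (2 * (m + 1 + s))"
    using Suc by (intro mult_right_mono) auto
  also have "\<dots> = 2 ^ (2 * Suc s * (m + 1 + s))" by (simp flip: power_add)
  also have "\<dots> \<le> 2 ^ (2 * Suc s * (m + 1 + Suc s))" by (intro power_increasing mult_left_mono) auto
  finally show ?case .
qed simp

lemma and_basesI:
  assumes "bs \<in> and_bases m s" "f \<in> lspan bs" "h \<in> lspan bs"
  shows "bs @ [\<lambda>x. f x \<and> h x] \<in> and_bases m (Suc s)"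
  using assms length_and_bases[OF assms(1)] by (force simp: lspan_def image_iff)

lemma lincomb_boolfuns:
  "set bs \<subseteq> boolfuns m \<Longrightarrow> lincomb w bs \<in> boolfuns m"
proof (induction bs arbitrary: w)
  case Nil
  then show ?case by (simp add: boolfuns_def)
next
  case (Cons b bs)
  then show ?case by (cases w) (auto simp: boolfuns_def)
qed

lemma and_bases_boolfuns: "bs \<in> and_bases m s \<Longrightarrow> set bs \<subseteq> boolfuns m"
proof (induction s arbitrary: bs)
  case 0
  then show ?case by (auto simp: boolfuns_def bvecs_def)
next
  case (Suc s)
  then obtain bs' w w' where bs: "bs' \<in> and_bases m s" "bs = bs' @ [\<lambda>x. lincomb w bs' x \<and> lincomb w' bs' x]"
    by auto
  have "lincomb w bs' \<in> boolfuns m" using Suc.IH[OF bs(1)] by (rule lincomb_boolfuns)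
  then have "(\<lambda>x. lincomb w bs' x \<and> lincomb w' bs' x) \<in> boolfuns m" by (simp add: boolfuns_def)
  then show ?case using Suc.IH[OF bs(1)] bs(2) by auto
qed

text \<open>XOR and constant gates stay in the span of the basis found so far; only AND gates extend
  it.\<close>

lemma wires_in_lspan:
  assumes "wf_gates m gs"
  shows "\<exists>bs \<in> and_bases m (and_count gs). \<forall>w < m + length gs. \<exists>h \<in> lspan bs.
    \<forall>x \<in> bvecs m. wire_vals gs x ! w = h x"
  using assms
proof (induction gs rule: rev_induct)
  case Nil
  let ?bs = "map (\<lambda>i x. length x = m \<and> x ! i) [0..<m] @ [\<lambda>x. length x = m]"
  have "\<exists>h \<in> lspan ?bs. \<forall>x \<in> bvecs m. wire_vals [] x ! w = h x" if "w < m" for w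
    using lspan_nth[of w ?bs] that
    by (intro bexI[of _ "?bs ! w"]) (auto simp: nth_append wire_vals_def bvecs_def)
  then show ?case by simp
next
  case (snoc g gs)
  have wf: "wf_gates m gs" and inp: "\<forall>j \<in> gate_inputs g. j < m + length gs"
    using snoc.prems by (auto simp: wf_gates_snoc)
  obtain bs where bs: "bs \<in> and_bases m (and_count gs)"
    and sp: "\<And>w. w < m + length gs \<Longrightarrow> \<exists>h \<in> lspan bs. \<forall>x \<in> bvecs m. wire_vals gs x ! w = h x"
    using snoc.IH[OF wf] by blast
  have "\<exists>bs' \<in> and_bases m (and_count (gs @ [g])). lspan bs \<subseteq> lspan bs' \<and>
      (\<exists>h \<in> lspan bs'. \<forall>x \<in> bvecs m. gate_val (wire_vals gs x) g = h x)"
  proof (cases g)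
    case (AndG i j)
    then obtain f h where fh: "f \<in> lspan bs" "h \<in> lspan bs"
      "\<forall>x \<in> bvecs m. wire_vals gs x ! i = f x" "\<forall>x \<in> bvecs m. wire_vals gs x ! j = h x"
      using sp inp by (metis gate_inputs.simps(1) insertCI)
    show ?thesis
      using and_basesI[OF bs fh(1,2)] lspan_append[of _ bs] lspan_snoc_new[of "\<lambda>x. f x \<and> h x" bs] fh AndG
      by (intro bexI[of _ "bs @ [\<lambda>x. f x \<and> h x]"]) (auto intro!: bexI[of _ "\<lambda>x. f x \<and> h x"] simp del: and_bases.simps)
  next
    case (XorG i j)
    then obtain f h where fh: "f \<in> lspan bs" "h \<in> lspan bs"
      "\<forall>x \<in> bvecs m. wire_vals gs x ! i = f x" "\<forall>x \<in> bvecs m. wire_vals gs x ! j = h x"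
      using sp inp by (metis gate_inputs.simps(2) insertCI)
    show ?thesis
      using bs lspan_xor[OF fh(1,2)] fh XorG
      by (intro bexI[of _ bs]) (auto intro!: bexI[of _ "\<lambda>x. f x \<noteq> h x"])
  next
    case OneG
    \<comment> \<open>The constant one is entry \<open>m\<close>, right behind the inputs, and later
      entries are only appended.\<close>
    have one: "(\<lambda>x. length x = m) \<in> lspan bs"
    proof -
      have "bs ! m = (\<lambda>x. length x = m)" if "bs \<in> and_bases m s" for s bs
        using that
      proof (induction s arbitrary: bs)
        case 0
        then show ?case by (simp add: nth_append)
      next
        case (Suc s)
        then obtain bs' u where "bs' \<in> and_bases m s" "bs = bs' @ [u]" by auto
        then show ?case using Suc.IH[of bs'] length_and_bases[of bs' m s] by (simp add: nth_append)
      qed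
      from this[OF bs] show ?thesis using lspan_nth[of m bs] length_and_bases[OF bs] by simp
    qed
    then show ?thesis using bs OneG
      by (intro bexI[of _ bs]) (auto simp: bvecs_def intro!: bexI[of _ "\<lambda>x. length x = m"])
  qed
  then obtain bs' h where bs': "bs' \<in> and_bases m (and_count (gs @ [g]))" "lspan bs \<subseteq> lspan bs'"
    "h \<in> lspan bs'" "\<forall>x \<in> bvecs m. gate_val (wire_vals gs x) g = h x" by blast
  have "\<exists>h \<in> lspan bs'. \<forall>x \<in> bvecs m. wire_vals (gs @ [g]) x ! w = h x" if "w < m + length (gs @ [g])" for w
  proof (cases "w < m + length gs")
    case True
    then obtain h where "h \<in> lspan bs" "\<forall>x \<in> bvecs m. wire_vals gs x ! w = h x" using sp by blast
    then show ?thesis using bs'(2) True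
      by (intro bexI[of _ h]) (auto simp: wire_vals_snoc nth_append bvecs_def)
  next
    case False
    then have "w = m + length gs" using that by simp
    then show ?thesis using bs'(3,4)
      by (intro bexI[of _ h]) (auto simp: wire_vals_snoc nth_append bvecs_def)
  qed
  then show ?case using bs'(1) by blast
qed

text \<open>A basis is padded by AND gates combining its first entry with itself. Functions of
  complexity at most \<open>s\<close> can thus be counted by bases with exactly \<open>s\<close>
  gates.\<close>

lemma and_bases_mono:
  assumes "s \<le> s'" "bs \<in> and_bases m s"
  shows "\<exists>bs' \<in> and_bases m s'. lspan bs \<subseteq> lspan bs'"
  using assms(1)
proof (induction s' rule: dec_induct)
  case base
  then show ?case using assms(2) by blast
next
  case (step k)
  then obtain bs' where bs': "bs' \<in> and_bases m k" "lspan bs \<subseteq> lspan bs'" by blast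
  have "bs' ! 0 \<in> lspan bs'" using length_and_bases[OF bs'(1)] by (intro lspan_nth) simp
  from and_basesI[OF bs'(1) this this] show ?case using bs'(2) lspan_append by blast
qed

text \<open>A function is determined by a basis and one more coefficient word for its output wire,
  which accounts for \<open>2 * s + 1\<close> words.\<close>

theorem card_mult_complexity_le:
  "card {f \<in> boolfuns m. mult_complexity m f \<le> s} \<le> 2 ^ ((2 * s + 1) * (m + 1 + s))"
proof -
  let ?S = "and_bases m s \<times> bvecs (m + 1 + s)"
  have "{f \<in> boolfuns m. mult_complexity m f \<le> s} \<subseteq> (\<lambda>(bs, w). lincomb w bs) ` ?S"
  proof
    fix f assume "f \<in> {f \<in> boolfuns m. mult_complexity m f \<le> s}"
    then have f: "f \<in> boolfuns m" "mult_complexity m f \<le> s" by auto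
    obtain gs out where gs: "circuit_computes m gs out f" "and_count gs = mult_complexity m f"
      using mult_complexity_attained by blast
    then have "wf_gates m gs" "out < m + length gs" "\<forall>x \<in> bvecs m. wire_vals gs x ! out = f x"
      by (auto simp: circuit_computes_def wf_circuit_def wf_gates_def)
    then obtain bs h where bs: "bs \<in> and_bases m (and_count gs)" "h \<in> lspan bs" "\<forall>x \<in> bvecs m. f x = h x"
      using wires_in_lspan[of m gs] by metis
    obtain bs' where bs': "bs' \<in> and_bases m s" "h \<in> lspan bs'"
      using and_bases_mono[OF _ bs(1), of s] f(2) gs(2) bs(2) by auto
    then obtain w where w: "w \<in> bvecs (m + 1 + s)" "h = lincomb w bs'"
      using length_and_bases[OF bs'(1)] by (auto simp: lspan_def)
    then have "h \<in> boolfuns m" using lincomb_boolfuns[OF and_bases_boolfuns[OF bs'(1)]] by simp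
    \<comment> \<open>The circuit determines \<open>f\<close> on words of length \<open>m\<close>
      only; elsewhere both functions are \<open>False\<close>.\<close>
    then have "f = h" using f(1) bs(3) by (auto simp: boolfuns_def fun_eq_iff)
    then show "f \<in> (\<lambda>(bs, w). lincomb w bs) ` ?S" using w bs'(1) by auto
  qed
  then have "card {f \<in> boolfuns m. mult_complexity m f \<le> s} \<le> card ((\<lambda>(bs, w). lincomb w bs) ` ?S)"
    by (intro card_mono) (auto simp: finite_and_bases)
  also have "\<dots> \<le> card ?S" by (intro card_image_le) (auto simp: finite_and_bases)
  also have "\<dots> \<le> 2 ^ (2 * s * (m + 1 + s)) * 2 ^ (m + 1 + s)"
    unfolding card_cartesian_product card_bvecs using card_and_bases by (intro mult_right_mono) auto
  also have "\<dots> = 2 ^ ((2 * s + 1) * (m + 1 + s))" by (simp add: algebra_simps flip: power_add)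
  finally show ?thesis .
qed

section \<open>Binary counters and truth tables\<close>

abbreviation val :: "bool list \<Rightarrow> nat" where
  "val \<equiv> horner_sum of_bool 2"

lemma val_less: "val xs < 2 ^ length xs"
  by (induction xs) auto

lemma val_append: "val (xs @ ys) = val xs + 2 ^ length xs * val ys"
  by (simp add: horner_sum_append)

lemma val_replicate_False [simp]: "val (replicate k False) = 0"
  by (induction k) auto

lemma val_replicate_True: "Suc (val (replicate k True)) = 2 ^ k"
  by (induction k) auto

lemma val_inject: "length xs = length ys \<Longrightarrow> val xs = val ys \<Longrightarrow> xs = ys"
proof (induction xs arbitrary: ys)
  case (Cons x xs)
  then obtain y ys' where ys: "ys = y # ys'" by (cases ys) auto
  have "x = y \<and> val xs = val ys'" using Cons.prems ys
    by (cases x; cases y) (simp_all, presburger+)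
  then show ?case using Cons ys by simp
qed simp

text \<open>This is why the threshold is a power of two: the machine only has to look for a bit 1
  from position \<open>t\<close> on. Leading zeros in \<open>ys\<close> do no harm.\<close>

lemma val_ge_iff: "2 ^ t \<le> val ys \<longleftrightarrow> (\<exists>i < length ys. t \<le> i \<and> ys ! i)"
proof (cases "\<exists>i < length ys. t \<le> i \<and> ys ! i")
  case True
  then obtain i where i: "i < length ys" "t \<le> i" "ys ! i" by blast
  have "ys = take i ys @ True # drop (Suc i) ys" using i id_take_nth_drop[of i ys] by simp
  then have "val ys = val (take i ys) + 2 ^ i * (1 + 2 * val (drop (Suc i) ys))"
    using i by (metis (no_types, lifting) val_append horner_sum_simps(2) length_take min.absorb4 of_bool_eq(2) order_less_imp_le)
  then have "2 ^ i \<le> val ys" by simp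
  moreover have "(2::nat) ^ t \<le> 2 ^ i" using i by (intro power_increasing) auto
  ultimately have "2 ^ t \<le> val ys" by linarith
  then show ?thesis using True by simp
next
  case False
  have "drop t ys = replicate (length (drop t ys)) False"
    using False by (intro replicate_eqI) (auto simp: in_set_conv_nth)
  then have "val (drop t ys) = 0" by (metis val_replicate_False)
  then have "val ys = val (take t ys)" using val_append[of "take t ys" "drop t ys"] by simp
  also have "\<dots> < 2 ^ length (take t ys)" by (rule val_less)
  also have "\<dots> \<le> 2 ^ t" by (rule power_increasing) auto
  finally show ?thesis using False by auto
qed

section \<open>Incrementing binary counters\<close>

abbreviation ones :: "bool list \<Rightarrow> nat" where
  "ones xs \<equiv> length (takeWhile id xs)"

text \<open>If all bits are set, \<open>drop\<close> yields the empty list and the word grows by one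
  bit.\<close>

definition inc :: "bool list \<Rightarrow> bool list" where
  "inc xs = replicate (ones xs) False @ True # drop (Suc (ones xs)) xs"

lemma takeWhile_ones: "takeWhile id xs = replicate (ones xs) True"
  by (rule replicate_eqI) (auto dest: set_takeWhileD)

lemma split_ones:
  "xs = replicate (ones xs) True @ drop (ones xs) xs"
  by (metis append_take_drop_id takeWhile_eq_take takeWhile_ones)

lemma nth_ones: "ones xs < length xs \<Longrightarrow> \<not> xs ! ones xs"
  using nth_length_takeWhile[of id xs] by simp

lemma val_inc: "val (inc xs) = Suc (val xs)"
proof -
  let ?k = "ones xs"
  have "val xs = val (replicate ?k True) + 2 ^ ?k * val (drop ?k xs)"
    using split_ones[of xs] val_append by (metis length_replicate)
  moreover have "val (drop ?k xs) = 2 * val (drop (Suc ?k) xs)"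
  proof (cases "?k < length xs")
    case True
    then have "drop ?k xs = False # drop (Suc ?k) xs"
      using nth_ones[OF True] by (metis Cons_nth_drop_Suc)
    then show ?thesis by simp
  qed simp
  ultimately show ?thesis using val_replicate_True[of ?k] by (simp add: inc_def val_append algebra_simps)
qed

lemma val_inc_iterate: "val ((inc ^^ i) xs) = val xs + i"
  by (induction i) (simp_all add: val_inc)

lemma length_inc: "length (inc xs) = max (length xs) (Suc (ones xs))"
  by (simp add: inc_def)

lemma ones_le: "ones xs \<le> length xs"
  by (rule length_takeWhile_le)

lemma two_power_ones_le: "2 ^ ones xs \<le> Suc (val xs)"
proof -
  have "val xs = val (replicate (ones xs) True) + 2 ^ ones xs * val (drop (ones xs) xs)"
    using split_ones[of xs] val_append by (metis length_replicate)
  then show ?thesis using val_replicate_True[of "ones xs"] by linarith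
qed

text \<open>\<open>ones xs\<close> is the exponent of 2 in \<open>val xs + 1\<close>. It reaches
  \<open>m\<close> exactly when the next value is \<open>2 ^ m\<close>, so the length of a carry
  reveals the end of the enumeration, whatever the length of the word.\<close>

lemma ones_less_iff:
  assumes "val xs < 2 ^ m"
  shows "ones xs < m \<longleftrightarrow> Suc (val xs) < 2 ^ m"
proof (cases "Suc (val xs) < 2 ^ m")
  case True
  then show ?thesis using two_power_ones_le[of xs]
    by (metis le_less_trans power_less_imp_less_exp one_less_numeral_iff semiring_norm(76))
next
  case False
  then have "val (inc xs) = 2 ^ m" using assms val_inc by simp
  moreover have "val (inc xs) = 2 ^ ones xs * (1 + 2 * val (drop (Suc (ones xs)) xs))"
    by (simp add: inc_def val_append)
  \<comment> \<open>The second factor is odd, so a smaller exponent of 2 would contradict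
    parity.\<close>
  ultimately have eq: "2 ^ m = 2 ^ ones xs * (1 + 2 * val (drop (Suc (ones xs)) xs))" by simp
  have "\<not> ones xs < m"
  proof
    assume "ones xs < m"
    then have "(2::nat) ^ m = 2 ^ ones xs * 2 ^ (m - ones xs)" by (simp flip: power_add)
    then have "2 ^ ones xs * 2 ^ (m - ones xs) = 2 ^ ones xs * (1 + 2 * val (drop (Suc (ones xs)) xs))"
      using eq by metis
    then have "(2::nat) ^ (m - ones xs) = 1 + 2 * val (drop (Suc (ones xs)) xs)"
      by (subst (asm) mult_left_cancel) auto
    moreover have "even ((2::nat) ^ (m - ones xs))" using \<open>ones xs < m\<close> by simp
    ultimately show False by simp
  qed
  then show ?thesis using False by simp
qed

text \<open>As long as the value stays below \<open>2 ^ k\<close>, every carry ends within the first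
  \<open>k\<close> bits.\<close>

lemma length_inc_iterate_le:
  "i < 2 ^ k \<Longrightarrow> length ((inc ^^ i) xs) \<le> max (length xs) k" if "val xs = 0" for xs
proof (induction i)
  case (Suc i)
  have "ones ((inc ^^ i) xs) < k"
    using ones_less_iff[of "(inc ^^ i) xs" k] Suc.prems that by (simp add: val_inc_iterate)
  then show ?case using Suc by (simp add: length_inc)
qed simp

lemma length_inc_iterate_ge: "length xs \<le> length ((inc ^^ i) xs)"
  by (induction i) (auto simp: length_inc)

text \<open>Defined through the counter because this is how the machine obtains it: as the length of
  the word reached after counting \<open>n\<close> input cells.\<close>

definition bit_length :: "nat \<Rightarrow> nat" where
  "bit_length n = length ((inc ^^ n) [])"

lemma less_two_power_bit_length: "n < 2 ^ bit_length n"
  using val_less[of "(inc ^^ n) []"] by (simp add: bit_length_def val_inc_iterate)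

text \<open>The word grows only by a carry over all its bits, and then the value is already large
  (\<open>two_power_ones_le\<close>). This bound keeps \<open>2 ^ ruler_length a n\<close>
  polynomial.\<close>

lemma two_power_bit_length_le: "2 ^ bit_length n \<le> 2 * n + 1"
proof (induction n)
  case 0
  then show ?case by (simp add: bit_length_def)
next
  case (Suc n)
  let ?xs = "(inc ^^ n) []"
  have b: "bit_length (Suc n) = max (bit_length n) (Suc (ones ?xs))"
    by (simp add: bit_length_def length_inc)
  have "2 ^ Suc (ones ?xs) \<le> 2 * Suc n + 1"
    using two_power_ones_le[of ?xs] by (simp add: val_inc_iterate)
  then show ?case using Suc unfolding b max_def by simp
qed

lemma bit_length_le: "bit_length n \<le> n"
proof (cases "n = 0")
  case False
  have "2 ^ bit_length n \<le> 2 * n + 1" by (rule two_power_bit_length_le)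
  also have "\<dots> < 2 ^ Suc n" using Suc_leI[OF less_exp[of n]] by simp
  finally have "bit_length n < Suc n" by (rule power_less_imp_less_exp[rotated]) simp
  then show ?thesis by simp
qed (simp add: bit_length_def)

text \<open>Lexicographic order is numerical order with the most significant bit first, whereas
  \<open>val\<close> expects the least significant bit first.\<close>

lemma map_val_rev_bvec_list: "map (\<lambda>x. val (rev x)) (bvec_list m) = [0..<2 ^ m]"
  and length_bvec_list: "x \<in> set (bvec_list m) \<Longrightarrow> length x = m"
proof -
  have len: "x \<in> set (bvec_list m) \<Longrightarrow> length x = m" for x m
    by (induction m arbitrary: x) auto
  then show "x \<in> set (bvec_list m) \<Longrightarrow> length x = m" .
  show "map (\<lambda>x. val (rev x)) (bvec_list m) = [0..<2 ^ m]"
  proof (induction m)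
    case (Suc m)
    have "map (\<lambda>x. val (rev (True # x))) (bvec_list m) = map (\<lambda>k. k + 2 ^ m) (map (\<lambda>x. val (rev x)) (bvec_list m))"
      unfolding map_map by (rule map_cong) (auto simp: val_append dest: len)
    also have "\<dots> = [2 ^ m..<2 ^ m + 2 ^ m]" unfolding Suc by (simp add: map_add_upt)
    finally have "map (\<lambda>x. val (rev (True # x))) (bvec_list m) = [2 ^ m..<2 ^ m + 2 ^ m]" .
    moreover have "map (\<lambda>x. val (rev (False # x))) (bvec_list m) = [0..<2 ^ m]"
      using Suc by (simp add: val_append)
    ultimately show ?case by (simp add: mult_2 comp_def upt_add_eq_append[of 0, simplified])
  qed simp
qed

text \<open>
  Queries are the states of an \<open>n\<close>-bit counter with the least significant bit first, whereas truth
  tables list their arguments with the most significant bit first; hence the reversal. If \<open>m > n\<close>,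
  the counter outgrows \<open>n\<close> bits, which keeps the machine total.
\<close>

definition sub_fun :: "nat \<Rightarrow> nat \<Rightarrow> (bool list \<Rightarrow> bool) \<Rightarrow> bool list \<Rightarrow> bool" where
  "sub_fun n m g x = (x \<in> bvecs m \<and> g ((inc ^^ val (rev x)) (replicate n False)))"

lemma sub_fun_boolfuns: "sub_fun n m g \<in> boolfuns m"
  by (simp add: sub_fun_def boolfuns_def)

lemma truth_table_sub_fun:
  "truth_table m (sub_fun n m g) = map (\<lambda>i. g ((inc ^^ i) (replicate n False))) [0..<2 ^ m]"
proof -
  have "truth_table m (sub_fun n m g) =
      map (\<lambda>i. g ((inc ^^ i) (replicate n False))) (map (\<lambda>x. val (rev x)) (bvec_list m))"
    unfolding truth_table_def map_map
    by (rule map_cong) (auto simp: sub_fun_def bvecs_def dest: length_bvec_list)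
  then show ?thesis by (simp add: map_val_rev_bvec_list)
qed

text \<open>For \<open>m \<le> n\<close> the counter never outgrows its \<open>n\<close> bits, and
  the function is an honest restriction: the last \<open>n - m\<close> arguments are fixed to
  \<open>False\<close>.\<close>

lemma sub_fun_eq:
  assumes "m \<le> n" "length x = m"
  shows "sub_fun n m g x = g (rev x @ replicate (n - m) False)"
proof -
  have v: "val (rev x) < 2 ^ m" using val_less[of "rev x"] assms by simp
  let ?w = "(inc ^^ val (rev x)) (replicate n False)"
  have "length ?w = n"
    using length_inc_iterate_le[of "replicate n False" _ m, OF _ v] length_inc_iterate_ge[of "replicate n False"]
      assms by (simp add: le_antisym)
  then have "?w = rev x @ replicate (n - m) False"
    using assms by (intro val_inject) (auto simp: val_inc_iterate val_append)
  then show ?thesis using assms by (simp add: sub_fun_def bvecs_def)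
qed

section \<open>Tapes holding words\<close>

abbreviation wtape :: "bool list \<Rightarrow> nat \<Rightarrow> tape" where
  "wtape xs h \<equiv> (fst (init_tape xs), h)"

lemma wtape_0: "wtape xs 0 = init_tape xs"
  by (simp add: init_tape_def)

lemma wtape_read:
  "fst (init_tape xs) 0 = 1"
  "fst (init_tape xs) (Suc i) = (if i < length xs then if xs ! i then 3 else 2 else 0)"
  by (auto simp: init_tape_def)

text \<open>Covers overwriting a word from left to right as well as extending it, because
  \<open>drop i xs\<close> is empty from the end of \<open>xs\<close> on.\<close>

lemma wtape_write:
  assumes "length ys = i"
  shows "(fst (init_tape (ys @ drop i xs)))(Suc i := (if b then 3 else 2)) =
    fst (init_tape ((ys @ [b]) @ drop (Suc i) xs))"
proof
  fix j
  show "((fst (init_tape (ys @ drop i xs)))(Suc i := (if b then 3 else 2))) j =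
    fst (init_tape ((ys @ [b]) @ drop (Suc i) xs)) j"
  proof (cases j)
    case (Suc k)
    then show ?thesis using assms
      by (cases "k < length xs"; cases "k < i"; cases "k = i") (auto simp: wtape_read nth_append)
  qed (simp add: wtape_read)
qed

lemma tape_word_wtape [simp]: "tape_word (wtape xs h) = xs"
proof -
  have "(LEAST j. 1 \<le> j \<and> fst (init_tape xs) j \<notin> {2, 3}) = Suc (length xs)"
  proof (rule Least_equality)
    fix j assume "1 \<le> j \<and> fst (init_tape xs) j \<notin> {2, 3}"
    then show "Suc (length xs) \<le> j" by (cases j) (auto simp: wtape_read split: if_splits)
  qed (simp add: wtape_read)
  then show ?thesis
    by (intro nth_equalityI) (simp_all add: tape_word_def wtape_read del: upt_Suc)
qed


section \<open>The distinguisher\<close>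

abbreviation mv :: "nat \<Rightarrow> dir \<Rightarrow> prog" where
  "mv i d \<equiv> Act i None d"

abbreviation wr :: "nat \<Rightarrow> nat \<Rightarrow> dir \<Rightarrow> prog" where
  "wr i s d \<equiv> Act i (Some s) d"

lemma runs_mv:
  assumes "i < length ts" "ts' = ts[i := (fst (ts ! i), move d (snd (ts ! i)))]"
  shows "runs g (mv i d) ts 1 ts'"
  using runs_Act[OF assms(1), of g None d] assms(2) by (cases "ts ! i") simp

lemma runs_wr:
  assumes "i < length ts" "ts' = ts[i := ((fst (ts ! i))(snd (ts ! i) := s), move d (snd (ts ! i)))]"
  shows "runs g (wr i s d) ts 1 ts'"
  using runs_Act[OF assms(1), of g "Some s" d] assms(2) by (cases "ts ! i") simp

lemma runs_conv:
  assumes "runs g p ts B ts'" "ts = us" "ts' = us'" "B \<le> B'"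
  shows "runs g p us B' us'"
  using assms runs_weaken by metis

section \<open>Subroutines: rewinding heads and propagating carries\<close>

definition back1 :: "nat \<Rightarrow> prog" where
  "back1 i = Loop (\<lambda>ss. ss ! i \<noteq> 1) (mv i MoveL)"

text \<open>Only tape \<open>i\<close> needs an intact left end marker; it tells when both heads are
  home. Tape \<open>j\<close> may hold anything, as the output tape of a simulated machine
  does.\<close>

definition back2 :: "nat \<Rightarrow> nat \<Rightarrow> prog" where
  "back2 i j = Loop (\<lambda>ss. ss ! i \<noteq> 1) (mv i MoveL ;; mv j MoveL)"

lemma wtape_marker: "fst (init_tape xs) h = Suc 0 \<longleftrightarrow> h = 0"
  by (simp add: init_tape_def)

lemma runs_back1:
  assumes "i < length ts" "ts ! i = wtape xs h"
  shows "runs g (back1 i) ts (2 * h + 1) (ts[i := wtape xs 0])"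
proof -
  let ?S = "\<lambda>k. ts[i := wtape xs (h - k)]"
  have run: "runs g (back1 i) (?S 0) (h * Suc 1 + 1) (?S h)"
    unfolding back1_def
  proof (rule runs_Loop_iterate)
    fix k assume "k < h"
    then show "map read_tape (?S k) ! i \<noteq> 1" using assms by (simp add: wtape_marker)
    show "runs g (mv i MoveL) (?S k) 1 (?S (Suc k))" using assms by (intro runs_mv) auto
  qed (use assms in \<open>simp add: wtape_marker\<close>)
  have "?S 0 = ts" using assms by (metis list_update_id minus_nat.diff_0)
  from runs_conv[OF run this] show ?thesis by simp
qed

lemma runs_back2:
  assumes "i < length ts" "j < length ts" "i \<noteq> j" "ts ! i = wtape xs h" "ts ! j = (c, h)"
  shows "runs g (back2 i j) ts (3 * h + 1) (ts[i := wtape xs 0, j := (c, 0)])"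
proof -
  let ?S = "\<lambda>k. ts[i := wtape xs (h - k), j := (c, h - k)]"
  have run: "runs g (back2 i j) (?S 0) (h * Suc (1 + 1) + 1) (?S h)"
    unfolding back2_def
  proof (rule runs_Loop_iterate)
    fix k assume "k < h"
    then show "map read_tape (?S k) ! i \<noteq> 1" using assms by (simp add: wtape_marker)
    show "runs g (mv i MoveL ;; mv j MoveL) (?S k) (1 + 1) (?S (Suc k))"
    proof (rule runs_Seq)
      show "runs g (mv i MoveL) (?S k) 1 (ts[i := wtape xs (h - Suc k), j := (c, h - k)])"
        using assms by (intro runs_mv) (auto simp: list_update_swap)
      show "runs g (mv j MoveL) (ts[i := wtape xs (h - Suc k), j := (c, h - k)]) 1 (?S (Suc k))"
        using assms by (intro runs_mv) auto
    qed
  qed (use assms in \<open>simp add: wtape_marker\<close>)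
  have "?S 0 = ts" using assms by (metis list_update_id minus_nat.diff_0)
  from runs_conv[OF run this] show ?thesis by simp
qed

text \<open>Clears the leading ones but leaves the final write to the caller. The head on tape 3
  keeps pace, so the symbol under it can tell whether the carry has passed the end of the
  ruler.\<close>

definition carry :: prog where
  "carry = Loop (\<lambda>ss. ss ! 2 = 3) (wr 2 2 MoveR ;; mv 3 MoveR)"

lemma runs_carry:
  "runs g carry (a # b # wtape xs 1 # (c, 1) # ms) (3 * length xs + 1)
    (a # b # wtape (replicate (ones xs) False @ drop (ones xs) xs) (Suc (ones xs)) # (c, Suc (ones xs)) # ms)"
proof -
  let ?S = "\<lambda>i. a # b # wtape (replicate i False @ drop i xs) (Suc i) # (c, Suc i) # ms"
  have run: "runs g carry (?S 0) (ones xs * Suc (1 + 1) + 1) (?S (ones xs))"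
    unfolding carry_def
  proof (rule runs_Loop_iterate)
    fix i assume i: "i < ones xs"
    have "xs ! i" using takeWhile_nth[OF i] i takeWhile_ones[of xs] by (metis nth_replicate)
    then show "map read_tape (?S i) ! 2 = 3"
      using i ones_le[of xs] by (simp add: wtape_read nth_append)
    show "runs g (wr 2 2 MoveR ;; mv 3 MoveR) (?S i) (1 + 1) (?S (Suc i))"
    proof (rule runs_Seq)
      show "runs g (wr 2 2 MoveR) (?S i) 1
          (a # b # wtape (replicate (Suc i) False @ drop (Suc i) xs) (Suc (Suc i)) # (c, Suc i) # ms)"
        using wtape_write[of "replicate i False" i xs False]
        by (intro runs_wr) (auto simp: replicate_append_same)
      show "runs g (mv 3 MoveR)
          (a # b # wtape (replicate (Suc i) False @ drop (Suc i) xs) (Suc (Suc i)) # (c, Suc i) # ms) 1 (?S (Suc i))"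
        by (intro runs_mv) auto
    qed
  next
    show "map read_tape (?S (ones xs)) ! 2 \<noteq> 3"
      using nth_ones[of xs] by (auto simp: wtape_read nth_append)
  qed
  show ?thesis by (rule runs_conv[OF run]) (use ones_le[of xs] in simp_all)
qed


lemma over_inc:
  "(fst (init_tape (replicate (ones xs) False @ drop (ones xs) xs)))(Suc (ones xs) := 3) = fst (init_tape (inc xs))"
  using wtape_write[of "replicate (ones xs) False" "ones xs" xs True] by (simp add: inc_def)

section \<open>The stages of the distinguisher\<close>

definition count_loop :: prog where
  "count_loop = mv 0 MoveR ;; Loop (\<lambda>ss. ss ! 0 \<noteq> 0)
     (mv 2 MoveR ;; mv 3 MoveR ;; carry ;; wr 2 3 Stay ;; back2 2 3 ;; mv 0 MoveR)"

text \<open>Counting the unary input in binary leaves a word of length \<open>bit_length n\<close>,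
  the unit from which the ruler is made. Bounding that length by \<open>n\<close> gives quadratic
  time, which is good enough.\<close>

lemma runs_count_loop:
  "runs g count_loop
    (wtape (replicate n True) 0 # b # wtape [] 0 # wtape rs 0 # ms) (n * (6 * n + 10) + 2)
    (wtape (replicate n True) (Suc n) # b # wtape ((inc ^^ n) []) 0 # wtape rs 0 # ms)"
proof -
  let ?w = "\<lambda>i. (inc ^^ i) []" and ?t = "wtape (replicate n True)"
  let ?S = "\<lambda>i. ?t (Suc i) # b # wtape (?w i) 0 # wtape rs 0 # ms"
  let ?p = "mv 2 MoveR ;; mv 3 MoveR ;; carry ;; wr 2 3 Stay ;; back2 2 3 ;; mv 0 MoveR"
  have loop: "runs g (Loop (\<lambda>ss. ss ! 0 \<noteq> 0) ?p) (?S 0) (n * Suc (6 * n + 9) + 1) (?S n)"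
  proof (rule runs_Loop_iterate)
    fix i assume i: "i < n"
    then show "map read_tape (?S i) ! 0 \<noteq> 0" by (simp add: wtape_read)
    let ?xs = "?w i"
    let ?k = "ones ?xs"
    let ?ys = "replicate ?k False @ drop ?k ?xs"
    have len: "length ?xs \<le> n" using bit_length_le[of i] i by (simp add: bit_length_def)
    have 1: "runs g (mv 2 MoveR) (?S i) 1 (?t (Suc i) # b # wtape ?xs 1 # wtape rs 0 # ms)"
      by (intro runs_mv) auto
    have 2: "runs g (mv 3 MoveR) (?t (Suc i) # b # wtape ?xs 1 # wtape rs 0 # ms) 1
        (?t (Suc i) # b # wtape ?xs 1 # wtape rs 1 # ms)"
      by (intro runs_mv) auto
    have 3: "runs g carry (?t (Suc i) # b # wtape ?xs 1 # wtape rs 1 # ms) (3 * n + 1)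
        (?t (Suc i) # b # wtape ?ys (Suc ?k) # wtape rs (Suc ?k) # ms)"
      by (rule runs_weaken[OF runs_carry]) (use len in simp)
    have 4: "runs g (wr 2 3 Stay) (?t (Suc i) # b # wtape ?ys (Suc ?k) # wtape rs (Suc ?k) # ms) 1
        (?t (Suc i) # b # wtape (?w (Suc i)) (Suc ?k) # wtape rs (Suc ?k) # ms)"
      using over_inc[of ?xs] by (intro runs_wr) auto
    have 5: "runs g (back2 2 3) (?t (Suc i) # b # wtape (?w (Suc i)) (Suc ?k) # wtape rs (Suc ?k) # ms)
        (3 * Suc n + 1) (?t (Suc i) # b # wtape (?w (Suc i)) 0 # wtape rs 0 # ms)"
      by (rule runs_conv[OF runs_back2[where h = "Suc ?k"]]) (use ones_le[of ?xs] len in auto)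
    have 6: "runs g (mv 0 MoveR) (?t (Suc i) # b # wtape (?w (Suc i)) 0 # wtape rs 0 # ms) 1 (?S (Suc i))"
      by (intro runs_mv) auto
    show "runs g ?p (?S i) (6 * n + 9) (?S (Suc i))"
      by (rule runs_conv[OF runs_Seq[OF 1 runs_Seq[OF 2 runs_Seq[OF 3 runs_Seq[OF 4 runs_Seq[OF 5 6]]]]]]) auto
  qed (simp add: wtape_read)
  have 0: "runs g (mv 0 MoveR) (?t 0 # b # wtape [] 0 # wtape rs 0 # ms) 1 (?S 0)"
    by (intro runs_mv) auto
  show ?thesis unfolding count_loop_def
    by (rule runs_conv[OF runs_Seq[OF 0 loop]]) auto
qed

text \<open>There is no empty program, so \<open>rep k p\<close> executes \<open>p\<close> exactly
  \<open>k + 1\<close> times.\<close>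

fun rep :: "nat \<Rightarrow> prog \<Rightarrow> prog" where
  "rep 0 p = p"
| "rep (Suc k) p = p ;; rep k p"

lemma runs_rep_write:
  "runs g (rep k (wr 3 (if v then 3 else 2) MoveR)) (a # b # q # wtape ys (Suc (length ys)) # ms) (Suc k)
    (a # b # q # wtape (ys @ replicate (Suc k) v) (Suc (length ys + Suc k)) # ms)"
proof (induction k arbitrary: ys)
  case 0
  have "runs g (wr 3 (if v then 3 else 2) MoveR) (a # b # q # wtape ys (Suc (length ys)) # ms) 1
      (a # b # q # wtape (ys @ [v]) (Suc (length (ys @ [v]))) # ms)"
    using wtape_write[of ys "length ys" "[]" v] by (intro runs_wr) auto
  then show ?case by simp
next
  case (Suc k)
  have "runs g (wr 3 (if v then 3 else 2) MoveR) (a # b # q # wtape ys (Suc (length ys)) # ms) 1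
      (a # b # q # wtape (ys @ [v]) (Suc (length (ys @ [v]))) # ms)"
    using wtape_write[of ys "length ys" "[]" v] by (intro runs_wr) auto
  from runs_Seq[OF this Suc] show ?case by simp
qed

lemma replicate_mult_Suc: "replicate (i * c) v @ replicate c v = replicate (Suc i * c) v"
  by (simp add: add.commute flip: replicate_add)

text \<open>
  The length of the ruler is the number of variables of the queried function; the position where it
  changes from \<open>False\<close> to \<open>True\<close> is the binary logarithm of the acceptance threshold.
\<close>

definition ruler :: "nat \<Rightarrow> nat \<Rightarrow> bool list" where
  "ruler a l = replicate (l * Suc a) False @ replicate (l * Suc (Suc a)) True"

text \<open>The head on tape 2 walks over the counter word forth and back. On the way out each bit
  contributes \<open>a + 1\<close> cells \<open>False\<close> to the ruler, on the way back
  \<open>a + 2\<close> cells \<open>True\<close>.\<close>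

definition make_ruler :: "nat \<Rightarrow> prog" where
  "make_ruler a = mv 2 MoveR ;; mv 3 MoveR ;;
     Loop (\<lambda>ss. ss ! 2 \<noteq> 0) (rep a (wr 3 2 MoveR) ;; mv 2 MoveR) ;; mv 2 MoveL ;;
     Loop (\<lambda>ss. ss ! 2 \<noteq> 1) (rep (Suc a) (wr 3 3 MoveR) ;; mv 2 MoveL) ;; mv 3 MoveL ;; back1 3"

lemma runs_make_ruler:
  assumes "length xs = l"
  shows "runs g (make_ruler a) (x # b # wtape xs 0 # wtape [] 0 # ms) (l * (6 * a + 13) + 7)
    (x # b # wtape xs 0 # wtape (ruler a l) 0 # ms)"
proof -
  let ?S = "\<lambda>i. x # b # wtape xs (Suc i) # wtape (replicate (i * Suc a) False) (Suc (i * Suc a)) # ms"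
  let ?R = "\<lambda>i. replicate (l * Suc a) False @ replicate (i * Suc (Suc a)) True"
  let ?T = "\<lambda>i. x # b # wtape xs (l - i) # wtape (?R i) (Suc (length (?R i))) # ms"
  have 1: "runs g (mv 2 MoveR) (x # b # wtape xs 0 # wtape [] 0 # ms) 1 (x # b # wtape xs 1 # wtape [] 0 # ms)"
    by (intro runs_mv) auto
  have 2: "runs g (mv 3 MoveR) (x # b # wtape xs 1 # wtape [] 0 # ms) 1 (?S 0)"
    by (intro runs_mv) auto
  have 3: "runs g (Loop (\<lambda>ss. ss ! 2 \<noteq> 0) (rep a (wr 3 2 MoveR) ;; mv 2 MoveR)) (?S 0)
      (l * Suc (Suc a + 1) + 1) (?S l)"
  proof (rule runs_Loop_iterate)
    fix i assume i: "i < l"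
    show "map read_tape (?S i) ! 2 \<noteq> 0" using i assms by (simp add: wtape_read)
    show "runs g (rep a (wr 3 2 MoveR) ;; mv 2 MoveR) (?S i) (Suc a + 1) (?S (Suc i))"
    proof (rule runs_Seq)
      show "runs g (rep a (wr 3 2 MoveR)) (?S i) (Suc a)
          (x # b # wtape xs (Suc i) # wtape (replicate (Suc i * Suc a) False) (Suc (Suc i * Suc a)) # ms)"
        by (rule runs_conv[OF runs_rep_write[of g a False x b _ "replicate (i * Suc a) False", unfolded if_False]])
          (simp_all add: replicate_mult_Suc add.commute del: replicate_Suc mult_Suc_right)
      show "runs g (mv 2 MoveR)
          (x # b # wtape xs (Suc i) # wtape (replicate (Suc i * Suc a) False) (Suc (Suc i * Suc a)) # ms) 1 (?S (Suc i))"
        by (intro runs_mv) auto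
    qed
  qed (use assms in \<open>simp add: wtape_read\<close>)
  have 4: "runs g (mv 2 MoveL) (?S l) 1 (?T 0)"
    by (intro runs_mv) auto
  have 5: "runs g (Loop (\<lambda>ss. ss ! 2 \<noteq> 1) (rep (Suc a) (wr 3 3 MoveR) ;; mv 2 MoveL)) (?T 0)
      (l * Suc (Suc (Suc a) + 1) + 1) (?T l)"
  proof (rule runs_Loop_iterate)
    fix i assume i: "i < l"
    show "map read_tape (?T i) ! 2 \<noteq> 1" using i assms by (simp add: wtape_marker)
    show "runs g (rep (Suc a) (wr 3 3 MoveR) ;; mv 2 MoveL) (?T i) (Suc (Suc a) + 1) (?T (Suc i))"
    proof (rule runs_Seq)
      show "runs g (rep (Suc a) (wr 3 3 MoveR)) (?T i) (Suc (Suc a))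
          (x # b # wtape xs (l - i) # wtape (?R (Suc i)) (Suc (length (?R (Suc i)))) # ms)"
        by (rule runs_conv[OF runs_rep_write[of g "Suc a" True x b _ "?R i", unfolded if_True]])
          (simp_all add: replicate_mult_Suc add.commute del: replicate_Suc mult_Suc_right)
      show "runs g (mv 2 MoveL)
          (x # b # wtape xs (l - i) # wtape (?R (Suc i)) (Suc (length (?R (Suc i)))) # ms) 1 (?T (Suc i))"
        by (intro runs_mv) auto
    qed
  qed (simp add: wtape_marker)
  have 6: "runs g (mv 3 MoveL) (?T l) 1 (x # b # wtape xs 0 # wtape (?R l) (length (?R l)) # ms)"
    by (intro runs_mv) auto
  have 7: "runs g (back1 3) (x # b # wtape xs 0 # wtape (?R l) (length (?R l)) # ms) (2 * length (?R l) + 1)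
      (x # b # wtape xs 0 # wtape (?R l) 0 # ms)"
    by (rule runs_conv[OF runs_back1[where h = "length (?R l)"]]) auto
  show ?thesis unfolding make_ruler_def
    by (rule runs_conv[OF runs_Seq[OF 1 runs_Seq[OF 2 runs_Seq[OF 3 runs_Seq[OF 4 runs_Seq[OF 5 runs_Seq[OF 6 7]]]]]]])
      (auto simp: ruler_def algebra_simps)
qed

definition zero_query :: prog where
  "zero_query = mv 0 MoveL ;; mv 2 MoveR ;;
     Loop (\<lambda>ss. ss ! 0 \<noteq> 1) (wr 2 2 MoveR ;; mv 0 MoveL) ;; mv 2 MoveL ;; back1 2"

text \<open>The input tape, read backwards, measures out \<open>n\<close> zeros. They overwrite the
  old counter completely because it has at most \<open>n\<close> bits.\<close>

lemma runs_zero_query: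
  assumes "length xs \<le> n"
  shows "runs g zero_query (wtape ys (Suc n) # b # wtape xs 0 # r # ms) (5 * n + 5)
    (wtape ys 0 # b # wtape (replicate n False) 0 # r # ms)"
proof -
  let ?w = "\<lambda>i. replicate i False @ drop i xs"
  let ?S = "\<lambda>i. wtape ys (n - i) # b # wtape (?w i) (Suc i) # r # ms"
  have 1: "runs g (mv 0 MoveL) (wtape ys (Suc n) # b # wtape xs 0 # r # ms) 1 (wtape ys n # b # wtape xs 0 # r # ms)"
    by (intro runs_mv) auto
  have 2: "runs g (mv 2 MoveR) (wtape ys n # b # wtape xs 0 # r # ms) 1 (?S 0)"
    by (intro runs_mv) auto
  have 3: "runs g (Loop (\<lambda>ss. ss ! 0 \<noteq> 1) (wr 2 2 MoveR ;; mv 0 MoveL)) (?S 0) (n * Suc (1 + 1) + 1) (?S n)"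
  proof (rule runs_Loop_iterate)
    fix i assume i: "i < n"
    show "map read_tape (?S i) ! 0 \<noteq> 1" using i by (simp add: wtape_marker)
    show "runs g (wr 2 2 MoveR ;; mv 0 MoveL) (?S i) (1 + 1) (?S (Suc i))"
    proof (rule runs_Seq)
      show "runs g (wr 2 2 MoveR) (?S i) 1 (wtape ys (n - i) # b # wtape (?w (Suc i)) (Suc (Suc i)) # r # ms)"
        using wtape_write[of "replicate i False" i xs False]
        by (intro runs_wr) (auto simp: replicate_append_same)
      show "runs g (mv 0 MoveL) (wtape ys (n - i) # b # wtape (?w (Suc i)) (Suc (Suc i)) # r # ms) 1 (?S (Suc i))"
        by (intro runs_mv) auto
    qed
  qed (simp add: wtape_marker)
  have 4: "runs g (mv 2 MoveL) (?S n) 1 (wtape ys 0 # b # wtape (replicate n False) n # r # ms)"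
    using assms by (intro runs_mv) auto
  have 5: "runs g (back1 2) (wtape ys 0 # b # wtape (replicate n False) n # r # ms) (2 * n + 1)
      (wtape ys 0 # b # wtape (replicate n False) 0 # r # ms)"
    by (rule runs_conv[OF runs_back1[where h = n]]) auto
  show ?thesis unfolding zero_query_def
    by (rule runs_conv[OF runs_Seq[OF 1 runs_Seq[OF 2 runs_Seq[OF 3 runs_Seq[OF 4 5]]]]]) auto
qed

text \<open>
  The two heads move in parallel, so a carry that runs off the ruler signals that the counter has
  overflowed; the head on tape 3 is then left on a blank, which ends the loop.
\<close>

definition query_step :: prog where
  "query_step = Ask (wr 4 3 MoveR) (wr 4 2 MoveR) ;; mv 2 MoveR ;; mv 3 MoveR ;; carry ;;
     Cond (\<lambda>ss. ss ! 3 \<noteq> 0) (wr 2 3 Stay ;; back2 2 3) (mv 0 Stay)"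

definition query_loop :: prog where
  "query_loop = mv 4 MoveR ;; Loop (\<lambda>ss. ss ! 3 \<noteq> 0) query_step ;; back1 3 ;; back1 4"

text \<open>The part common to an ordinary round and the last one: ask, record the answer, propagate
  the carry. The two differ only in the branch that follows.\<close>

lemma runs_query_step_prefix:
  assumes "length xs \<le> N"
  shows "runs g (Cond c p q) (x # b # wtape (replicate (ones xs) False @ drop (ones xs) xs) (Suc (ones xs)) #
      wtape rs (Suc (ones xs)) # wtape (ys @ [g xs]) (Suc (Suc (length ys))) # ms) B ts \<Longrightarrow>
    runs g (Ask (wr 4 3 MoveR) (wr 4 2 MoveR) ;; mv 2 MoveR ;; mv 3 MoveR ;; carry ;; Cond c p q)
      (x # b # wtape xs 0 # wtape rs 0 # wtape ys (Suc (length ys)) # ms) (3 * N + 5 + B) ts"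
proof -
  let ?m = "wtape (ys @ [g xs]) (Suc (Suc (length ys)))"
  assume 5: "runs g (Cond c p q) (x # b # wtape (replicate (ones xs) False @ drop (ones xs) xs) (Suc (ones xs)) #
      wtape rs (Suc (ones xs)) # ?m # ms) B ts"
  have if_wr: "(if g xs then wr 4 3 MoveR else wr 4 2 MoveR) = wr 4 (if g xs then 3 else 2) MoveR" by simp
  have "runs g (if g xs then wr 4 3 MoveR else wr 4 2 MoveR)
      (x # b # wtape xs 0 # wtape rs 0 # wtape ys (Suc (length ys)) # ms) 1
      (x # b # wtape xs 0 # wtape rs 0 # ?m # ms)"
    unfolding if_wr using wtape_write[of ys "length ys" "[]" "g xs"] by (intro runs_wr) auto
  then have 1: "runs g (Ask (wr 4 3 MoveR) (wr 4 2 MoveR))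
      (x # b # wtape xs 0 # wtape rs 0 # wtape ys (Suc (length ys)) # ms) (Suc 1)
      (x # b # wtape xs 0 # wtape rs 0 # ?m # ms)"
    by (intro runs_Ask) simp
  have 2: "runs g (mv 2 MoveR) (x # b # wtape xs 0 # wtape rs 0 # ?m # ms) 1
      (x # b # wtape xs 1 # wtape rs 0 # ?m # ms)"
    by (intro runs_mv) auto
  have 3: "runs g (mv 3 MoveR) (x # b # wtape xs 1 # wtape rs 0 # ?m # ms) 1
      (x # b # wtape xs 1 # wtape rs 1 # ?m # ms)"
    by (intro runs_mv) auto
  show ?thesis
    by (rule runs_conv[OF runs_Seq[OF 1 runs_Seq[OF 2 runs_Seq[OF 3 runs_Seq[OF runs_carry 5]]]]])
      (use assms in auto)
qed

lemma runs_query_step: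
  assumes "length xs \<le> N" "ones xs < length rs"
  shows "runs g query_step (x # b # wtape xs 0 # wtape rs 0 # wtape ys (Suc (length ys)) # ms) (6 * N + 11)
    (x # b # wtape (inc xs) 0 # wtape rs 0 # wtape (ys @ [g xs]) (Suc (Suc (length ys))) # ms)"
proof -
  let ?m = "wtape (ys @ [g xs]) (Suc (Suc (length ys)))" and ?k = "ones xs"
  have 1: "runs g (wr 2 3 Stay) (x # b # wtape (replicate ?k False @ drop ?k xs) (Suc ?k) #
      wtape rs (Suc ?k) # ?m # ms) 1 (x # b # wtape (inc xs) (Suc ?k) # wtape rs (Suc ?k) # ?m # ms)"
    using over_inc[of xs] by (intro runs_wr) auto
  have 2: "runs g (back2 2 3) (x # b # wtape (inc xs) (Suc ?k) # wtape rs (Suc ?k) # ?m # ms) (3 * N + 4)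
      (x # b # wtape (inc xs) 0 # wtape rs 0 # ?m # ms)"
    by (rule runs_conv[OF runs_back2[where h = "Suc ?k"]]) (use ones_le[of xs] assms in auto)
  have "runs g (Cond (\<lambda>ss. ss ! 3 \<noteq> 0) (wr 2 3 Stay ;; back2 2 3) (mv 0 Stay))
      (x # b # wtape (replicate ?k False @ drop ?k xs) (Suc ?k) # wtape rs (Suc ?k) # ?m # ms)
      (Suc (1 + (3 * N + 4))) (x # b # wtape (inc xs) 0 # wtape rs 0 # ?m # ms)"
    using runs_Seq[OF 1 2] assms(2) by (intro runs_Cond) (simp add: wtape_read)
  from runs_query_step_prefix[OF assms(1) this] show ?thesis
    unfolding query_step_def by (rule runs_weaken) simp
qed

lemma runs_query_step_last:
  assumes "length xs \<le> N" "length rs \<le> ones xs"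
  shows "runs g query_step (x # b # wtape xs 0 # wtape rs 0 # wtape ys (Suc (length ys)) # ms) (6 * N + 11)
    (x # b # wtape (replicate (ones xs) False @ drop (ones xs) xs) (Suc (ones xs)) #
      wtape rs (Suc (ones xs)) # wtape (ys @ [g xs]) (Suc (Suc (length ys))) # ms)"
proof -
  let ?m = "wtape (ys @ [g xs]) (Suc (Suc (length ys)))" and ?k = "ones xs"
  let ?s = "x # b # wtape (replicate ?k False @ drop ?k xs) (Suc ?k) # wtape rs (Suc ?k) # ?m # ms"
  have "runs g (mv 0 Stay) ?s 1 ?s" by (intro runs_mv) auto
  then have "runs g (Cond (\<lambda>ss. ss ! 3 \<noteq> 0) (wr 2 3 Stay ;; back2 2 3) (mv 0 Stay)) ?s (Suc 1) ?s"
    using assms(2) by (intro runs_Cond) (simp add: wtape_read)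
  from runs_query_step_prefix[OF assms(1) this] show ?thesis
    unfolding query_step_def by (rule runs_weaken) simp
qed

text \<open>The ruler decides when to stop: the first carry of length at least \<open>m\<close>
  occurs at the value \<open>2 ^ m - 1\<close>, that is, after exactly \<open>2 ^ m\<close> queries.
  What then remains on the query tape is left unspecified.\<close>

lemma runs_query_loop:
  assumes "length rs = m"
  shows "\<exists>q. runs g query_loop (x # b # wtape (replicate n False) 0 # wtape rs 0 # wtape [] 0 # ms)
    (2 ^ m * (6 * (n + m) + 14) + 2 * (n + m) + 9)
    (x # b # q # wtape rs 0 # wtape (truth_table m (sub_fun n m g)) 0 # ms)"
proof -
  define w where "w i = (inc ^^ i) (replicate n False)" for i
  define ans where "ans i = map (\<lambda>i. g (w i)) [0..<i]" for i
  define k where "k = ones (w (2 ^ m - 1))"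
  define q where "q = wtape (replicate k False @ drop k (w (2 ^ m - 1))) (Suc k)"
  \<comment> \<open>The last round breaks off in the middle of an increment with both heads
    displaced, so the state after it needs a description of its own.\<close>
  let ?S = "\<lambda>i. if i < 2 ^ m then x # b # wtape (w i) 0 # wtape rs 0 # wtape (ans i) (Suc i) # ms
    else x # b # q # wtape rs (Suc k) # wtape (ans (2 ^ m)) (Suc (2 ^ m)) # ms"
  have val_w: "val (w i) = i" for i by (simp add: w_def val_inc_iterate)
  have len: "length (w i) \<le> n + m" if "i < 2 ^ m" for i
    using length_inc_iterate_le[of "replicate n False" i m] that by (auto simp: w_def)
  have ans: "ans (Suc i) = ans i @ [g (w i)]" "length (ans i) = i" for i
    by (simp_all add: ans_def)
  have pos: "(0::nat) < 2 ^ m" by simp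
  have mk: "m \<le> k" using ones_less_iff[of "w (2 ^ m - 1)" m] by (simp add: k_def val_w)
  have kn: "k \<le> n + m" using ones_le[of "w (2 ^ m - 1)"] len[of "2 ^ m - 1"] by (simp add: k_def)
  have 1: "runs g (mv 4 MoveR) (x # b # wtape (replicate n False) 0 # wtape rs 0 # wtape [] 0 # ms) 1 (?S 0)"
    by (intro runs_mv) (auto simp: w_def ans_def)
  have 2: "runs g (Loop (\<lambda>ss. ss ! 3 \<noteq> 0) query_step) (?S 0) (2 ^ m * Suc (6 * (n + m) + 11) + 1) (?S (2 ^ m))"
  proof (rule runs_Loop_iterate)
    fix i :: nat assume i: "i < 2 ^ m"
    then show "map read_tape (?S i) ! 3 \<noteq> 0" by (simp add: wtape_read)
    show "runs g query_step (?S i) (6 * (n + m) + 11) (?S (Suc i))"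
    proof (cases "Suc i < 2 ^ m")
      case True
      then have "ones (w i) < length rs" using ones_less_iff[of "w i" m] i assms by (simp add: val_w)
      from runs_query_step[OF len[OF i] this, of g x b "ans i" ms] show ?thesis
        using i True ans by (simp add: w_def)
    next
      case False
      then have "i = 2 ^ m - 1" using i by simp
      then have wk: "k = ones (w i)" "q = wtape (replicate k False @ drop k (w i)) (Suc k)" "2 ^ m = Suc i"
        by (simp_all add: k_def q_def)
      have "length rs \<le> ones (w i)" using mk wk assms by simp
      from runs_query_step_last[OF len[OF i] this, of g x b "ans i" ms] show ?thesis
        using wk ans by simp
    qed
  next
    show "\<not> map read_tape (?S (2 ^ m)) ! 3 \<noteq> 0" using mk assms by (simp add: wtape_read)
  qed
  have 3: "runs g (back1 3) (?S (2 ^ m)) (2 * (n + m + 1) + 1)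
      (x # b # q # wtape rs 0 # wtape (ans (2 ^ m)) (Suc (2 ^ m)) # ms)"
    by (rule runs_conv[OF runs_back1[where h = "Suc k"]]) (use kn in auto)
  have 4: "runs g (back1 4) (x # b # q # wtape rs 0 # wtape (ans (2 ^ m)) (Suc (2 ^ m)) # ms) (2 * Suc (2 ^ m) + 1)
      (x # b # q # wtape rs 0 # wtape (ans (2 ^ m)) 0 # ms)"
    by (rule runs_conv[OF runs_back1[where h = "Suc (2 ^ m)"]]) auto
  have "ans (2 ^ m) = truth_table m (sub_fun n m g)"
    by (simp add: ans_def w_def truth_table_sub_fun)
  with 4 have 4: "runs g (back1 4) (x # b # q # wtape rs 0 # wtape (ans (2 ^ m)) (Suc (2 ^ m)) # ms) (2 * Suc (2 ^ m) + 1)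
      (x # b # q # wtape rs 0 # wtape (truth_table m (sub_fun n m g)) 0 # ms)" by simp
  show ?thesis unfolding query_loop_def
    by (rule exI, rule runs_conv[OF runs_Seq[OF 1 runs_Seq[OF 2 runs_Seq[OF 3 4]]]]) (auto simp: algebra_simps)
qed


text \<open>Some cell without a bit must be known for the \<open>LEAST\<close> in
  \<open>tape_word\<close> to be meaningful.\<close>

lemma tape_word_cells:
  assumes "fst tp (Suc N) \<notin> {2, 3}"
  shows "length (tape_word tp) \<le> N"
    and "i < length (tape_word tp) \<Longrightarrow> fst tp (Suc i) \<in> {2, 3}"
    and "i < length (tape_word tp) \<Longrightarrow> tape_word tp ! i \<longleftrightarrow> fst tp (Suc i) = 3"
    and "fst tp (Suc (length (tape_word tp))) \<notin> {2, 3}"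
proof -
  let ?P = "\<lambda>j. 1 \<le> j \<and> fst tp j \<notin> {2, 3}"
  let ?l = "LEAST j. ?P j"
  have N: "?P (Suc N)" using assms by simp
  have l: "?P ?l" "?l \<le> Suc N" using N LeastI[of ?P] Least_le[of ?P] by blast+
  have len: "length (tape_word tp) = ?l - 1" by (simp add: tape_word_def)
  show "length (tape_word tp) \<le> N" using l len by simp
  show "fst tp (Suc (length (tape_word tp))) \<notin> {2, 3}" using l(1) unfolding len by simp
  assume i: "i < length (tape_word tp)"
  then have "Suc i < ?l" using len by simp
  then have "\<not> ?P (Suc i)" by (rule not_less_Least)
  then show "fst tp (Suc i) \<in> {2, 3}" by simp
  show "tape_word tp ! i \<longleftrightarrow> fst tp (Suc i) = 3"
    using i len unfolding tape_word_def by simp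
qed

text \<open>The output is laid against the ruler. A bit 1 counts if the ruler cell beside it is not
  \<open>False\<close> (symbol 2): that includes the blanks behind the ruler, should the output be
  longer. Rewinding relies on tape 3, as \<open>M\<close> may have erased the marker of tape
  5.\<close>

definition check_output :: prog where
  "check_output = back2 3 5 ;; mv 3 MoveR ;; mv 5 MoveR ;; mv 1 MoveR ;;
     Loop (\<lambda>ss. ss ! 5 \<in> {2, 3})
       (Cond (\<lambda>ss. ss ! 5 = 3 \<and> ss ! 3 \<noteq> 2) (wr 1 3 Stay) (mv 1 Stay) ;; mv 3 MoveR ;; mv 5 MoveR)"

lemma runs_check_output:
  assumes y: "tape_word (c, h) = y" and N: "c (Suc N) \<notin> {2, 3}" "h \<le> N"
  shows "\<exists>r o'. runs g check_output
      (x # wtape [] 0 # q # wtape (replicate t False @ replicate s True) h # u # (c, h) # ms) (8 * N + 5)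
      (x # wtape (if \<exists>j < length y. t \<le> j \<and> y ! j then [True] else []) 1 # q # r # u # o' # ms)"
proof -
  let ?rs = "replicate t False @ replicate s True"
  define z where "z i = wtape (if \<exists>j < i. t \<le> j \<and> y ! j then [True] else []) 1" for i
  let ?S = "\<lambda>i. x # z i # q # wtape ?rs (Suc i) # u # (c, Suc i) # ms"
  note cells = tape_word_cells[of "(c, h)" N, unfolded fst_conv y, OF N(1)]
  have 1: "runs g (back2 3 5) (x # wtape [] 0 # q # wtape ?rs h # u # (c, h) # ms) (3 * N + 1)
      (x # wtape [] 0 # q # wtape ?rs 0 # u # (c, 0) # ms)"
    by (rule runs_conv[OF runs_back2[where h = h]]) (use N in auto)
  have 2: "runs g (mv 3 MoveR) (x # wtape [] 0 # q # wtape ?rs 0 # u # (c, 0) # ms) 1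
      (x # wtape [] 0 # q # wtape ?rs 1 # u # (c, 0) # ms)"
    by (intro runs_mv) auto
  have 3: "runs g (mv 5 MoveR) (x # wtape [] 0 # q # wtape ?rs 1 # u # (c, 0) # ms) 1
      (x # wtape [] 0 # q # wtape ?rs 1 # u # (c, 1) # ms)"
    by (intro runs_mv) auto
  have 4: "runs g (mv 1 MoveR) (x # wtape [] 0 # q # wtape ?rs 1 # u # (c, 1) # ms) 1 (?S 0)"
    by (intro runs_mv) (auto simp: z_def)
  let ?p = "Cond (\<lambda>ss. ss ! 5 = 3 \<and> ss ! 3 \<noteq> 2) (wr 1 3 Stay) (mv 1 Stay) ;; mv 3 MoveR ;; mv 5 MoveR"
  have 5: "runs g (Loop (\<lambda>ss. ss ! 5 \<in> {2, 3}) ?p) (?S 0) (length y * Suc (Suc 1 + (1 + 1)) + 1) (?S (length y))"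
  proof (rule runs_Loop_iterate)
    fix i assume i: "i < length y"
    then show "map read_tape (?S i) ! 5 \<in> {2, 3}" using cells(2) by simp
    let ?T = "x # z (Suc i) # q # wtape ?rs (Suc i) # u # (c, Suc i) # ms"
    have r: "fst (init_tape ?rs) (Suc i) \<noteq> 2 \<longleftrightarrow> t \<le> i"
      by (auto simp: wtape_read nth_append)
    have ex: "(\<exists>j < Suc i. t \<le> j \<and> y ! j) \<longleftrightarrow> (\<exists>j < i. t \<le> j \<and> y ! j) \<or> t \<le> i \<and> y ! i"
      by (auto simp: less_Suc_eq)
    have w: "(fst (init_tape (if b then [True] else [])))(Suc 0 := 3) = fst (init_tape [True])" for b
      by (auto simp: init_tape_def fun_eq_iff)
    have "runs g (if y ! i \<and> t \<le> i then wr 1 3 Stay else mv 1 Stay) (?S i) 1 ?T"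
    proof (cases "y ! i \<and> t \<le> i")
      case True
      have "runs g (wr 1 3 Stay) (?S i) 1 ?T"
        using w True ex by (intro runs_wr) (auto simp: z_def)
      then show ?thesis using True by simp
    next
      case False
      have "runs g (mv 1 Stay) (?S i) 1 ?T"
        using False ex by (intro runs_mv) (auto simp: z_def)
      then show ?thesis using False by (simp only: if_False)
    qed
    then have a: "runs g (Cond (\<lambda>ss. ss ! 5 = 3 \<and> ss ! 3 \<noteq> 2) (wr 1 3 Stay) (mv 1 Stay)) (?S i) (Suc 1) ?T"
      using cells(3)[OF i] r by (intro runs_Cond) simp
    have b: "runs g (mv 3 MoveR) ?T 1 (x # z (Suc i) # q # wtape ?rs (Suc (Suc i)) # u # (c, Suc i) # ms)"
      by (intro runs_mv) auto
    have c: "runs g (mv 5 MoveR) (x # z (Suc i) # q # wtape ?rs (Suc (Suc i)) # u # (c, Suc i) # ms) 1 (?S (Suc i))"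
      by (intro runs_mv) auto
    show "runs g ?p (?S i) (Suc 1 + (1 + 1)) (?S (Suc i))"
      by (rule runs_Seq[OF a runs_Seq[OF b c]])
  next
    show "map read_tape (?S (length y)) ! 5 \<notin> {2, 3}" using cells(4) by simp
  qed
  have len: "length y \<le> N" by (rule cells(1))
  show ?thesis unfolding check_output_def
    by (intro exI, rule runs_conv[OF runs_Seq[OF 1 runs_Seq[OF 2 runs_Seq[OF 3 runs_Seq[OF 4 5]]]]])
      (use len in \<open>auto simp: z_def\<close>)
qed

section \<open>The assembled machine and its running time\<close>

definition distinguisher :: "nat \<Rightarrow> tm \<Rightarrow> prog" where
  "distinguisher a M =
     count_loop ;; make_ruler a ;; zero_query ;; query_loop ;; RunTM M ;; check_output"

definition ruler_length :: "nat \<Rightarrow> nat \<Rightarrow> nat" where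
  "ruler_length a n = bit_length n * (2 * a + 3)"

definition dist_time :: "nat \<Rightarrow> (nat \<Rightarrow> nat) \<Rightarrow> nat \<Rightarrow> nat" where
  "dist_time a T n = (n * (6 * n + 10) + 2) + (n * (6 * a + 13) + 7) + (5 * n + 5)
     + (2 ^ ruler_length a n * (6 * (n + ruler_length a n) + 14) + 2 * (n + ruler_length a n) + 9)
     + (9 * T (ruler_length a n) + 20)"

lemma runs_distinguisher:
  assumes M: "wf_tm M" and m: "m = ruler_length a n"
    and out: "outputs_within M (truth_table m (sub_fun n m g)) (T m) y"
  shows "\<exists>ts. runs g (distinguisher a M)
      (init_tape (replicate n True) # replicate (tm_tapes M + 3) (init_tape [])) (dist_time a T n) ts \<and>
    tape_word (ts ! 1) = (if 2 ^ (bit_length n * Suc a) \<le> val y then [True] else [])"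
proof -
  let ?l = "bit_length n"
  let ?tt = "truth_table m (sub_fun n m g)" and ?e = "wtape [] 0" and ?rs = "ruler a ?l"
  have "2 \<le> tm_tapes M" using M by (simp add: wf_tm_def)
  then obtain k where k: "tm_tapes M = Suc (Suc k)" by (metis add_2_eq_Suc le_Suc_ex)
  let ?es = "replicate k ?e"
  let ?x = "wtape (replicate n True)"
  have init: "init_tape (replicate n True) # replicate (tm_tapes M + 3) (init_tape []) =
      ?x 0 # ?e # ?e # ?e # ?e # ?e # ?es"
    using k by (simp add: wtape_0 numeral_eq_Suc)
  have 1: "runs g count_loop (?x 0 # ?e # ?e # ?e # ?e # ?e # ?es) (n * (6 * n + 10) + 2)
      (?x (Suc n) # ?e # wtape ((inc ^^ n) []) 0 # ?e # ?e # ?e # ?es)"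
    by (rule runs_count_loop)
  have 2: "runs g (make_ruler a) (?x (Suc n) # ?e # wtape ((inc ^^ n) []) 0 # ?e # ?e # ?e # ?es) (n * (6 * a + 13) + 7)
      (?x (Suc n) # ?e # wtape ((inc ^^ n) []) 0 # wtape ?rs 0 # ?e # ?e # ?es)"
    by (rule runs_weaken[OF runs_make_ruler[of _ ?l]]) (simp_all add: bit_length_def bit_length_le[unfolded bit_length_def])
  have 3: "runs g zero_query (?x (Suc n) # ?e # wtape ((inc ^^ n) []) 0 # wtape ?rs 0 # ?e # ?e # ?es) (5 * n + 5)
      (?x 0 # ?e # wtape (replicate n False) 0 # wtape ?rs 0 # ?e # ?e # ?es)"
    by (rule runs_zero_query) (simp add: bit_length_le[unfolded bit_length_def])
  have rs: "length ?rs = m" by (simp add: ruler_def m ruler_length_def algebra_simps)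
  obtain q where 4: "runs g query_loop (?x 0 # ?e # wtape (replicate n False) 0 # wtape ?rs 0 # ?e # ?e # ?es)
      (2 ^ m * (6 * (n + m) + 14) + 2 * (n + m) + 9) (?x 0 # ?e # q # wtape ?rs 0 # wtape ?tt 0 # ?e # ?es)"
    using runs_query_loop[OF rs, of g "?x 0" ?e n "?e # ?es"] by blast
  let ?c0 = "init_config M ?tt"
  have c0: "?c0 = (tm_start M, wtape ?tt 0 # ?e # ?es)"
    using k by (simp add: init_config_def wtape_0)
  define us where "us = snd ((tm_step M ^^ T m) ?c0)"
  have halt: "(tm_step M ^^ T m) ?c0 = (tm_halt M, us)" and word: "tape_word (us ! 1) = y"
    using out by (auto simp: outputs_within_def Let_def halted_def out_word_def us_def prod_eq_iff)
  have "length us = tm_tapes M"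
    using wf_config_steps[OF M wf_config_init[OF M], of "T m" ?tt] halt by (simp add: wf_config_def)
  then obtain u0 c h us' where us: "us = u0 # (c, h) # us'"
    using k by (metis length_Suc_conv surj_pair)
  \<comment> \<open>The output tape was empty at the start, so cell \<open>T m + 1\<close> is still
    blank and ends the output word.\<close>
  have "snd (us ! 1) \<le> T m \<and> (\<forall>j > T m. fst (us ! 1) j = fst (snd ?c0 ! 1) j)"
    using tm_steps_head_le[OF M wf_config_init[OF M], of ?tt 1 "T m"] halt k
    by (auto simp: init_config_def init_tape_def)
  then have h: "h \<le> T m" "c (Suc (T m)) \<notin> {2, 3}"
    using us c0 by (auto simp: wtape_read)
  have 5: "runs g (RunTM M) (?x 0 # ?e # q # wtape ?rs 0 # wtape ?tt 0 # ?e # ?es) (T m + 2)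
      (?x 0 # ?e # q # wtape ?rs h # u0 # (c, h) # us')"
  proof (rule runs_conv[OF runs_RunTM[where t = "T m" and us = us and M = M]])
    show "(tm_step M ^^ T m) (tm_start M, drop 4 (?x 0 # ?e # q # wtape ?rs 0 # wtape ?tt 0 # ?e # ?es)) = (tm_halt M, us)"
      using halt c0 by simp
    show "wf_config M (tm_start M, drop 4 (?x 0 # ?e # q # wtape ?rs 0 # wtape ?tt 0 # ?e # ?es))"
      using wf_config_init[OF M, of ?tt] c0 by simp
  qed (use M us in auto)
  have y: "tape_word (c, h) = y" using word us by simp
  obtain r o' where 6: "runs g check_output (?x 0 # ?e # q # wtape ?rs h # u0 # (c, h) # us') (8 * T m + 5)
      (?x 0 # wtape (if \<exists>j < length y. ?l * Suc a \<le> j \<and> y ! j then [True] else []) 1 # q # r # u0 # o' # us')"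
    using runs_check_output[OF y h(2,1), of g "?x 0" q "?l * Suc a" "?l * Suc (Suc a)" u0 us']
    unfolding ruler_def by blast
  let ?ts = "?x 0 # wtape (if \<exists>j < length y. ?l * Suc a \<le> j \<and> y ! j then [True] else []) 1 # q # r # u0 # o' # us'"
  have "runs g (distinguisher a M) (?x 0 # ?e # ?e # ?e # ?e # ?e # ?es) (dist_time a T n) ?ts"
    unfolding distinguisher_def
    by (rule runs_conv[OF runs_Seq[OF 1 runs_Seq[OF 2 runs_Seq[OF 3 runs_Seq[OF 4 runs_Seq[OF 5 6]]]]]])
      (simp_all add: dist_time_def m)
  moreover have "tape_word (?ts ! 1) = (if 2 ^ (?l * Suc a) \<le> val y then [True] else [])"
    by (auto simp: val_ge_iff simp del: mult_Suc_right)
  ultimately show ?thesis unfolding init by blast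
qed

lemma wf_prog_rep: "wf_prog k s (rep c p) = wf_prog k s p"
  by (induction c) auto

lemma asks_rep_Act: "asks (rep c (Act i w d)) b = {}"
  by (induction c arbitrary: b) auto

lemmas distinguisher_defs = distinguisher_def count_loop_def make_ruler_def zero_query_def
  query_loop_def query_step_def check_output_def carry_def back1_def back2_def

lemma wf_distinguisher:
  assumes "wf_tm M"
  shows "wf_prog (tm_tapes M + 4) (tm_symbols M) (distinguisher a M)"
proof -
  have "2 \<le> tm_tapes M" "4 \<le> tm_symbols M" using assms by (auto simp: wf_tm_def)
  then show ?thesis using assms by (simp add: distinguisher_defs wf_prog_rep)
qed

text \<open>The single oracle call sits inside a loop; this is what permits one query state. Its
  addresses are never computed explicitly, \<open>dist_potm\<close> just selects them.\<close>

lemma asks_distinguisher: "\<exists>x. asks (distinguisher a M) 0 = {x}"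
  by (simp add: distinguisher_defs asks_rep_Act)

definition dist_potm :: "nat \<Rightarrow> tm \<Rightarrow> potm" where
  "dist_potm a M = prog_potm (tm_tapes M + 4) (tm_symbols M) (distinguisher a M)
     (SOME x. asks (distinguisher a M) 0 = {x})"

text \<open>With equal transition functions, only the number of coin tosses matters.\<close>

lemma potm_run_prog_potm:
  "potm_run (prog_potm k s p x) g n r =
    (potm_step (prog_potm k s p x) g True ^^ length r) (init_config (prog_potm k s p x) (replicate n True))"
proof -
  have coin: "potm_step (prog_potm k s p x) g False = potm_step (prog_potm k s p x) g True"
    by (simp add: potm_step_def prog_potm_def fun_eq_iff)
  have "fold (potm_step (prog_potm k s p x) g) r c = (potm_step (prog_potm k s p x) g True ^^ length r) c" for c
  proof (induction r arbitrary: c)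
    case (Cons b r)
    then show ?case by (cases b) (simp_all add: coin funpow_swap1)
  qed simp
  then show ?thesis by (simp add: potm_run_def)
qed

text \<open>Halting is demanded for all \<open>n\<close> and all oracles. It holds because
  \<open>sub_fun n m g\<close> belongs to \<open>boolfuns m\<close> for arbitrary \<open>g\<close>,
  so the guarantee for \<open>M\<close> applies even when the ruler is longer than
  \<open>n\<close>.\<close>

theorem dist_potm_correct:
  assumes M: "wf_tm M" and out: "\<And>m f. f \<in> boolfuns m \<Longrightarrow> outputs_within M (truth_table m f) (T m) (y m f)"
  shows "wf_potm (dist_potm a M)" and "potm_time (dist_potm a M) (dist_time a T)"
    and "length r = dist_time a T n \<Longrightarrow> m = ruler_length a n \<Longrightarrow>
      potm_accepts (dist_potm a M) g n r \<longleftrightarrow> 2 ^ (bit_length n * Suc a) \<le> val (y m (sub_fun n m g))"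
proof -
  let ?p = "distinguisher a M"
  have x: "asks ?p 0 = {SOME x. asks ?p 0 = {x}}"
    using asks_distinguisher by (rule someI_ex)
  have ks: "3 \<le> tm_tapes M + 4" "4 \<le> tm_symbols M" using M by (auto simp: wf_tm_def)
  show "wf_potm (dist_potm a M)"
    unfolding dist_potm_def using wf_distinguisher[OF M] ks x by (rule wf_potm_prog_potm)
  have code: "code_at (dist_potm a M) ?p 0 (psize ?p)"
    unfolding dist_potm_def using wf_distinguisher[OF M] ks x by (rule code_at_prog_potm)
  have fin: "\<exists>ts. potm_run (dist_potm a M) g n r = (psize ?p, ts) \<and>
      tape_word (ts ! 1) = (if 2 ^ (bit_length n * Suc a) \<le> val (y m (sub_fun n m g)) then [True] else [])"
    if r: "length r = dist_time a T n" and m: "m = ruler_length a n" for g n r m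
  proof -
    obtain ts where ts: "runs g ?p (init_tape (replicate n True) # replicate (tm_tapes M + 3) (init_tape [])) (dist_time a T n) ts"
      "tape_word (ts ! 1) = (if 2 ^ (bit_length n * Suc a) \<le> val (y m (sub_fun n m g)) then [True] else [])"
      using runs_distinguisher[of M m a n g T, OF M m out[OF sub_fun_boolfuns]] by blast
    let ?s = "potm_step (dist_potm a M) g True"
    obtain t where t: "t \<le> dist_time a T n"
      "(?s ^^ t) (0, init_tape (replicate n True) # replicate (tm_tapes M + 3) (init_tape [])) = (psize ?p, ts)"
      using runs_correct[OF ts(1) code] by blast
    have "init_config (dist_potm a M) (replicate n True) =
        (0, init_tape (replicate n True) # replicate (tm_tapes M + 3) (init_tape []))"
      by (simp add: init_config_def dist_potm_def prog_potm_def)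
    moreover have "?s (psize ?p, ts) = (psize ?p, ts)"
      by (simp add: potm_step_def halted_def dist_potm_def prog_potm_def)
    then have "(?s ^^ d) (psize ?p, ts) = (psize ?p, ts)" for d
      by (induction d) auto
    ultimately have "(?s ^^ (dist_time a T n - t + t)) (init_config (dist_potm a M) (replicate n True)) = (psize ?p, ts)"
      using t(2) unfolding funpow_add by simp
    then have "potm_run (dist_potm a M) g n r = (psize ?p, ts)"
      using t(1) r unfolding dist_potm_def potm_run_prog_potm by simp
    then show ?thesis using ts(2) by blast
  qed
  show "potm_time (dist_potm a M) (dist_time a T)"
    unfolding potm_time_def
  proof (intro allI ballI)
    fix n g r assume "r \<in> bvecs (dist_time a T n)"
    then obtain ts where "potm_run (dist_potm a M) g n r = (psize ?p, ts)"
      using fin[of r n] by (auto simp: bvecs_def)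
    then show "halted (dist_potm a M) (potm_run (dist_potm a M) g n r)"
      by (simp add: halted_def dist_potm_def prog_potm_def)
  qed
  assume "length r = dist_time a T n" "m = ruler_length a n"
  from fin[OF this, of g] show "potm_accepts (dist_potm a M) g n r \<longleftrightarrow>
      2 ^ (bit_length n * Suc a) \<le> val (y m (sub_fun n m g))"
    unfolding potm_accepts_def out_word_def by (auto split: if_splits)
qed

section \<open>Polynomial bounds\<close>

text \<open>The form \<open>(n + 2) ^ c\<close> is convenient for closure properties: exponents add
  under products, and the base is at least 2, so one additional factor absorbs a sum.\<close>

lemma poly_bounded_iff: "poly_bounded p \<longleftrightarrow> (\<exists>c. \<forall>n. p n \<le> (n + 2) ^ c)"
proof
  assume "poly_bounded p"
  then obtain c where c: "p n \<le> n ^ c + c" for n by (auto simp: poly_bounded_def)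
  have "p n \<le> (n + 2) ^ Suc c" for n
  proof -
    have "c \<le> 2 ^ c" by (rule less_imp_le[OF less_exp])
    also have "\<dots> \<le> (n + 2) ^ c" by (intro power_mono) auto
    finally have "n ^ c + c \<le> (n + 2) ^ c + (n + 2) ^ c" by (intro add_mono power_mono) auto
    also have "\<dots> \<le> (n + 2) ^ Suc c" by simp
    finally show ?thesis using c[of n] by linarith
  qed
  then show "\<exists>c. \<forall>n. p n \<le> (n + 2) ^ c" by blast
next
  assume "\<exists>c. \<forall>n. p n \<le> (n + 2) ^ c"
  then obtain c where c: "p n \<le> (n + 2) ^ c" for n by blast
  \<comment> \<open>For \<open>n \<ge> 2\<close> one has \<open>n + 2 \<le> n * n\<close>, whence
    the exponent \<open>2 * c\<close>; the summand \<open>3 ^ c\<close> takes care of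
    \<open>n < 2\<close>.\<close>
  define e where "e = 2 * c + 3 ^ c"
  have "p n \<le> n ^ e + e" for n
  proof (cases "n < 2")
    case True
    then have "(n + 2) ^ c \<le> 3 ^ c" by (intro power_mono) auto
    then show ?thesis using c[of n] by (simp add: e_def)
  next
    case False
    then have "n + 2 \<le> n * n" by (cases n; cases "n - 1") (auto simp: algebra_simps)
    then have "(n + 2) ^ c \<le> (n * n) ^ c" by (intro power_mono) auto
    also have "\<dots> = n ^ (2 * c)" by (simp add: power_mult power2_eq_square)
    also have "\<dots> \<le> n ^ e" using False by (intro power_increasing) (auto simp: e_def)
    finally show ?thesis using c[of n] by simp
  qed
  then show "poly_bounded p" by (auto simp: poly_bounded_def)
qed

lemma poly_bounded_mono:
  assumes "poly_bounded q" "\<And>n. p n \<le> q n"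
  shows "poly_bounded p"
  using assms unfolding poly_bounded_iff by (meson order_trans)

lemma poly_bounded_const: "poly_bounded (\<lambda>n. c)"
  unfolding poly_bounded_def by (intro exI[of _ c]) auto

lemma poly_bounded_id: "poly_bounded (\<lambda>n. n)"
  unfolding poly_bounded_def by (intro exI[of _ 1]) auto

lemma poly_bounded_mult:
  assumes "poly_bounded p" "poly_bounded q"
  shows "poly_bounded (\<lambda>n. p n * q n)"
proof -
  obtain c d where "p n \<le> (n + 2) ^ c" "q n \<le> (n + 2) ^ d" for n
    using assms unfolding poly_bounded_iff by blast
  then have "p n * q n \<le> (n + 2) ^ (c + d)" for n unfolding power_add by (intro mult_mono) auto
  then show ?thesis unfolding poly_bounded_iff by blast
qed

lemma poly_bounded_add:
  assumes "poly_bounded p" "poly_bounded q"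
  shows "poly_bounded (\<lambda>n. p n + q n)"
proof -
  obtain c d where cd: "p n \<le> (n + 2) ^ c" "q n \<le> (n + 2) ^ d" for n
    using assms unfolding poly_bounded_iff by blast
  have "p n + q n \<le> (n + 2) ^ Suc (max c d)" for n
  proof -
    have "(n + 2) ^ c \<le> (n + 2) ^ max c d" "(n + 2) ^ d \<le> (n + 2) ^ max c d"
      by (intro power_increasing; simp)+
    then have "p n + q n \<le> 2 * (n + 2) ^ max c d" using cd[of n] by linarith
    also have "\<dots> \<le> (n + 2) ^ Suc (max c d)" by simp
    finally show ?thesis .
  qed
  then show ?thesis unfolding poly_bounded_iff by blast
qed

lemma poly_bounded_power:
  assumes "poly_bounded p"
  shows "poly_bounded (\<lambda>n. p n ^ k)"
  using assms by (induction k) (simp_all add: poly_bounded_const poly_bounded_mult)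

lemma poly_bounded_two_power_ruler: "poly_bounded (\<lambda>n. 2 ^ ruler_length a n)"
proof (rule poly_bounded_mono)
  show "poly_bounded (\<lambda>n. (2 * n + 1) ^ (2 * a + 3))"
    by (intro poly_bounded_power poly_bounded_add poly_bounded_mult poly_bounded_const poly_bounded_id)
  show "2 ^ ruler_length a n \<le> (2 * n + 1) ^ (2 * a + 3)" for n
    unfolding ruler_length_def power_mult using two_power_bit_length_le by (rule power_mono) simp
qed

text \<open>\<open>T\<close> is exponential in the number of variables, and
  \<open>2 ^ ruler_length a n\<close> is polynomial. The finitely many arguments below
  \<open>n0\<close> are absorbed by a constant sum.\<close>

lemma poly_bounded_dist_time:
  assumes "exp_bounded T"
  shows "poly_bounded (dist_time a T)"
proof -
  obtain C n0 where T: "\<And>n. n0 \<le> n \<Longrightarrow> T n \<le> 2 ^ (C * n)"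
    using assms by (auto simp: exp_bounded_def)
  have "T n \<le> 2 ^ (C * n) + (\<Sum>i<n0. T i)" for n
  proof (cases "n0 \<le> n")
    case False
    then have "T n \<le> (\<Sum>i<n0. T i)" by (intro member_le_sum) auto
    then show ?thesis by simp
  qed (use T[of n] in simp)
  moreover have "(2::nat) ^ (C * ruler_length a n) = (2 ^ ruler_length a n) ^ C" for n
    by (simp add: mult.commute flip: power_mult)
  ultimately have le: "T (ruler_length a n) \<le> (2 ^ ruler_length a n) ^ C + (\<Sum>i<n0. T i)" for n
    by metis
  have "poly_bounded (\<lambda>n. (2 ^ ruler_length a n) ^ C + (\<Sum>i<n0. T i))"
    by (intro poly_bounded_add poly_bounded_power poly_bounded_two_power_ruler poly_bounded_const)
  from poly_bounded_mono[OF this le] have pT: "poly_bounded (\<lambda>n. T (ruler_length a n))" .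
  have pr: "poly_bounded (ruler_length a)"
    using poly_bounded_two_power_ruler[of a] by (rule poly_bounded_mono) (rule less_imp_le[OF less_exp])
  show ?thesis unfolding dist_time_def[abs_def]
    by (intro poly_bounded_add poly_bounded_mult poly_bounded_const poly_bounded_id
        poly_bounded_two_power_ruler pT pr)
qed

lemma bit_length_ge:
  assumes "2 ^ k \<le> 2 * n" shows "k \<le> bit_length n"
proof -
  have "2 ^ k < (2::nat) ^ Suc (bit_length n)" using assms less_two_power_bit_length[of n] by simp
  then have "k < Suc (bit_length n)" by (rule power_less_imp_less_exp[rotated]) simp
  then show ?thesis by simp
qed

text \<open>With \<open>c = 2 * a + 3\<close> and \<open>l\<close> the bit length: if
  \<open>l\<close> is large, then \<open>l * l \<le> 2 ^ l \<le> 2 * n + 1\<close> beats the linear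
  \<open>l * c\<close>; otherwise \<open>l * c\<close> is at most the constant in the
  hypothesis.\<close>

lemma ruler_length_le:
  assumes "(2 * (2 * a + 3) + 4) * (2 * a + 3) \<le> n"
  shows "ruler_length a n \<le> n"
proof -
  define c l where "c = 2 * a + 3" and "l = bit_length n"
  show ?thesis
  proof (cases "4 \<le> l \<and> 2 * c + 1 \<le> l")
    case True
    have "l * l \<le> 2 ^ l"
    proof -
      have "k * k \<le> 2 ^ k" if "4 \<le> k" for k :: nat
        using that
      proof (induction k rule: dec_induct)
        case (step k)
        have "4 * k \<le> k * k" using step.hyps by (intro mult_right_mono) auto
        then have "Suc k * Suc k \<le> 2 * (k * k)"
          using step.hyps unfolding mult_Suc mult_Suc_right by linarith
        then show ?case using step by simp
      qed simp
      then show ?thesis using True by simp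
    qed
    also have "\<dots> \<le> 2 * n + 1" unfolding l_def by (rule two_power_bit_length_le)
    finally have "l * l \<le> 2 * n + 1" .
    moreover have "l * (2 * c + 1) \<le> l * l" using True by (intro mult_left_mono) auto
    ultimately have "2 * (l * c) + l \<le> 2 * n + 1" by (simp add: algebra_simps)
    then have "l * c \<le> n" using True by simp
    then show ?thesis by (simp add: ruler_length_def c_def l_def)
  next
    case False
    then have "l * c \<le> (2 * c + 4) * c" by (intro mult_right_mono) auto
    also have "\<dots> \<le> n" using assms by (simp only: c_def)
    finally show ?thesis by (simp add: ruler_length_def c_def l_def)
  qed
qed

section \<open>Keyed functions are simple\<close>

text \<open>The key and the zero padding are wired into the circuit as constants, so the bound holds
  for every single key.\<close>

lemma mult_complexity_sub_fun_keyed: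
  assumes M: "wf_tm M"
    and out: "\<And>x. length x = n \<Longrightarrow> outputs_within M (k @ x) t [f n k x]"
    and k: "length k = n" and m: "m \<le> n"
  shows "mult_complexity m (sub_fun n m (keyed_fun f n k)) \<le> (t + 1) * step_cost M (t + 1)"
proof (rule mult_complexity_tm_le[OF M])
  let ?e = "\<lambda>x. k @ rev x @ replicate (n - m) False"
  show "length (?e x) = 2 * n" if "length x = m" for x using that k m by simp
  show "outputs_within M (?e x) t [sub_fun n m (keyed_fun f n k) x]" if "length x = m" for x
    using out[of "rev x @ replicate (n - m) False"] that m
    by (simp add: sub_fun_eq keyed_fun_def bvecs_def)
  fix i assume i: "i < 2 * n"
  consider "i < n" | "n \<le> i" "i < n + m" | "n + m \<le> i" by linarith
  then show "and_cost m {} 0 (\<lambda>x. ?e x ! i)"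
  proof cases
    case 1
    have "and_cost m {} 0 (\<lambda>x. k ! i)" by (rule and_cost_const)
    then show ?thesis by (rule and_cost_cong) (use 1 k in \<open>simp add: nth_append\<close>)
  next
    case 2
    have "and_cost m {} 0 (\<lambda>x. x ! (m - Suc (i - n)))" by (rule and_cost_input) (use 2 in simp)
    then show ?thesis by (rule and_cost_cong) (use 2 k in \<open>auto simp: nth_append rev_nth\<close>)
  next
    case 3
    have "and_cost m {} 0 (\<lambda>x. False)" by (rule and_cost_const)
    then show ?thesis by (rule and_cost_cong) (use 3 k i m in \<open>auto simp: nth_append\<close>)
  qed
qed

lemma poly_bounded_step_cost:
  assumes "poly_bounded p"
  shows "poly_bounded (\<lambda>n. (p n + 1) * step_cost M (p n + 1))"
  unfolding step_cost_def view_cost_def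
  by (intro poly_bounded_mult poly_bounded_add poly_bounded_const assms)

section \<open>Random functions are complex\<close>

definition funs_on :: "'a set \<Rightarrow> ('a \<Rightarrow> bool) set" where
  "funs_on A = {f. \<forall>x. x \<notin> A \<longrightarrow> \<not> f x}"

lemma boolfuns_eq_funs_on: "boolfuns n = funs_on (bvecs n)"
  by (simp add: boolfuns_def funs_on_def)

lemma funs_on_Pow: "funs_on A = (\<lambda>S x. x \<in> S) ` Pow A"
proof (intro equalityI subsetI)
  fix f assume "f \<in> funs_on A"
  then show "f \<in> (\<lambda>S x. x \<in> S) ` Pow A"
    by (intro image_eqI[of _ _ "Collect f"]) (auto simp: funs_on_def)
qed (auto simp: funs_on_def)

lemma card_funs_on:
  assumes "finite A"
  shows "finite (funs_on A)" "card (funs_on A) = 2 ^ card A"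
proof -
  have "inj_on (\<lambda>S x. x \<in> S) (Pow A)" by (auto simp: inj_on_def fun_eq_iff)
  then show "finite (funs_on A)" "card (funs_on A) = 2 ^ card A"
    using assms unfolding funs_on_Pow by (simp_all add: card_image card_Pow)
qed

lemma finite_boolfuns [simp]: "finite (boolfuns n)" and card_boolfuns: "card (boolfuns n) = 2 ^ 2 ^ n"
  unfolding boolfuns_eq_funs_on by (simp_all add: card_funs_on card_bvecs)

text \<open>The restriction of a uniformly random function is again uniform: \<open>g\<close>
  consists of its values on the \<open>2 ^ m\<close> queried points and, independently, of the
  values elsewhere. The form without division stays within the natural numbers.\<close>

lemma card_sub_fun_vimage:
  assumes m: "m \<le> n" and S: "S \<subseteq> boolfuns m"
  shows "card {g \<in> boolfuns n. sub_fun n m g \<in> S} * 2 ^ 2 ^ m \<le> card S * 2 ^ 2 ^ n"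
proof -
  define \<sigma> where "\<sigma> x = rev x @ replicate (n - m) False" for x :: "bool list"
  let ?I = "\<sigma> ` bvecs m"
  have "inj_on \<sigma> (bvecs m)" by (auto simp: inj_on_def \<sigma>_def)
  then have I: "?I \<subseteq> bvecs n" "card ?I = 2 ^ m"
    using m by (auto simp: card_image card_bvecs) (auto simp: \<sigma>_def bvecs_def)
  let ?R = "funs_on (bvecs n - ?I)"
  have cR: "card ?R = 2 ^ (2 ^ n - 2 ^ m)" "finite ?R"
    using I by (simp_all add: card_funs_on card_Diff_subset card_bvecs finite_subset[OF I(1)])
  let ?h = "\<lambda>g. (sub_fun n m g, \<lambda>x. g x \<and> x \<notin> ?I)"
  have sub: "sub_fun n m g x = g (\<sigma> x)" if "x \<in> bvecs m" for g x
    using that m by (simp add: sub_fun_eq \<sigma>_def bvecs_def)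
  have inj: "inj_on ?h {g \<in> boolfuns n. sub_fun n m g \<in> S}"
  proof (rule inj_onI)
    fix g g' assume eq: "?h g = ?h g'"
    have "g y = g' y" for y
    proof (cases "y \<in> ?I")
      case True
      then obtain x where x: "x \<in> bvecs m" "y = \<sigma> x" by blast
      have "sub_fun n m g x = sub_fun n m g' x" using eq by simp
      then show ?thesis using sub x by simp
    next
      case False
      have "snd (?h g) y = snd (?h g') y" using eq by (rule arg_cong)
      then show ?thesis using False by simp
    qed
    then show "g = g'" by blast
  qed
  have img: "?h ` {g \<in> boolfuns n. sub_fun n m g \<in> S} \<subseteq> S \<times> ?R"
    by (auto simp: funs_on_def boolfuns_eq_funs_on)
  have "finite (S \<times> ?R)" using cR finite_subset[OF S] by simp
  then have "card {g \<in> boolfuns n. sub_fun n m g \<in> S} \<le> card (S \<times> ?R)"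
    by (rule card_inj_on_le[OF inj img])
  also have "\<dots> = card S * 2 ^ (2 ^ n - 2 ^ m)" by (simp add: card_cartesian_product cR)
  finally have "card {g \<in> boolfuns n. sub_fun n m g \<in> S} * 2 ^ 2 ^ m \<le>
      card S * 2 ^ (2 ^ n - 2 ^ m) * 2 ^ 2 ^ m" by (rule mult_right_mono) simp
  also have "\<dots> = card S * 2 ^ 2 ^ n"
    using m by (simp add: mult.assoc flip: power_add)
  finally show ?thesis .
qed

text \<open>The left side is at most \<open>12 * s * s\<close>, and \<open>l \<ge> 4\<close>
  supplies a factor of 16. The coefficient \<open>2 * a + 3\<close> is chosen so that
  \<open>m\<close> exceeds twice the exponent of \<open>s\<close> by exactly
  \<open>l\<close>.\<close>

lemma exponent_bound:
  assumes l: "4 \<le> l" and s: "s = 2 ^ (l * Suc a)" and m: "m = l * (2 * a + 3)"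
  shows "(2 * s + 1) * (m + 1 + s) < 2 ^ m"
proof -
  have s1: "1 \<le> s" by (simp add: s)
  have "l * Suc a + 1 \<le> s" unfolding s using Suc_leI[OF less_exp[of "l * Suc a"]] by (simp only: Suc_eq_plus1)
  then have "3 * (l * Suc a) + 3 \<le> 3 * s" by simp
  moreover have "m \<le> 3 * (l * Suc a)" by (simp add: m algebra_simps)
  ultimately have "m + 1 + s \<le> 4 * s" by simp
  moreover have "2 * s + 1 \<le> 3 * s" using s1 by simp
  ultimately have "(2 * s + 1) * (m + 1 + s) \<le> 3 * s * (4 * s)" by (intro mult_mono) auto
  also have "\<dots> < 16 * (s * s)" using s1 by simp
  also have "\<dots> \<le> 2 ^ l * (s * s)"
    using power_increasing[OF l, of "2::nat"] by (intro mult_right_mono) auto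
  also have "\<dots> = 2 ^ (l + (l * Suc a + l * Suc a))" unfolding s by (simp only: power_add)
  also have "l + (l * Suc a + l * Suc a) = m" by (simp add: m algebra_simps)
  finally show ?thesis .
qed

lemma card_random_simple:
  assumes n: "8 \<le> n" and m: "m = ruler_length a n" "m \<le> n"
  shows "2 * card {g \<in> boolfuns n. mult_complexity m (sub_fun n m g) \<le> 2 ^ (bit_length n * Suc a)} \<le> card (boolfuns n)"
proof -
  let ?s = "2 ^ (bit_length n * Suc a)"
  let ?S = "{f \<in> boolfuns m. mult_complexity m f \<le> ?s}"
  let ?c = "card {g \<in> boolfuns n. sub_fun n m g \<in> ?S}"
  \<comment> \<open>This is where 8 comes from: \<open>2 ^ 4 \<le> 2 * 8\<close>.\<close>
  have "4 \<le> bit_length n" using n by (intro bit_length_ge) simp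
  from exponent_bound[OF this refl, of m a] m(1)
  \<comment> \<open>One spare unit in the exponent halves the count, and a half is all that is
    needed.\<close>
  have "Suc ((2 * ?s + 1) * (m + 1 + ?s)) \<le> 2 ^ m" by (simp add: ruler_length_def Suc_le_eq)
  then have "2 * 2 ^ ((2 * ?s + 1) * (m + 1 + ?s)) \<le> (2::nat) ^ 2 ^ m"
    using power_increasing[of _ _ "2::nat"] by (metis one_le_numeral power_Suc)
  moreover have "card ?S \<le> 2 ^ ((2 * ?s + 1) * (m + 1 + ?s))" by (rule card_mult_complexity_le)
  ultimately have S: "2 * card ?S \<le> 2 ^ 2 ^ m" by linarith
  have "(2 * ?c) * 2 ^ 2 ^ m \<le> (2 * card ?S) * 2 ^ 2 ^ n"
    using card_sub_fun_vimage[OF m(2), of ?S] by (simp add: mult.assoc)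
  also have "\<dots> \<le> 2 ^ 2 ^ m * 2 ^ 2 ^ n" using S by (rule mult_right_mono) simp
  finally have "2 * ?c \<le> 2 ^ 2 ^ n" by (simp add: mult.commute)
  moreover have "{g \<in> boolfuns n. mult_complexity m (sub_fun n m g) \<le> ?s} = {g \<in> boolfuns n. sub_fun n m g \<in> ?S}"
    using sub_fun_boolfuns by auto
  ultimately show ?thesis by (simp add: card_boolfuns)
qed

section \<open>The distinguishing advantage\<close>

lemma bvecs_nonempty: "bvecs n \<noteq> {}"
  using card_bvecs[of n] by (metis card.empty power_not_zero zero_neq_numeral)

lemma boolfuns_nonempty: "boolfuns n \<noteq> {}"
  using card_boolfuns[of n] by (metis card.empty power_not_zero zero_neq_numeral)

lemma prob_keyed_eq_0:
  assumes "\<And>k r. length k = n \<Longrightarrow> length r = p n \<Longrightarrow> \<not> potm_accepts A (keyed_fun f n k) n r"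
  shows "prob_keyed f A p n = 0"
  unfolding prob_keyed_def measure_pmf_zero_iff
  using assms by (auto simp: bvecs_nonempty) (simp add: bvecs_def)

lemma prob_random_ge_half:
  assumes "\<And>g r. g \<in> boolfuns n - B \<Longrightarrow> length r = p n \<Longrightarrow> potm_accepts A g n r"
    and "2 * card (boolfuns n \<inter> B) \<le> card (boolfuns n)"
  shows "1 / 2 \<le> prob_random A p n"
proof -
  let ?G = "pmf_of_set (boolfuns n)"
  let ?P = "pair_pmf ?G (pmf_of_set (bvecs (p n)))"
  have "measure_pmf.prob ?G B = card (boolfuns n \<inter> B) / card (boolfuns n)"
    by (simp add: measure_pmf_of_set boolfuns_nonempty)
  also have "\<dots> \<le> 1 / 2"
    using of_nat_mono[OF assms(2), where 'a = real] boolfuns_nonempty[of n]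
    by (simp add: divide_simps card_gt_0_iff)
  finally have "1 / 2 \<le> measure_pmf.prob ?G (- B)"
    using measure_pmf.prob_compl[of B ?G] by (simp add: Compl_eq_Diff_UNIV)
  \<comment> \<open>The event concerns the oracle alone, so the probability passes to the pair
    through the first marginal.\<close>
  also have "\<dots> = measure_pmf.prob ?P (fst -` (- B))"
    by (subst map_fst_pair_pmf[of ?G "pmf_of_set (bvecs (p n))", symmetric]) (simp only: measure_map_pmf)
  also have "\<dots> = measure_pmf.prob ?P (fst -` (- B) \<inter> set_pmf ?P)"
    by (simp only: measure_Int_set_pmf)
  also have "\<dots> \<le> prob_random A p n"
    unfolding prob_random_def
    by (rule measure_pmf.finite_measure_mono)
      (auto simp: bvecs_nonempty boolfuns_nonempty intro!: assms(1), simp add: bvecs_def)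
  finally show ?thesis .
qed

lemma not_negligible:
  assumes "\<forall>\<^sub>F n in at_top. 1 / 2 \<le> \<nu> n"
  shows "\<not> negligible \<nu>"
proof
  assume "negligible \<nu>"
  then obtain h :: "nat \<Rightarrow> real" where h: "filterlim h at_top at_top"
    and ev: "\<forall>\<^sub>F n in at_top. \<nu> n \<le> real n powr (- h n)" by (auto simp: negligible_def)
  have "\<forall>\<^sub>F n in at_top. 1 \<le> h n" using h by (simp add: filterlim_at_top)
  \<comment> \<open>From 3 on, 1/n is strictly below the constant advantage 1/2.\<close>
  moreover have "\<forall>\<^sub>F n in at_top. (3::nat) \<le> n" by (rule eventually_ge_at_top)
  ultimately have "\<forall>\<^sub>F n::nat in at_top. False"
    using ev assms
  proof eventually_elim
    case (elim n)
    have "real n powr (- h n) \<le> real n powr (- 1)" using elim by (intro powr_mono) auto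
    also have "\<dots> \<le> 1 / 3" using elim by (simp add: powr_minus divide_simps)
    finally show ?case using elim by linarith
  qed
  then show False by simp
qed

text \<open>In powers of two the claim reads (1 - \<delta>)(2a + 3)/2 + 2d < a + 1 per unit of the
  bit length, that is, 4d + 1 < \<delta>(2a + 3). Since \<delta> > 0 is fixed before
  \<open>a\<close>, a large \<open>a\<close> achieves it.\<close>

lemma exponent_choice:
  assumes \<epsilon>: "0 < \<epsilon>" "\<epsilon> \<le> (2::real)"
  obtains a where "\<And>n m c :: nat. 1 \<le> n \<Longrightarrow> m = ruler_length a n \<Longrightarrow> c \<le> (n + 2) ^ d \<Longrightarrow>
    (2 - \<epsilon>) powr (real m / 2) * real c < 2 ^ (bit_length n * Suc a)"
proof -
  obtain \<delta> where \<delta>: "0 < \<delta>" "\<delta> \<le> 1" "2 - \<epsilon> \<le> 2 powr (1 - \<delta>)"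
  proof -
    show thesis
    proof (cases "\<epsilon> < 1")
      case True
      have "log 2 (2 - \<epsilon>) < 1" using assms True by (simp add: log_less_iff)
      then show thesis using assms True that[of "1 - log 2 (2 - \<epsilon>)"]
        by (simp add: zero_le_log_cancel_iff)
    next
      case False
      \<comment> \<open>The base is now at most 1, so \<delta> = 1 serves; this includes the base 0,
        where no logarithm is available.\<close>
      then show thesis using that[of 1] by simp
    qed
  qed
  obtain a :: nat where a: "(4 * real d + 1) / \<delta> < real a" using reals_Archimedean2 by blast
  show thesis
  proof (rule that[of a])
    fix n m c :: nat
    assume n: "1 \<le> n" and m: "m = ruler_length a n" and c: "c \<le> (n + 2) ^ d"
    define l where "l = bit_length n"
    have l: "1 \<le> l" unfolding l_def using n by (intro bit_length_ge) simp
    have "(2 - \<epsilon>) powr (real m / 2) \<le> (2 powr (1 - \<delta>)) powr (real m / 2)"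
      using \<delta> \<epsilon> by (intro powr_mono2) auto
    also have "\<dots> = 2 powr ((1 - \<delta>) * real m / 2)" by (simp add: powr_powr)
    finally have 1: "(2 - \<epsilon>) powr (real m / 2) \<le> 2 powr ((1 - \<delta>) * real m / 2)" .
    \<comment> \<open>The exponent is then enlarged to \<open>2 * l\<close>, so that the polynomial,
      too, is bounded by a power whose exponent is a multiple of \<open>l\<close>.\<close>
    have "n + 2 \<le> 2 ^ (l + 1)" using less_two_power_bit_length[of n] n by (simp add: l_def)
    also have "\<dots> \<le> 2 ^ (2 * l)" using l by (intro power_increasing) auto
    finally have "(n + 2) ^ d \<le> (2 ^ (2 * l)) ^ d" by (rule power_mono) simp
    then have "c \<le> 2 ^ (2 * l * d)" using c by (simp add: power_mult)
    then have "real c \<le> 2 ^ (2 * l * d)" by (metis of_nat_le_iff of_nat_numeral of_nat_power)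
    then have 2: "real c \<le> 2 powr (real (2 * l * d))" by (simp only: powr_realpow zero_less_numeral)
    have "(2 - \<epsilon>) powr (real m / 2) * real c \<le> 2 powr ((1 - \<delta>) * real m / 2) * 2 powr (real (2 * l * d))"
      using 1 2 by (intro mult_mono) auto
    also have "\<dots> = 2 powr ((1 - \<delta>) * real m / 2 + real (2 * l * d))" by (simp only: powr_add)
    also have "\<dots> < 2 powr (real (l * Suc a))"
    proof (rule powr_less_mono)
      have "4 * real d + 1 < \<delta> * real a" using a \<delta> by (simp add: divide_simps mult.commute)
      also have "\<dots> \<le> \<delta> * (2 * real a + 3)" using \<delta> by (intro mult_left_mono) auto
      finally have "(1 - \<delta>) * (2 * real a + 3) / 2 + 2 * real d < real (Suc a)"
        by (simp add: field_simps)
      then have "real l * ((1 - \<delta>) * (2 * real a + 3) / 2 + 2 * real d) < real l * real (Suc a)"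
        using l by (intro mult_strict_left_mono) auto
      then show "(1 - \<delta>) * real m / 2 + real (2 * l * d) < real (l * Suc a)"
        by (simp add: m ruler_length_def l_def algebra_simps)
    qed simp
    also have "\<dots> = 2 ^ (l * Suc a)" by (simp only: powr_realpow zero_less_numeral)
    finally show "(2 - \<epsilon>) powr (real m / 2) * real c < 2 ^ (bit_length n * Suc a)" by (simp add: l_def)
  qed
qed

theorem theorem2:
  fixes \<epsilon> :: real
  assumes "\<exists>f. prf_family f"
    and "0 < \<epsilon>" and "\<epsilon> \<le> 2"
  shows "\<not> (\<exists>(M :: tm) T \<rho>. wf_tm M \<and> exp_bounded T \<and>
              (\<forall>n. \<rho> n \<le> (2 - \<epsilon>) powr (real n / 2)) \<and> approximates_mc M T \<rho>)"
proof
  assume "\<exists>(M :: tm) T \<rho>. wf_tm M \<and> exp_bounded T \<and>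
              (\<forall>n. \<rho> n \<le> (2 - \<epsilon>) powr (real n / 2)) \<and> approximates_mc M T \<rho>"
  then obtain M :: tm and T \<rho> where M: "wf_tm M" and T: "exp_bounded T"
    and \<rho>: "\<And>n. \<rho> n \<le> (2 - \<epsilon>) powr (real n / 2)" and appr: "approximates_mc M T \<rho>"
    by blast
  have "\<forall>m. \<forall>f \<in> boolfuns m. \<exists>y. outputs_within M (truth_table m f) (T m) y \<and>
      real (val y) \<in> {real (mult_complexity m f) .. \<rho> m * real (mult_complexity m f)}"
    using appr by (simp add: approximates_mc_def)
  then obtain y where y: "\<And>m f. f \<in> boolfuns m \<Longrightarrow> outputs_within M (truth_table m f) (T m) (y m f)"
    and val: "\<And>m f. f \<in> boolfuns m \<Longrightarrow>
      real (val (y m f)) \<in> {real (mult_complexity m f) .. \<rho> m * real (mult_complexity m f)}"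
    by metis
  obtain f where f: "prf_family f" using assms(1) by blast
  then obtain M0 p0 where M0: "wf_tm M0" "poly_bounded p0"
    and out0: "\<And>n k x. length k = n \<Longrightarrow> length x = n \<Longrightarrow> outputs_within M0 (k @ x) (p0 n) [f n k x]"
    unfolding prf_family_def poly_time_family_def bvecs_def by blast
  obtain d where d: "(p0 n + 1) * step_cost M0 (p0 n + 1) \<le> (n + 2) ^ d" for n
    using poly_bounded_step_cost[OF M0(2)] unfolding poly_bounded_iff by blast
  \<comment> \<open>The order of the choices matters: the degree \<open>d\<close> belongs to the
    function family, \<open>a\<close> depends on \<open>d\<close> and \<epsilon>, and only then is
    the distinguisher built.\<close>
  obtain a where a: "\<And>n m c :: nat. 1 \<le> n \<Longrightarrow> m = ruler_length a n \<Longrightarrow> c \<le> (n + 2) ^ d \<Longrightarrow>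
      (2 - \<epsilon>) powr (real m / 2) * real c < 2 ^ (bit_length n * Suc a)"
    using exponent_choice[OF assms(2,3)] by blast
  let ?A = "dist_potm a M" and ?p = "dist_time a T"
  have accepts: "potm_accepts ?A g n r \<longleftrightarrow>
      2 ^ (bit_length n * Suc a) \<le> val (y (ruler_length a n) (sub_fun n (ruler_length a n) g))"
    if "length r = ?p n" for g n r
    using dist_potm_correct(3)[OF M, of T y] y that by blast
  have "1 / 2 \<le> \<bar>prob_keyed f ?A ?p n - prob_random ?A ?p n\<bar>"
    \<comment> \<open>The first bound makes random functions complex, the second ensures that
      \<open>m\<close> variables are available.\<close>
    if n: "max 8 ((2 * (2 * a + 3) + 4) * (2 * a + 3)) \<le> n" for n
  proof -
    define m where "m = ruler_length a n"
    have mn: "m \<le> n" unfolding m_def using n by (intro ruler_length_le) simp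
    let ?t = "2 ^ (bit_length n * Suc a) :: nat"
    have "prob_keyed f ?A ?p n = 0"
    proof (rule prob_keyed_eq_0)
      fix k r :: "bool list" assume k: "length k = n" and r: "length r = ?p n"
      let ?f = "sub_fun n m (keyed_fun f n k)"
      have "mult_complexity m ?f \<le> (n + 2) ^ d"
        using mult_complexity_sub_fun_keyed[of M0 n k "p0 n" f, OF M0(1) out0[OF k] k mn] d[of n] by (rule order_trans)
      have "real (val (y m ?f)) \<le> \<rho> m * real (mult_complexity m ?f)"
        using val[OF sub_fun_boolfuns] by simp
      also have "\<dots> \<le> (2 - \<epsilon>) powr (real m / 2) * real (mult_complexity m ?f)"
        using \<rho> by (intro mult_right_mono) auto
      also have "\<dots> < 2 ^ (bit_length n * Suc a)"
        using n \<open>mult_complexity m ?f \<le> (n + 2) ^ d\<close> by (intro a) (auto simp: m_def)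
      finally have "val (y m ?f) < ?t" by (metis of_nat_less_iff of_nat_numeral of_nat_power)
      then show "\<not> potm_accepts ?A (keyed_fun f n k) n r" using accepts[OF r] by (simp add: m_def)
    qed
    moreover have "1 / 2 \<le> prob_random ?A ?p n"
    proof (rule prob_random_ge_half)
      let ?B = "{g. mult_complexity m (sub_fun n m g) \<le> ?t}"
      show "2 * card (boolfuns n \<inter> ?B) \<le> card (boolfuns n)"
        using card_random_simple[OF _ m_def mn] n by (simp add: Int_def)
      fix g and r :: "bool list" assume g: "g \<in> boolfuns n - ?B" and r: "length r = ?p n"
      \<comment> \<open>Random functions use the lower end of the approximation interval, keyed
        functions its upper end.\<close>
      have "real (mult_complexity m (sub_fun n m g)) \<le> real (val (y m (sub_fun n m g)))"
        using val[OF sub_fun_boolfuns] by simp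
      then show "potm_accepts ?A g n r" using g accepts[OF r] by (simp add: m_def)
    qed
    ultimately show ?thesis by simp
  qed
  then have "\<forall>\<^sub>F n in at_top. 1 / 2 \<le> \<bar>prob_keyed f ?A ?p n - prob_random ?A ?p n\<bar>"
    unfolding eventually_at_top_linorder by blast
  then have "\<not> negligible (\<lambda>n. \<bar>prob_keyed f ?A ?p n - prob_random ?A ?p n\<bar>)"
    by (rule not_negligible)
  moreover have "wf_potm ?A" "potm_time ?A ?p"
    using dist_potm_correct(1,2)[OF M, of T y] y by blast+
  ultimately show False
    using f poly_bounded_dist_time[OF T] unfolding prf_family_def by blast
qed

end
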